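(* Let $A>0$ and $\rho>0$. There is a constant $C=C(\rho,A)$ such that for every $\alpha\in(0,A]$, $\beta>0$, $L\in\mathbb N$ with $L\ge\beta^2$, every $\ell\in\mathbb N$ with $\ell\ge2$, every $T>0$, $t\in[0,T]$ and every $v\in C^\infty([0,T];\ell^1(\mathbb Z))$, $$\mathbf E_{\rho,L}\bigg[\bigg(\int_0^t\sum_{x\in\mathbb Z}\tau_x\big(\mathfrak f(\eta(s))-\mathcal Q_\rho(\ell,\eta(s))\big)v_{s,x}\,ds\bigg)^2\bigg]\le\frac{C}{\alpha^3L^2}\bigg(\frac1\alpha+\frac{\ell^2}{\alpha\ell+1}+\frac{tL^2}{\ell^2}\bigg)\int_0^t\|v_{s,\cdot}\|_{\ell^2(\mathbb Z)}^2\,ds,$$ where $\mathfrak f(\eta)=(\eta_0-\rho)(\eta_1-\rho)$ and $$\mathcal Q_\rho(\ell,\eta)=\big(\overline\eta_0^\ell-\rho\big)^2-\frac{\chi(\rho)}\ell,\qquad\overline\eta_0^\ell=\frac1\ell\sum_{y=0}^{\ell-1}\eta_y .$$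
   Context: **The process.** Fix $\alpha,\beta,\rho>0$ and $L\in\mathbb N$ with $L\ge\beta^2$. Put $p_L=\frac12(1+L^{-1/2}\beta)$, $q_L=\frac12(1-L^{-1/2}\beta)$, $c_L(x,x+1)=p_L$, $c_L(x,x-1)=q_L$, and $c_L(x,y)=0$ otherwise. Let $\Omega=\mathbb N_0^{\mathbb Z}$ with the product topology, and $\eta^{x,y}_z=\eta_z+\delta_{y,z}-\delta_{x,z}$. On bounded local $f:\Omega\to\mathbb R$ (depending on finitely many coordinates), $$\mathcal G_Lf(\eta)=L^2\sum_{x,y\in\mathbb Z}c_L(x,y)\,\eta_x(\alpha+\eta_y)\,[f(\eta^{x,y})-f(\eta)].$$ Let $\nu_\rho$ be the product measure on $\Omega$ with one-site marginal proportional to $\frac{\Gamma(\alpha+n)}{n!\,\Gamma(\alpha)}\big(\frac{\rho}{\alpha+\rho}\big)^n$, $n\in\mathbb N_0$; it has mean $\rho$ and variance $\chi(\rho)=\rho+\rho^2/\alpha$. For $K\in\mathbb N$ let $\mathbb T_K=\{-K,\dots,K\}$ be the discrete torus, $\nu_\rho^{\mathbb T_K}$ the product measure on $\mathbb N_0^{\mathbb T_K}$ with the same marginals, and $\eta^{(K)}$ the stationary continuous-time Markov chain on $\mathbb N_0^{\mathbb T_K}$ started from $\nu_\rho^{\mathbb T_K}$ in which a particle jumps from $x$ to $x\pm1$ (mod $2K+1$) at rate $L^2p_L\eta_x(\alpha+\eta_{x+1})$, resp. $L^2q_L\eta_x(\alpha+\eta_{x-1})$. Extended periodically to $\mathbb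 Z$, the laws of $\eta^{(K)}$ converge weakly in $D([0,\infty);\mathbb N_0^{\mathbb Z})$ as $K\to\infty$; $\mathbf P_{\rho,L}$ denotes the limit law, $\mathbf E_{\rho,L}$ its expectation, and $(\eta(t))_{t\ge0}$ the coordinate process. It is stationary with one-time marginal $\nu_\rho$ and solves the martingale problem for $\mathcal G_L$ on bounded local functions. **Shifts.** $(\tau_x\eta)_y=\eta_{x+y}$ and $(\tau_xf)(\eta)=f(\tau_x\eta)$. *)

theory Defs
  imports "HOL-Probability.Probability"
begin

type_synonym config = "int \<Rightarrow> nat"

section \<open>Path space and weak convergence\<close>

text \<open>
  A path on \<open>[0,\<infinity>)\<close> is a function on \<^typ>\<open>real\<close> that is \<^const>\<open>undefined\<close> off \<open>{0..}\<close>, so that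
  each path has exactly one representative.
\<close>

definition cadlag_paths :: "(real \<Rightarrow> 'a::topological_space) set" where
  "cadlag_paths = {w \<in> extensional {0..}.
     (\<forall>t\<ge>0. (w \<longlongrightarrow> w t) (at_right t)) \<and> (\<forall>t>0. \<exists>l. (w \<longlongrightarrow> l) (at_left t))}"

text \<open>
  The sigma-algebra generated by the coordinates; for Polish state spaces it is the Borel
  sigma-algebra of the Skorokhod topology below.
\<close>

definition path_space :: "(real \<Rightarrow> 'a::topological_space) measure" where
  "path_space = restrict_space (PiM {0..} (\<lambda>_. borel)) cadlag_paths"

text \<open>Increasing bijections of \<open>[0,\<infinity>)\<close>; these are automatically continuous and fix \<open>0\<close>.\<close>

definition time_changes :: "(real \<Rightarrow> real) set" where
  "time_changes = {l. strict_mono_on {0..} l \<and> bij_betw l {0..} {0..}}"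

text \<open>
  Uniform convergence on compact time intervals up to a time change. Uniformity on
  \<^typ>\<open>config\<close> is that of the product: uniform convergence of every coordinate.
\<close>

definition skorokhod_converges ::
    "(nat \<Rightarrow> real \<Rightarrow> config) \<Rightarrow> (real \<Rightarrow> config) \<Rightarrow> bool" where
  "skorokhod_converges X w \<longleftrightarrow>
     (\<exists>l. (\<forall>n. l n \<in> time_changes) \<and>
          (\<forall>T>0. uniform_limit {0..T} l (\<lambda>t. t) sequentially \<and>
                 (\<forall>z. uniform_limit {0..T} (\<lambda>n t. real (X n (l n t) z)) (\<lambda>t. real (w t z))
                        sequentially)))"

text \<open>
  The Skorokhod (J1) topology is metrizable, hence it is the topology whose open sets are the
  sequentially open sets for its convergent sequences.
\<close>

definition skorokhod_topology :: "(real \<Rightarrow> config) topology" where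
  "skorokhod_topology = topology (\<lambda>U. U \<subseteq> cadlag_paths \<and>
     (\<forall>w\<in>U. \<forall>X. (\<forall>n. X n \<in> cadlag_paths) \<and> skorokhod_converges X w \<longrightarrow>
        (\<forall>\<^sub>F n in sequentially. X n \<in> U)))"

lemma openin_skorokhod_topology:
  "openin skorokhod_topology U \<longleftrightarrow> U \<subseteq> cadlag_paths \<and>
     (\<forall>w\<in>U. \<forall>X. (\<forall>n. X n \<in> cadlag_paths) \<and> skorokhod_converges X w \<longrightarrow>
        (\<forall>\<^sub>F n in sequentially. X n \<in> U))" (is "_ \<longleftrightarrow> ?P U")
proof -
  have "istopology ?P"
    unfolding istopology_def
  proof (intro conjI allI impI)
    fix S T assume "?P S" "?P T"
    then show "S \<inter> T \<subseteq> cadlag_paths" by blast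
    show "\<forall>w\<in>S \<inter> T. \<forall>X. (\<forall>n. X n \<in> cadlag_paths) \<and> skorokhod_converges X w \<longrightarrow>
        (\<forall>\<^sub>F n in sequentially. X n \<in> S \<inter> T)"
      using \<open>?P S\<close> \<open>?P T\<close> by (auto simp: eventually_conj_iff)
  next
    fix \<K> assume *: "\<forall>K\<in>\<K>. ?P K"
    then show "\<Union>\<K> \<subseteq> cadlag_paths" by blast
    show "\<forall>w\<in>\<Union>\<K>. \<forall>X. (\<forall>n. X n \<in> cadlag_paths) \<and> skorokhod_converges X w \<longrightarrow>
        (\<forall>\<^sub>F n in sequentially. X n \<in> \<Union>\<K>)"
    proof (intro ballI allI impI)
      fix w X assume "w \<in> \<Union>\<K>" and X: "(\<forall>n. X n \<in> cadlag_paths) \<and> skorokhod_converges X w"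
      then obtain K where K: "K \<in> \<K>" "w \<in> K" by blast
      with * X have "\<forall>\<^sub>F n in sequentially. X n \<in> K" by blast
      then show "\<forall>\<^sub>F n in sequentially. X n \<in> \<Union>\<K>"
        by (rule eventually_mono) (use K in blast)
    qed
  qed
  then show ?thesis
    by (simp add: skorokhod_topology_def topology_inverse')
qed

definition skorokhod_weakly_converges ::
    "(nat \<Rightarrow> (real \<Rightarrow> config) measure) \<Rightarrow> (real \<Rightarrow> config) measure \<Rightarrow> bool" where
  "skorokhod_weakly_converges N P \<longleftrightarrow>
     (\<forall>F :: (real \<Rightarrow> config) \<Rightarrow> real.
        continuous_map skorokhod_topology euclideanreal F \<and> bounded (F ` cadlag_paths) \<longrightarrow>
        (\<lambda>n. \<integral>w. F w \<partial>N n) \<longlonglongrightarrow> (\<integral>w. F w \<partial>P))"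

section \<open>Continuous-time Markov chains\<close>

text \<open>
  \<open>q x y\<close> is the jump rate from \<open>x\<close> to \<open>y\<close>. The last clause is the Kolmogorov backward equation.
\<close>

definition markov_transition_function ::
    "'s set \<Rightarrow> ('s \<Rightarrow> 's \<Rightarrow> real) \<Rightarrow> (real \<Rightarrow> 's \<Rightarrow> 's \<Rightarrow> real) \<Rightarrow> bool" where
  "markov_transition_function S q p \<longleftrightarrow>
     (\<forall>t\<ge>0. \<forall>x\<in>S. (\<forall>y\<in>S. 0 \<le> p t x y) \<and> (p t x has_sum 1) S) \<and>
     (\<forall>x\<in>S. \<forall>y\<in>S. p 0 x y = of_bool (x = y)) \<and>
     (\<forall>s\<ge>0. \<forall>t\<ge>0. \<forall>x\<in>S. \<forall>z\<in>S. ((\<lambda>y. p s x y * p t y z) has_sum p (s + t) x z) S) \<and>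
     (\<forall>t\<ge>0. \<forall>x\<in>S. \<forall>y\<in>S.
        ((\<lambda>s. p s x y) has_real_derivative (\<Sum>\<^sub>\<infinity>z\<in>S. q x z * (p t z y - p t x y)))
          (at t within {0..}))"

text \<open>
  \<open>N\<close> is the law of a chain with state space \<open>S\<close>, jump rates \<open>q\<close> and initial law \<open>\<mu>\<close>.
\<close>

definition markov_chain_law ::
    "'s::topological_space set \<Rightarrow> ('s \<Rightarrow> 's \<Rightarrow> real) \<Rightarrow> 's measure \<Rightarrow> (real \<Rightarrow> 's) measure \<Rightarrow> bool"
  where
  "markov_chain_law S q \<mu> N \<longleftrightarrow>
     prob_space N \<and> sets N = sets path_space \<and>
     (\<exists>p. markov_transition_function S q p \<and>
        (\<forall>n (t :: nat \<Rightarrow> real) x.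
           t 0 = 0 \<and> (\<forall>i<n. t i \<le> t (Suc i)) \<and> (\<forall>i\<le>n. x i \<in> S) \<longrightarrow>
           measure N {w \<in> space N. \<forall>i\<le>n. w (t i) = x i} =
             measure \<mu> {x 0} * (\<Prod>i<n. p (t (Suc i) - t i) (x i) (x (Suc i)))))"

section \<open>The particle system\<close>

definition p_rate :: "real \<Rightarrow> nat \<Rightarrow> real" where
  "p_rate \<beta> L = 1 / 2 * (1 + \<beta> / sqrt (real L))"

definition q_rate :: "real \<Rightarrow> nat \<Rightarrow> real" where
  "q_rate \<beta> L = 1 / 2 * (1 - \<beta> / sqrt (real L))"

text \<open>
  The configuration \<open>\<eta>\<^sup>x\<^sup>,\<^sup>y\<close>. Truncated subtraction only matters if \<open>\<eta> x = 0\<close>, where all jump rates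
  out of \<open>x\<close> vanish.
\<close>

definition move :: "int \<Rightarrow> int \<Rightarrow> config \<Rightarrow> config" where
  "move x y \<eta> = (\<lambda>z. \<eta> z + of_bool (z = y) - of_bool (z = x))"

definition site_weight :: "real \<Rightarrow> real \<Rightarrow> nat \<Rightarrow> real" where
  "site_weight \<alpha> \<rho> n = Gamma (\<alpha> + real n) / (fact n * Gamma \<alpha>) * (\<rho> / (\<alpha> + \<rho>)) ^ n"

definition site_measure :: "real \<Rightarrow> real \<Rightarrow> nat measure" where
  "site_measure \<alpha> \<rho> =
     density (count_space UNIV) (\<lambda>n. ennreal (site_weight \<alpha> \<rho> n / (\<Sum>m. site_weight \<alpha> \<rho> m)))"

definition torus :: "nat \<Rightarrow> int set" where
  "torus K = {- int K..int K}"

definition torus_rep :: "nat \<Rightarrow> int \<Rightarrow> int" where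
  "torus_rep K z = (z + int K) mod (2 * int K + 1) - int K"

text \<open>Configurations on the torus are \<^const>\<open>undefined\<close> off the sites \<open>-K, \<dots>, K\<close>.\<close>

definition torus_configs :: "nat \<Rightarrow> config set" where
  "torus_configs K = (torus K \<rightarrow>\<^sub>E UNIV)"

definition torus_measure :: "real \<Rightarrow> real \<Rightarrow> nat \<Rightarrow> config measure" where
  "torus_measure \<alpha> \<rho> K = PiM (torus K) (\<lambda>_. site_measure \<alpha> \<rho>)"

definition torus_rate :: "real \<Rightarrow> real \<Rightarrow> nat \<Rightarrow> nat \<Rightarrow> config \<Rightarrow> config \<Rightarrow> real" where
  "torus_rate \<alpha> \<beta> L K \<eta> \<xi> =
     (\<Sum>x\<in>torus K. let r = torus_rep K (x + 1); l = torus_rep K (x - 1) in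
        (real L)\<^sup>2 * p_rate \<beta> L * real (\<eta> x) * (\<alpha> + real (\<eta> r)) * of_bool (\<xi> = move x r \<eta>) +
        (real L)\<^sup>2 * q_rate \<beta> L * real (\<eta> x) * (\<alpha> + real (\<eta> l)) * of_bool (\<xi> = move x l \<eta>))"

definition periodize :: "nat \<Rightarrow> config \<Rightarrow> config" where
  "periodize K \<eta> = (\<lambda>z. \<eta> (torus_rep K z))"

definition periodize_law :: "nat \<Rightarrow> (real \<Rightarrow> config) measure \<Rightarrow> (real \<Rightarrow> config) measure" where
  "periodize_law K N = distr N path_space (\<lambda>w. \<lambda>t\<in>{0..}. periodize K (w t))"

text \<open>
  \<open>P\<close> is the law \<open>\<^bold>P\<^bsub>\<rho>,L\<^esub>\<close>. The torus with \<open>K = 0\<close> is left out,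
  since its single site has no neighbours.
\<close>

definition limit_law ::
    "real \<Rightarrow> real \<Rightarrow> real \<Rightarrow> nat \<Rightarrow> (real \<Rightarrow> config) measure \<Rightarrow> bool" where
  "limit_law \<alpha> \<beta> \<rho> L P \<longleftrightarrow>
     prob_space P \<and> sets P = sets path_space \<and>
     (\<exists>N. (\<forall>K\<ge>1. markov_chain_law (torus_configs K) (torus_rate \<alpha> \<beta> L K)
                     (torus_measure \<alpha> \<rho> K) (N K)) \<and>
          skorokhod_weakly_converges (\<lambda>K. periodize_law K (N K)) P)"

section \<open>Observables\<close>

definition shift :: "int \<Rightarrow> config \<Rightarrow> config" where
  "shift x \<eta> = (\<lambda>y. \<eta> (x + y))"

definition shift_fun :: "int \<Rightarrow> (config \<Rightarrow> real) \<Rightarrow> config \<Rightarrow> real" where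
  "shift_fun x f = (\<lambda>\<eta>. f (shift x \<eta>))"

definition chi :: "real \<Rightarrow> real \<Rightarrow> real" where
  "chi \<alpha> \<rho> = \<rho> + \<rho>\<^sup>2 / \<alpha>"

definition local_product :: "real \<Rightarrow> config \<Rightarrow> real" where
  "local_product \<rho> \<eta> = (real (\<eta> 0) - \<rho>) * (real (\<eta> 1) - \<rho>)"

definition block_average :: "nat \<Rightarrow> config \<Rightarrow> real" where
  "block_average l \<eta> = 1 / real l * (\<Sum>y<l. real (\<eta> (int y)))"

definition block_quadratic :: "real \<Rightarrow> real \<Rightarrow> nat \<Rightarrow> config \<Rightarrow> real" where
  "block_quadratic \<alpha> \<rho> l \<eta> = (block_average l \<eta> - \<rho>)\<^sup>2 - chi \<alpha> \<rho> / real l"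

section \<open>Smooth functions with values in \<open>\<ell>\<^sup>1\<close>\<close>

definition ell1 :: "(int \<Rightarrow> real) set" where
  "ell1 = {u. (\<lambda>x. \<bar>u x\<bar>) summable_on UNIV}"

definition ell1_norm :: "(int \<Rightarrow> real) \<Rightarrow> real" where
  "ell1_norm u = (\<Sum>\<^sub>\<infinity>x. \<bar>u x\<bar>)"

definition ell2_norm :: "(int \<Rightarrow> real) \<Rightarrow> real" where
  "ell2_norm u = sqrt (\<Sum>\<^sub>\<infinity>x. (u x)\<^sup>2)"

definition has_ell1_derivative ::
    "(real \<Rightarrow> int \<Rightarrow> real) \<Rightarrow> (int \<Rightarrow> real) \<Rightarrow> real \<Rightarrow> real set \<Rightarrow> bool" where
  "has_ell1_derivative u u' s S \<longleftrightarrow>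
     ((\<lambda>r. ell1_norm (\<lambda>x. (u r x - u s x) / (r - s) - u' x)) \<longlongrightarrow> 0) (at s within S)"

text \<open>\<open>D k\<close> is the derivative of order \<open>k\<close>, one-sided at the end points.\<close>

definition smooth_ell1 :: "real \<Rightarrow> (real \<Rightarrow> int \<Rightarrow> real) \<Rightarrow> bool" where
  "smooth_ell1 T v \<longleftrightarrow>
     (\<exists>D. (\<forall>s\<in>{0..T}. D 0 s = v s) \<and>
          (\<forall>k. \<forall>s\<in>{0..T}. D k s \<in> ell1 \<and> has_ell1_derivative (D k) (D (Suc k) s) s {0..T}))"

end

theory Submission
  imports Defs "HOL-Real_Asymp.Real_Asymp"
begin

text \<open>
  Write \<open>\<xi>\<^sub>x = \<eta>\<^sub>x - \<rho>\<close> and let \<open>M\<close> be the average of \<open>\<xi>\<^sub>0, \<dots>, \<xi>\<^bsub>l-1\<^esub>\<close> and \<open>M'\<close> that of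
  \<open>\<xi>\<^sub>1, \<dots>, \<xi>\<^bsub>l-1\<^esub>\<close>. The difference of the local product and the block quadratic is
  \<open>\<xi>\<^sub>0 (\<xi>\<^sub>1 - M') + (\<xi>\<^sub>0 - M) M + (\<xi>\<^sub>0 M' - \<xi>\<^sub>0\<^sup>2 + \<chi>) / l\<close>. In the first two terms the brackets
  telescope into discrete gradients \<open>\<eta>\<^sub>z - \<eta>\<^bsub>z+1\<^esub>\<close>
  (\<open>block_replacement_identity\<close>, \<open>sum_observable_decomposition\<close>). The last term has mean zero and a
  variance of order \<open>\<alpha>\<^sup>-\<^sup>3 l\<^sup>-\<^sup>2\<close>, its shifts split into two families of orthogonal functions
  (\<open>remainder_bound\<close>), and Cauchy--Schwarz in time turns it into the contribution \<open>t / (\<alpha>\<^sup>3 l\<^sup>2)\<close>.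

  Gradients gain a factor \<open>L\<^sup>-\<^sup>2\<close> from the fast dynamics. Detailed balance for the inclusion rates gives
  \<open>\<alpha> \<langle>(\<eta>\<^sub>z - \<eta>\<^bsub>z+1\<^esub>) h, u\<rangle> = \<langle>\<eta>\<^sub>z (\<alpha> + \<eta>\<^bsub>z+1\<^esub>) h, u - u(\<eta>\<^bsup>z,z+1\<^esup>)\<rangle>\<close> whenever \<open>h\<close> does not change
  when a particle jumps from \<open>z\<close> to \<open>z + 1\<close> (\<open>bond_pairing\<close>). By Cauchy--Schwarz the pairing of the
  gradient part with \<open>u\<close> is then controlled by the Dirichlet form of \<open>u\<close>, with the constant
  \<open>4 / (\<alpha>\<^sup>2 L\<^sup>2)\<close> times \<open>\<Sum>\<^sub>z E[\<eta>\<^sub>z (\<alpha> + \<eta>\<^bsub>z+1\<^esub>) h\<^sub>z\<^sup>2]\<close> (\<open>bond_sum_bound\<close>). All telescoping weights lie in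
  \<open>[0, 1]\<close>, so this sum is at most a constant times \<open>(l / \<alpha> + \<alpha>\<^sup>-\<^sup>2) \<Sum>\<^sub>x v\<^sub>x\<^sup>2\<close> (\<open>flux_bound\<close>), and
  \<open>l \<le> (A + 1) l\<^sup>2 / (\<alpha> l + 1)\<close> (\<open>constant_bound\<close>).

  A static bound of this kind controls time integrals of a stationary chain, reversible or not
  (\<open>kipnis_varadhan\<close>): \<open>u\<^sub>s = \<integral>\<^sub>s\<^sup>t P\<^bsub>r-s\<^esub> F\<^sub>r dr\<close> solves \<open>u' = - F - G u\<close> with \<open>u\<^sub>t = 0\<close>, the second
  moment of \<open>\<integral> F\<^sub>s(\<eta>(s)) ds\<close> is \<open>2 \<integral> \<langle>F\<^sub>s, u\<^sub>s\<rangle> ds\<close>, and the energy identity for \<open>u\<close> bounds the time integral of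
  its Dirichlet form by that same pairing. Only two-time marginals enter. On the torus the particle
  number is conserved, so everything is carried out on the finite set of configurations with at most
  \<open>M\<close> particles, and \<open>M \<rightarrow> \<infinity>\<close> by Fatou's lemma (\<open>torus_second_moment\<close>).

  The time integral of a local observable is continuous along Skorokhod convergent sequences, even if
  the observable is unbounded, because coordinates of cadlag paths are bounded on compact intervals.
  Moment bounds that are uniform in the torus therefore pass to the limit law
  (\<open>weak_limit_bound\<close>, \<open>limit_law_bound\<close>). A first moment bound shows that almost surely the sums over
  \<open>\<bar>x\<bar> \<le> n\<close> converge to the full series inside the time integral (\<open>limit_path_integral_tendsto\<close>), and
  Fatou's lemma concludes.
\<close>

section \<open>The one-site law and its moments\<close>

text \<open>
  Having all absolute moments is preserved by sums and products, which makes the integrability of every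
  polynomial in the occupation numbers a matter of closure rules.
\<close>

definition all_moments :: "'a pmf \<Rightarrow> ('a \<Rightarrow> real) \<Rightarrow> bool" where
  "all_moments p f \<longleftrightarrow> (\<forall>k. integrable (measure_pmf p) (\<lambda>x. \<bar>f x\<bar> ^ k))"

lemma all_moments_bound:
  assumes "all_moments p f" "all_moments p g"
    and "\<And>k x. \<bar>h x\<bar> ^ k \<le> c k * (\<bar>f x\<bar> ^ m k + \<bar>g x\<bar> ^ m k)"
  shows "all_moments p h"
  unfolding all_moments_def
proof
  fix k
  show "integrable (measure_pmf p) (\<lambda>x. \<bar>h x\<bar> ^ k)"
  proof (rule Bochner_Integration.integrable_bound)
    show "integrable (measure_pmf p) (\<lambda>x. c k * (\<bar>f x\<bar> ^ m k + \<bar>g x\<bar> ^ m k))"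
      using assms(1,2) by (auto simp: all_moments_def)
  qed (use assms(3) in \<open>auto intro!: always_eventually order_trans[OF assms(3)]\<close>)
qed

lemma all_moments_integrable: "all_moments p f \<Longrightarrow> integrable (measure_pmf p) f"
  unfolding all_moments_def by (drule spec[of _ 1]) (simp add: integrable_abs_iff)

lemma all_moments_const: "all_moments p (\<lambda>_. c)"
  by (auto simp: all_moments_def)

lemma all_moments_add:
  assumes "all_moments p f" "all_moments p g"
  shows "all_moments p (\<lambda>x. f x + g x)"
proof (rule all_moments_bound[OF assms, of _ "\<lambda>k. 2 ^ k" "\<lambda>k. k"])
  fix k x
  have "\<bar>f x + g x\<bar> ^ k \<le> (2 * max \<bar>f x\<bar> \<bar>g x\<bar>) ^ k" by (rule power_mono) auto
  also have "\<dots> \<le> 2 ^ k * (\<bar>f x\<bar> ^ k + \<bar>g x\<bar> ^ k)"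
    by (auto simp: power_mult_distrib max_def)
  finally show "\<bar>f x + g x\<bar> ^ k \<le> 2 ^ k * (\<bar>f x\<bar> ^ k + \<bar>g x\<bar> ^ k)" .
qed

lemma all_moments_mult:
  assumes "all_moments p f" "all_moments p g"
  shows "all_moments p (\<lambda>x. f x * g x)"
proof (rule all_moments_bound[OF assms, of _ "\<lambda>k. 1" "\<lambda>k. 2 * k"])
  fix k x
  have "2 * (\<bar>f x\<bar> ^ k * \<bar>g x\<bar> ^ k) \<le> (\<bar>f x\<bar> ^ k)\<^sup>2 + (\<bar>g x\<bar> ^ k)\<^sup>2"
    using sum_squares_bound[of "\<bar>f x\<bar> ^ k" "\<bar>g x\<bar> ^ k"] by simp
  moreover have "0 \<le> \<bar>f x\<bar> ^ k * \<bar>g x\<bar> ^ k" by simp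
  ultimately have "\<bar>f x\<bar> ^ k * \<bar>g x\<bar> ^ k \<le> (\<bar>f x\<bar> ^ k)\<^sup>2 + (\<bar>g x\<bar> ^ k)\<^sup>2" by linarith
  then show "\<bar>f x * g x\<bar> ^ k \<le> 1 * (\<bar>f x\<bar> ^ (2 * k) + \<bar>g x\<bar> ^ (2 * k))"
    by (simp add: abs_mult power_mult_distrib power_even_eq)
qed

lemma all_moments_diff:
  assumes "all_moments p f" "all_moments p g"
  shows "all_moments p (\<lambda>x. f x - g x)"
  using all_moments_add[OF assms(1) all_moments_mult[OF all_moments_const[of p "-1"] assms(2)]]
  by simp

lemma all_moments_power:
  assumes "all_moments p f" shows "all_moments p (\<lambda>x. f x ^ n)"
  by (induction n) (use assms in \<open>auto intro: all_moments_const all_moments_mult\<close>)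

lemma all_moments_sum:
  assumes "\<And>i. i \<in> I \<Longrightarrow> all_moments p (f i)"
  shows "all_moments p (\<lambda>x. \<Sum>i\<in>I. f i x)"
  using assms
  by (induction I rule: infinite_finite_induct) (auto intro: all_moments_const all_moments_add)

lemmas all_moments_intros = all_moments_const all_moments_add all_moments_mult all_moments_diff
  all_moments_power all_moments_sum

lemma all_moments_map_pmf:
  assumes "all_moments (map_pmf h p) f" shows "all_moments p (\<lambda>x. f (h x))"
  using assms unfolding all_moments_def by (simp add: map_pmf_rep_eq integrable_distr_eq)

lemma expectation_pair_pmf_mult:
  fixes f :: "'a \<Rightarrow> real" and g :: "'b \<Rightarrow> real"
  assumes "integrable (measure_pmf p) f" "integrable (measure_pmf q) g"
  shows "measure_pmf.expectation (pair_pmf p q) (\<lambda>(x, y). f x * g y) =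
    measure_pmf.expectation p f * measure_pmf.expectation q g"
proof -
  have E: "measure_pmf.expectation r h = infsetsum (\<lambda>x. pmf r x * h x) (set_pmf r)"
    for r and h :: "'c \<Rightarrow> real"
    unfolding pmf_expectation_eq_infsetsum
    by (intro infsetsum_cong_neutral) (auto simp: set_pmf_eq)
  have *: "Infinite_Set_Sum.abs_summable_on (\<lambda>x. pmf r x * h x) (set_pmf r)" if "integrable (measure_pmf r) h"
    for r and h :: "'c \<Rightarrow> real"
  proof -
    have "Infinite_Set_Sum.abs_summable_on (\<lambda>x. pmf r x * h x) UNIV"
      using that unfolding measure_pmf_eq_density abs_summable_on_def
      by (subst (asm) integrable_density) auto
    then show ?thesis by (rule Infinite_Set_Sum.abs_summable_on_subset) simp
  qed
  have "measure_pmf.expectation (pair_pmf p q) (\<lambda>(x, y). f x * g y) =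
      infsetsum (\<lambda>z. pmf (pair_pmf p q) z * (case z of (x, y) \<Rightarrow> f x * g y)) (set_pmf p \<times> set_pmf q)"
    by (simp add: E)
  also have "\<dots> = infsetsum (\<lambda>(x, y). (pmf p x * f x) * (pmf q y * g y)) (set_pmf p \<times> set_pmf q)"
    by (intro infsetsum_cong) (auto simp: pmf_pair)
  also have "\<dots> = measure_pmf.expectation p f * measure_pmf.expectation q g"
    unfolding E by (rule infsetsum_product) (use * assms in auto)
  finally show ?thesis .
qed

text \<open>
  The coordinate \<open>x\<close> is split off the product measure; that \<open>f\<close> ignores it is expressed by invariance under
  updates, so that products of observables of disjoint sites can be evaluated one site at a time.
\<close>

lemma expectation_Pi_pmf_factor:
  fixes f :: "('a \<Rightarrow> 'b) \<Rightarrow> real"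
  assumes A: "finite A" "x \<in> A"
    and f: "\<And>\<eta> k. f (\<eta>(x := k)) = f \<eta>" "integrable (measure_pmf (Pi_pmf A d p)) f"
    and g: "integrable (measure_pmf (p x)) g"
  shows "measure_pmf.expectation (Pi_pmf A d p) (\<lambda>\<eta>. f \<eta> * g (\<eta> x)) =
    measure_pmf.expectation (Pi_pmf A d p) f * measure_pmf.expectation (p x) g"
proof -
  define B where "B = A - {x}"
  have AB: "A = insert x B" "finite B" "x \<notin> B" using A by (auto simp: B_def)
  have eq: "Pi_pmf A d p = map_pmf (\<lambda>(y, \<eta>). \<eta>(x := y)) (pair_pmf (p x) (Pi_pmf B d p))"
    using AB by (simp add: Pi_pmf_insert)
  have "integrable (measure_pmf (pair_pmf (p x) (Pi_pmf B d p))) (\<lambda>z. f (snd z))"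
    using f unfolding eq map_pmf_rep_eq
    by (subst (asm) integrable_distr_eq) (auto simp: case_prod_beta)
  then have fB: "integrable (measure_pmf (Pi_pmf B d p)) f"
    by (subst map_snd_pair_pmf[symmetric, of _ "p x"], unfold map_pmf_rep_eq)
      (subst integrable_distr_eq, auto)
  have "measure_pmf.expectation (Pi_pmf A d p) (\<lambda>\<eta>. f \<eta> * h (\<eta> x)) =
      measure_pmf.expectation (Pi_pmf B d p) f * measure_pmf.expectation (p x) h"
    if "integrable (measure_pmf (p x)) h" for h :: "'b \<Rightarrow> real"
    unfolding eq using expectation_pair_pmf_mult[OF that fB] f
    by (simp add: split_def mult.commute)
  from this[OF g] this[of "\<lambda>_. 1"] show ?thesis by simp
qed

lemma sum_pmf_le_expectation:
  assumes "finite C" "integrable (measure_pmf p) f" "\<And>x. 0 \<le> f x"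
  shows "(\<Sum>x\<in>C. pmf p x * f x) \<le> measure_pmf.expectation p f"
proof -
  have "(\<Sum>x\<in>C. pmf p x * f x) = (\<Sum>x\<in>C. (f x * indicator C x) * pmf p x)"
    by (intro sum.cong) auto
  also have "\<dots> = measure_pmf.expectation p (\<lambda>x. f x * indicator C x)"
    by (rule integral_measure_pmf_real[symmetric]) (use assms(1) in \<open>auto split: split_indicator_asm\<close>)
  also have "\<dots> \<le> measure_pmf.expectation p f"
    using assms(2,3) by (intro integral_mono integrable_real_mult_indicator)
     (auto split: split_indicator)
  finally show ?thesis .
qed

locale inclusion_law =
  fixes \<alpha> \<rho> :: real
  assumes alpha_pos: "0 < \<alpha>" and rho_pos: "0 < \<rho>"
begin

abbreviation "\<phi> \<equiv> \<rho> / (\<alpha> + \<rho>)"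

lemma phi_range: "0 < \<phi>" "\<phi> < 1"
  using alpha_pos rho_pos by auto

lemma site_weight_pos: "0 < site_weight \<alpha> \<rho> n"
  using alpha_pos rho_pos by (auto simp: site_weight_def intro!: mult_pos_pos divide_pos_pos)

text \<open>
  The recursion of the negative binomial weights. It is the source both of the moment formulas and of
  detailed balance.
\<close>

lemma site_weight_Suc:
  "real (Suc n) * site_weight \<alpha> \<rho> (Suc n) = \<phi> * (\<alpha> + real n) * site_weight \<alpha> \<rho> n"
proof -
  have "Gamma (\<alpha> + real (Suc n)) = (\<alpha> + real n) * Gamma (\<alpha> + real n)"
    using Gamma_plus1[of "\<alpha> + real n"] alpha_pos
    by (auto simp: add_ac nonpos_Ints_def)
  then show ?thesis
    unfolding site_weight_def by (simp add: divide_simps del: of_nat_Suc)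
qed

lemma summable_site_weight_power: "summable (\<lambda>n. (1 + real n) ^ k * site_weight \<alpha> \<rho> n)"
proof -
  \<comment> \<open>the ratio of consecutive terms, which tends to \<open>\<phi> < 1\<close>\<close>
  define r where "r n = ((2 + real n) / (1 + real n)) ^ k * (\<phi> * ((\<alpha> + real n) / (1 + real n)))" for n
  have 1: "(\<lambda>n. (2 + real n) / (1 + real n)) \<longlonglongrightarrow> 1" by real_asymp
  have 2: "(\<lambda>n. (\<alpha> + real n) / (1 + real n)) \<longlonglongrightarrow> 1" by real_asymp
  have "r \<longlonglongrightarrow> 1 ^ k * (\<phi> * 1)"
    unfolding r_def by (intro tendsto_intros 1 2)
  then have "\<forall>\<^sub>F n in sequentially. r n < (1 + \<phi>) / 2"
    using phi_range by (intro order_tendstoD(2)[of r \<phi>]) (simp_all only: power_one mult_1 mult_1_right, argo)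
  then obtain N where N: "\<And>n. n \<ge> N \<Longrightarrow> r n < (1 + \<phi>) / 2"
    by (auto simp: eventually_sequentially)
  show ?thesis
  proof (rule summable_ratio_test)
    show "(1 + \<phi>) / 2 < 1" using phi_range by simp
    fix n assume n: "n \<ge> N"
    let ?f = "\<lambda>n. (1 + real n) ^ k * site_weight \<alpha> \<rho> n"
    have pos: "0 < ?f n" for n using site_weight_pos[of n] by (simp add: add_pos_nonneg)
    have "site_weight \<alpha> \<rho> (Suc n) = \<phi> * ((\<alpha> + real n) / (1 + real n)) * site_weight \<alpha> \<rho> n"
    proof -
      have "(1 + real n) * site_weight \<alpha> \<rho> (Suc n) = \<phi> * (\<alpha> + real n) * site_weight \<alpha> \<rho> n"
        using site_weight_Suc[of n] by simp
      then have "site_weight \<alpha> \<rho> (Suc n) = \<phi> * (\<alpha> + real n) * site_weight \<alpha> \<rho> n / (1 + real n)"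
        by (subst nonzero_eq_divide_eq) (auto simp: mult.commute)
      then show ?thesis by simp
    qed
    moreover have "(2 + real n) ^ k = ((2 + real n) / (1 + real n)) ^ k * (1 + real n) ^ k"
      by (simp add: power_divide)
    ultimately have "?f (Suc n) = r n * ?f n"
      unfolding r_def by (simp add: mult_ac)
    also have "\<dots> \<le> (1 + \<phi>) / 2 * ?f n"
      using N[OF n] pos[of n] by (intro mult_right_mono) auto
    finally show "norm (?f (Suc n)) \<le> (1 + \<phi>) / 2 * norm (?f n)"
      using pos[of n] pos[of "Suc n"] by (simp only: real_norm_def abs_of_pos)
  qed
qed

text \<open>
  The negative binomial series has a closed form, but only the ratios of consecutive weights matter.
\<close>

definition Z :: real where "Z = (\<Sum>n. site_weight \<alpha> \<rho> n)"

lemma summable_site_weight: "summable (site_weight \<alpha> \<rho>)"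
  using summable_site_weight_power[of 0] by simp

lemma Z_pos: "0 < Z"
  unfolding Z_def by (rule suminf_pos) (auto simp: summable_site_weight site_weight_pos)

definition site_pmf :: "nat pmf" where
  "site_pmf = embed_pmf (\<lambda>n. site_weight \<alpha> \<rho> n / Z)"

lemma site_weight_normalised:
  "(\<integral>\<^sup>+n. ennreal (site_weight \<alpha> \<rho> n / Z) \<partial>count_space UNIV) = 1"
proof -
  have "(\<lambda>n. site_weight \<alpha> \<rho> n / Z) sums (Z / Z)"
    unfolding Z_def by (intro sums_divide summable_sums summable_site_weight)
  then have "(\<lambda>n. site_weight \<alpha> \<rho> n / Z) sums 1" using Z_pos by simp
  then show ?thesis
    using Z_pos site_weight_pos
    by (simp add: nn_integral_count_space_nat suminf_ennreal2 sums_iff less_imp_le)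
qed

lemma pmf_site: "pmf site_pmf n = site_weight \<alpha> \<rho> n / Z"
  unfolding site_pmf_def using Z_pos site_weight_pos
  by (intro pmf_embed_pmf site_weight_normalised) (auto simp: less_imp_le)

lemma pmf_site_pos: "0 < pmf site_pmf n"
  using Z_pos site_weight_pos by (simp add: pmf_site)

lemma site_measure_eq: "site_measure \<alpha> \<rho> = measure_pmf site_pmf"
  by (simp add: site_measure_def measure_pmf_eq_density pmf_site Z_def)

lemma pmf_site_Suc:
  "(\<alpha> + \<rho>) * (real (Suc n) * pmf site_pmf (Suc n)) = \<rho> * ((\<alpha> + real n) * pmf site_pmf n)"
  using site_weight_Suc[of n] alpha_pos rho_pos Z_pos
  by (simp add: pmf_site field_simps del: of_nat_Suc)

lemma integrable_site_pmf_iff: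
  fixes g :: "nat \<Rightarrow> real"
  shows "integrable (measure_pmf site_pmf) g \<longleftrightarrow> summable (\<lambda>n. \<bar>pmf site_pmf n * g n\<bar>)"
  unfolding measure_pmf_eq_density
  by (subst integrable_density) (auto simp: integrable_count_space_nat_iff)

lemma expectation_site_sums:
  fixes g :: "nat \<Rightarrow> real"
  assumes "integrable (measure_pmf site_pmf) g"
  shows "(\<lambda>n. pmf site_pmf n * g n) sums measure_pmf.expectation site_pmf g"
proof -
  have "integrable (count_space UNIV) (\<lambda>n. pmf site_pmf n * g n)"
    using assms unfolding measure_pmf_eq_density by (subst (asm) integrable_density) auto
  from sums_integral_count_space_nat[OF this] show ?thesis
    unfolding measure_pmf_eq_density by (subst integral_density) auto
qed

lemma all_moments_site: "all_moments site_pmf real"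
  unfolding all_moments_def integrable_site_pmf_iff
proof
  fix k
  show "summable (\<lambda>n. \<bar>pmf site_pmf n * \<bar>real n\<bar> ^ k\<bar>)"
  proof (rule summable_comparison_test)
    show "summable (\<lambda>n. (1 + real n) ^ k * site_weight \<alpha> \<rho> n / Z)"
      by (intro summable_divide summable_site_weight_power)
    have "real n ^ k \<le> (1 + real n) ^ k" for n by (intro power_mono) auto
    then show "\<exists>N. \<forall>n\<ge>N. norm \<bar>pmf site_pmf n * \<bar>real n\<bar> ^ k\<bar> \<le> (1 + real n) ^ k * site_weight \<alpha> \<rho> n / Z"
      using Z_pos site_weight_pos
      by (intro exI[of _ 0]) (auto simp: pmf_site abs_mult less_imp_le mult.commute intro!: divide_right_mono mult_right_mono)
  qed
qed

text \<open>
  Summation by parts with the weight recursion. Each use lowers the degree of \<open>g\<close> by one, so centred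
  moments of any order follow recursively, with explicit dependence on \<open>\<alpha>\<close>.
\<close>

lemma stein:
  assumes g: "all_moments site_pmf g" and g': "all_moments site_pmf (\<lambda>n. g (Suc n))"
  shows "measure_pmf.expectation site_pmf (\<lambda>n. (real n - \<rho>) * g n) =
    \<rho> / \<alpha> * measure_pmf.expectation site_pmf (\<lambda>n. (\<alpha> + real n) * (g (Suc n) - g n))"
    (is "?E (\<lambda>n. (real n - \<rho>) * g n) = _")
proof -
  have i1: "integrable (measure_pmf site_pmf) (\<lambda>n. real n * g n)"
    using g by (intro all_moments_integrable all_moments_intros all_moments_site)
  have i2: "integrable (measure_pmf site_pmf) (\<lambda>n. (\<alpha> + real n) * g (Suc n))"
    using g' by (intro all_moments_integrable all_moments_intros all_moments_site)
  have i3: "integrable (measure_pmf site_pmf) g"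
    using g by (intro all_moments_integrable all_moments_intros all_moments_site)
  have "(\<lambda>n. pmf site_pmf (Suc n) * (real (Suc n) * g (Suc n))) sums ?E (\<lambda>n. real n * g n)"
    using expectation_site_sums[OF i1] by (subst sums_Suc_iff) simp
  moreover have "pmf site_pmf (Suc n) * (real (Suc n) * g (Suc n)) =
      \<phi> * (pmf site_pmf n * ((\<alpha> + real n) * g (Suc n)))" for n
  proof -
    have "real (Suc n) * pmf site_pmf (Suc n) = \<phi> * ((\<alpha> + real n) * pmf site_pmf n)"
      using pmf_site_Suc[of n] alpha_pos rho_pos by (simp add: field_simps del: of_nat_Suc)
    then show ?thesis by (metis mult.assoc mult.commute)
  qed
  ultimately have "?E (\<lambda>n. real n * g n) = \<phi> * ?E (\<lambda>n. (\<alpha> + real n) * g (Suc n))"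
    using sums_mult[OF expectation_site_sums[OF i2], of \<phi>] by (simp add: sums_unique2)
  then have "(\<alpha> + \<rho>) * ?E (\<lambda>n. real n * g n) = \<rho> * ?E (\<lambda>n. (\<alpha> + real n) * g (Suc n))"
    using alpha_pos rho_pos by (simp add: field_simps)
  moreover have "?E (\<lambda>n. (real n - \<rho>) * g n) = ?E (\<lambda>n. real n * g n) - \<rho> * ?E g"
    using i1 i3 by (simp add: left_diff_distrib)
  moreover have "?E (\<lambda>n. (\<alpha> + real n) * (g (Suc n) - g n)) =
      ?E (\<lambda>n. (\<alpha> + real n) * g (Suc n)) - \<alpha> * ?E g - ?E (\<lambda>n. real n * g n)"
  proof -
    have "(\<lambda>n. (\<alpha> + real n) * (g (Suc n) - g n)) =
        (\<lambda>n. (\<alpha> + real n) * g (Suc n) - \<alpha> * g n - real n * g n)"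
      by (auto simp: algebra_simps)
    then show ?thesis using i1 i2 i3 by simp
  qed
  moreover have "(\<alpha> + \<rho>) * N = \<rho> * S \<Longrightarrow> X = N - \<rho> * G \<Longrightarrow> Y = S - \<alpha> * G - N \<Longrightarrow> \<alpha> * X = \<rho> * Y"
    for N S X G Y :: real by algebra
  ultimately have "\<alpha> * ?E (\<lambda>n. (real n - \<rho>) * g n) =
      \<rho> * ?E (\<lambda>n. (\<alpha> + real n) * (g (Suc n) - g n))"
    by blast
  moreover have "\<alpha> * a = \<rho> * b \<Longrightarrow> a = \<rho> / \<alpha> * b" for a b :: real
    using alpha_pos by (simp add: field_simps)
  ultimately show ?thesis by blast
qed

abbreviation xi :: "nat \<Rightarrow> real" where "xi n \<equiv> real n - \<rho>"

lemma all_moments_xi: "all_moments site_pmf xi"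
  by (intro all_moments_intros all_moments_site)

lemma integrable_xi [simp]:
  "integrable (measure_pmf site_pmf) real" "integrable (measure_pmf site_pmf) xi"
  "integrable (measure_pmf site_pmf) (\<lambda>n. xi n ^ k)"
  by (intro all_moments_integrable all_moments_intros all_moments_site)+


text \<open>
  The third and fourth central moments of the site law, of order \<open>\<alpha>\<^sup>-\<^sup>2\<close> and \<open>\<alpha>\<^sup>-\<^sup>3\<close> as \<open>\<alpha>\<close> tends to zero.
\<close>

definition kappa3 :: real where "kappa3 = \<rho> / \<alpha> * (2 * chi \<alpha> \<rho> + \<alpha> + \<rho>)"
definition mu4 :: real where "mu4 = \<rho> / \<alpha> * (3 * kappa3 + 3 * chi \<alpha> \<rho> + 3 * (\<alpha> + \<rho>) * chi \<alpha> \<rho> + \<alpha> + \<rho>)"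

lemma chi_eq: "chi \<alpha> \<rho> = \<rho> * (\<alpha> + \<rho>) / \<alpha>"
  using alpha_pos by (simp add: chi_def field_simps power2_eq_square)

lemma expectation_xi: "measure_pmf.expectation site_pmf xi = 0"
  using stein[of "\<lambda>_. 1"] by (simp add: all_moments_const)

lemma expectation_real: "measure_pmf.expectation site_pmf real = \<rho>"
  using expectation_xi by (simp del: integrable_xi add: integrable_xi(1))

lemma expectation_xi2: "measure_pmf.expectation site_pmf (\<lambda>n. xi n ^ 2) = chi \<alpha> \<rho>"
proof -
  have "all_moments site_pmf (\<lambda>n. xi (Suc n))"
    using all_moments_add[OF all_moments_xi all_moments_const[of _ 1]] by (simp add: algebra_simps)
  from stein[OF all_moments_xi this] show ?thesis
    by (simp add: power2_eq_square expectation_real chi_eq)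
qed

lemma expectation_xi3: "measure_pmf.expectation site_pmf (\<lambda>n. xi n ^ 3) = kappa3"
proof -
  have "all_moments site_pmf (\<lambda>n. (xi n + 1)\<^sup>2)" by (intro all_moments_intros all_moments_site)
  then have "all_moments site_pmf (\<lambda>n. xi (Suc n) ^ 2)" by (simp add: algebra_simps)
  from stein[OF all_moments_power[OF all_moments_xi] this]
  have "measure_pmf.expectation site_pmf (\<lambda>n. xi n ^ 3) =
    \<rho> / \<alpha> * measure_pmf.expectation site_pmf (\<lambda>n. 2 * xi n ^ 2 + (2 * (\<alpha> + \<rho>) + 1) * xi n + (\<alpha> + \<rho>))"
    by (simp add: power3_eq_cube power2_eq_square algebra_simps)
  also have "\<dots> = kappa3"
    by (simp add: expectation_xi2 expectation_xi kappa3_def del: right_diff_distrib_numeral)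
  finally show ?thesis .
qed

lemma expectation_xi4: "measure_pmf.expectation site_pmf (\<lambda>n. xi n ^ 4) = mu4"
proof -
  have "all_moments site_pmf (\<lambda>n. (xi n + 1) ^ 3)" by (intro all_moments_intros all_moments_site)
  then have "all_moments site_pmf (\<lambda>n. xi (Suc n) ^ 3)" by (simp add: algebra_simps)
  from stein[OF all_moments_power[OF all_moments_xi] this]
  have "measure_pmf.expectation site_pmf (\<lambda>n. xi n ^ 4) =
    \<rho> / \<alpha> * measure_pmf.expectation site_pmf (\<lambda>n. (\<alpha> + real n) * (xi (Suc n) ^ 3 - xi n ^ 3))"
    by (simp add: power3_eq_cube power4_eq_xxxx algebra_simps)
  also have "(\<lambda>n. (\<alpha> + real n) * (xi (Suc n) ^ 3 - xi n ^ 3)) =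
      (\<lambda>n. 3 * xi n ^ 3 + 3 * xi n ^ 2 + 3 * (\<alpha> + \<rho>) * xi n ^ 2 + (3 * (\<alpha> + \<rho>) + 1) * xi n + (\<alpha> + \<rho>))"
    by (auto simp: algebra_simps power3_eq_cube power2_eq_square)
  also have "\<rho> / \<alpha> * measure_pmf.expectation site_pmf \<dots> = mu4"
    by (simp add: expectation_xi3 expectation_xi2 expectation_xi mu4_def del: right_diff_distrib_numeral)
  finally show ?thesis .
qed

end

section \<open>The block decomposition and product expectations\<close>

lemma telescoping_average:
  fixes g :: "nat \<Rightarrow> real"
  assumes "0 < m"
  shows "g 0 - (\<Sum>y<m. g y) / real m =
    (\<Sum>y<m-1. (1 - (real y + 1) / real m) * (g y - g (Suc y)))"
proof -
  have "real m * g 0 - (\<Sum>y<m. g y) = (\<Sum>y<m-1. (real m - (real y + 1)) * (g y - g (Suc y)))"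
    using assms
  proof (induction m)
    case (Suc m)
    show ?case
    proof (cases "m = 0")
      case False
      then obtain k where k: "m = Suc k" by (cases m) auto
      have "(\<Sum>y<m. (real (Suc m) - (real y + 1)) * (g y - g (Suc y))) =
          (\<Sum>y<m. (real m - (real y + 1)) * (g y - g (Suc y))) + (\<Sum>y<m. g y - g (Suc y))"
        by (simp add: sum.distrib[symmetric] algebra_simps)
      also have "(\<Sum>y<m. g y - g (Suc y)) = g 0 - g m" by (rule sum_lessThan_telescope')
      also have "(\<Sum>y<m. (real m - (real y + 1)) * (g y - g (Suc y))) =
          (\<Sum>y<m-1. (real m - (real y + 1)) * (g y - g (Suc y)))"
        by (simp add: k)
      also have "\<dots> = real m * g 0 - (\<Sum>y<m. g y)" using Suc.IH False by simp
      finally show ?thesis by (simp add: algebra_simps)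
    qed simp
  qed simp
  then have "(real m * g 0 - (\<Sum>y<m. g y)) / real m =
      (\<Sum>y<m-1. (real m - (real y + 1)) * (g y - g (Suc y)) / real m)"
    by (simp add: sum_divide_distrib)
  moreover have "(real m - (real y + 1)) * d / real m = (1 - (real y + 1) / real m) * d" for y d
    using assms by (simp add: field_simps)
  ultimately show ?thesis using assms by (simp add: diff_divide_distrib)
qed

text \<open>
  Telescoping weights of the two replacements: \<open>coef_pair\<close> for \<open>\<xi>\<^sub>1\<close> minus the average over the sites
  \<open>1, \<dots>, l - 1\<close>, hence no gradient across the bond from \<open>0\<close> to \<open>1\<close>; \<open>coef_block\<close> for \<open>\<xi>\<^sub>0\<close> minus the
  average over the whole block.
\<close>

definition coef_pair :: "nat \<Rightarrow> nat \<Rightarrow> real" where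
  "coef_pair l y = (if y = 0 then 0 else 1 - real y / (real l - 1))"

definition coef_block :: "nat \<Rightarrow> nat \<Rightarrow> real" where
  "coef_block l y = 1 - (real y + 1) / real l"

lemma coef_pair_sq_le: "y < l - 1 \<Longrightarrow> (coef_pair l y)\<^sup>2 \<le> 1"
  unfolding abs_square_le_1 coef_pair_def by (auto simp: abs_le_iff field_simps)

lemma coef_block_sq_le: "y < l - 1 \<Longrightarrow> (coef_block l y)\<^sup>2 \<le> 1"
  unfolding abs_square_le_1 coef_block_def by (auto simp: abs_le_iff field_simps)

text \<open>
  The factor next to the gradient across \<open>(y, y + 1)\<close> contains \<open>g 0\<close> only for \<open>y \<ge> 1\<close>, and otherwise the
  average over a block that contains both ends of the bond. A particle jump across the bond changes
  neither, which is what the integration by parts needs.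
\<close>

lemma block_replacement_identity:
  fixes g :: "nat \<Rightarrow> real"
  assumes l: "2 \<le> l"
  defines "avg \<equiv> (\<Sum>y<l. g y) / real l"
  shows "g 0 * g 1 - (avg\<^sup>2 - c / real l) =
    (\<Sum>y<l-1. (g y - g (Suc y)) * (coef_pair l y * g 0 + coef_block l y * avg)) +
    (g 0 * (\<Sum>y\<in>{1..<l}. g y) / (real l * (real l - 1)) - ((g 0)\<^sup>2 - c) / real l)"
proof -
  define s where "s = (\<Sum>y\<in>{1..<l}. g y)"
  have sl: "(\<Sum>y<l. g y) = g 0 + s"
    using l by (simp add: s_def lessThan_atLeast0 sum.atLeast_Suc_lessThan)
  have B: "g 0 - avg = (\<Sum>y<l-1. coef_block l y * (g y - g (Suc y)))"
    using telescoping_average[of l g] l by (simp add: avg_def coef_block_def)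
  have "(\<Sum>y<l-1. g (Suc y)) = s"
    unfolding s_def lessThan_atLeast0
    using sum.shift_bounds_Suc_ivl[of g 0 "l-1"] l by simp
  then have "g 1 - s / (real l - 1) = (\<Sum>y<l-2. (1 - (real y + 1) / (real l - 1)) * (g (Suc y) - g (Suc (Suc y))))"
    using telescoping_average[of "l-1" "\<lambda>y. g (Suc y)"] l by (simp add: of_nat_diff numeral_2_eq_2)
  also have "\<dots> = (\<Sum>y<l-2. coef_pair l (Suc y) * (g (Suc y) - g (Suc (Suc y))))"
    by (simp add: coef_pair_def add.commute)
  also have "\<dots> = (\<Sum>y<Suc (l-2). coef_pair l y * (g y - g (Suc y)))"
    by (subst sum.lessThan_Suc_shift) (simp add: coef_pair_def)
  also have "Suc (l-2) = l - 1" using l by simp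
  finally have A: "g 1 - s / (real l - 1) = (\<Sum>y<l-1. coef_pair l y * (g y - g (Suc y)))" .
  have "(\<Sum>y<l-1. (g y - g (Suc y)) * (coef_pair l y * g 0 + coef_block l y * avg)) =
      g 0 * (g 1 - s / (real l - 1)) + avg * (g 0 - avg)"
    unfolding A B sum_distrib_left sum.distrib[symmetric] by (simp add: algebra_simps)
  moreover have "g 0 * g 1 - (avg\<^sup>2 - c / real l) = g 0 * (g 1 - s / (real l - 1)) + avg * (g 0 - avg) +
    (g 0 * s / (real l * (real l - 1)) - ((g 0)\<^sup>2 - c) / real l)"
  proof -
    have alg: "a * b - (m\<^sup>2 - c / n) = a * (b - s / (n - 1)) + m * (a - m) + (u - (a\<^sup>2 - c) / n)"
      if "m = (a + s) / n" "a * s / (n - 1) = u + a * s / n" for a b c m n s u :: real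
    proof -
      have "a * m = a\<^sup>2 / n + a * s / n"
        unfolding that(1) by (simp add: power2_eq_square algebra_simps add_divide_distrib)
      then show ?thesis using that(2)
        by (simp add: algebra_simps power2_eq_square diff_divide_distrib)
    qed
    have avg: "avg = (g 0 + s) / real l" by (simp add: avg_def sl)
    have "g 0 * s / (real l - 1) = g 0 * s / (real l * (real l - 1)) + g 0 * s / real l"
      using l by (simp add: divide_simps) (simp add: algebra_simps)
    from alg[OF avg this] show ?thesis .
  qed
  ultimately show ?thesis unfolding s_def by simp
qed

lemma expectation_orthogonal_square:
  fixes f :: "'i \<Rightarrow> 'a \<Rightarrow> real"
  assumes I: "finite I" and W: "all_moments p W" and f: "\<And>i. i \<in> I \<Longrightarrow> all_moments p (f i)"
    and orth: "\<And>i j. i \<in> I \<Longrightarrow> j \<in> I \<Longrightarrow> i \<noteq> j \<Longrightarrow>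
      measure_pmf.expectation p (\<lambda>x. W x * f i x * f j x) = 0"
    and diag: "\<And>i. i \<in> I \<Longrightarrow> measure_pmf.expectation p (\<lambda>x. W x * f i x * f i x) \<le> \<kappa>"
  shows "measure_pmf.expectation p (\<lambda>x. W x * (\<Sum>i\<in>I. c i * f i x)\<^sup>2) \<le> \<kappa> * (\<Sum>i\<in>I. (c i)\<^sup>2)"
proof -
  have int: "integrable (measure_pmf p) (\<lambda>x. W x * f i x * f j x)" if "i \<in> I" "j \<in> I" for i j
    using W f that by (intro all_moments_integrable all_moments_intros) auto
  have "(\<lambda>x. W x * (\<Sum>i\<in>I. c i * f i x)\<^sup>2) =
      (\<lambda>x. \<Sum>i\<in>I. \<Sum>j\<in>I. (c i * c j) * (W x * f i x * f j x))"
    by (simp add: power2_eq_square sum_product sum_distrib_left mult_ac)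
  then have "measure_pmf.expectation p (\<lambda>x. W x * (\<Sum>i\<in>I. c i * f i x)\<^sup>2) =
      (\<Sum>i\<in>I. \<Sum>j\<in>I. (c i * c j) * measure_pmf.expectation p (\<lambda>x. W x * f i x * f j x))"
    using int by (simp add: Bochner_Integration.integral_sum Bochner_Integration.integrable_sum)
  also have "\<dots> = (\<Sum>i\<in>I. \<Sum>j\<in>I. if j = i then (c i)\<^sup>2 * measure_pmf.expectation p (\<lambda>x. W x * f i x * f i x) else 0)"
    by (intro sum.cong refl) (auto simp: orth power2_eq_square)
  also have "\<dots> = (\<Sum>i\<in>I. (c i)\<^sup>2 * measure_pmf.expectation p (\<lambda>x. W x * f i x * f i x))"
    using I by simp
  also have "\<dots> \<le> (\<Sum>i\<in>I. (c i)\<^sup>2 * \<kappa>)"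
    by (intro sum_mono mult_left_mono diag) auto
  finally show ?thesis by (simp add: sum_distrib_left mult.commute)
qed

context inclusion_law
begin

definition config_pmf :: "int set \<Rightarrow> config pmf" where
  "config_pmf S = Pi_pmf S undefined (\<lambda>_. site_pmf)"

abbreviation "EE S \<equiv> measure_pmf.expectation (config_pmf S)"
abbreviation "Es \<equiv> measure_pmf.expectation site_pmf"
abbreviation X :: "int \<Rightarrow> config \<Rightarrow> real" where "X i \<eta> \<equiv> xi (\<eta> i)"

lemma config_pmf_component:
  assumes "finite S" "i \<in> S"
  shows "map_pmf (\<lambda>\<eta>. \<eta> i) (config_pmf S) = site_pmf"
  using assms by (simp add: config_pmf_def Pi_pmf_component)

lemma expectation_coord:
  fixes g :: "nat \<Rightarrow> real"
  assumes "finite S" "i \<in> S" shows "EE S (\<lambda>\<eta>. g (\<eta> i)) = Es g"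
  using config_pmf_component[OF assms] by (metis integral_map_pmf)

lemma all_moments_coord:
  assumes "finite S" "i \<in> S" shows "all_moments (config_pmf S) (\<lambda>\<eta>. real (\<eta> i))"
  by (rule all_moments_map_pmf[of "\<lambda>\<eta>. \<eta> i" _ real])
    (simp add: config_pmf_component[OF assms] all_moments_site)

lemma expectation_factor:
  assumes "finite S" "i \<in> S" "all_moments (config_pmf S) f" "all_moments site_pmf g"
    and "\<And>\<eta> k. f (\<eta>(i := k)) = f \<eta>"
  shows "EE S (\<lambda>\<eta>. f \<eta> * g (\<eta> i)) = EE S f * Es g"
  using assms unfolding config_pmf_def
  by (intro expectation_Pi_pmf_factor all_moments_integrable) auto

text \<open>
  The symmetric part of the jump rate across the bond \<open>(z, z + 1)\<close>, which weights the Dirichlet form.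
\<close>

definition W :: "int \<Rightarrow> config \<Rightarrow> real" where
  "W z \<eta> = real (\<eta> z) * (\<alpha> + real (\<eta> (z + 1)))"

lemmas am_site = all_moments_intros all_moments_site

lemma W_nonneg: "0 \<le> W z \<eta>"
  using alpha_pos by (simp add: W_def)

lemma all_moments_W:
  assumes "finite S" "z \<in> S" "z + 1 \<in> S" shows "all_moments (config_pmf S) (W z)"
  unfolding W_def by (intro all_moments_intros all_moments_coord assms)

lemma expectation_two_sites:
  assumes "finite S" "z \<in> S" "z + 1 \<in> S" "all_moments site_pmf f" "all_moments site_pmf g"
  shows "EE S (\<lambda>\<eta>. f (\<eta> z) * g (\<eta> (z + 1))) = Es f * Es g"
proof -
  have "all_moments (config_pmf S) (\<lambda>\<eta>. f (\<eta> z))"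
    by (rule all_moments_map_pmf[of "\<lambda>\<eta>. \<eta> z" _ f])
      (simp add: config_pmf_component assms)
  then show ?thesis
    using assms by (subst expectation_factor) (auto simp: expectation_coord)
qed

lemma expectation_W:
  assumes "finite S" "z \<in> S" "z + 1 \<in> S" shows "EE S (W z) = \<rho> * (\<alpha> + \<rho>)"
  using expectation_two_sites[OF assms, of real "\<lambda>n. \<alpha> + real n"]
  unfolding W_def[abs_def] by (simp add: am_site expectation_real)

text \<open>
  Sites off the bond are independent of the weight and centred, so the cross terms vanish.
\<close>

lemma expectation_W_linear_square:
  assumes S: "finite S" "z \<in> S" "z + 1 \<in> S" and I: "I \<subseteq> S" "z \<notin> I" "z + 1 \<notin> I"
  shows "EE S (\<lambda>\<eta>. W z \<eta> * (\<Sum>i\<in>I. c i * X i \<eta>)\<^sup>2) \<le> \<rho> * (\<alpha> + \<rho>) * chi \<alpha> \<rho> * (\<Sum>i\<in>I. (c i)\<^sup>2)"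
proof (rule expectation_orthogonal_square)
  show "finite I" using I S by (auto intro: finite_subset)
  show "all_moments (config_pmf S) (W z)" using S by (rule all_moments_W)
  show *: "all_moments (config_pmf S) (X i)" if "i \<in> I" for i
    using that I S by (intro all_moments_intros all_moments_coord) auto
  fix i assume i: "i \<in> I"
  then have iz: "i \<noteq> z" "i \<noteq> z + 1" "i \<in> S" using I by auto
  show "EE S (\<lambda>\<eta>. W z \<eta> * X i \<eta> * X i \<eta>) \<le> \<rho> * (\<alpha> + \<rho>) * chi \<alpha> \<rho>"
  proof -
    have "EE S (\<lambda>\<eta>. W z \<eta> * xi (\<eta> i) ^ 2) = EE S (W z) * Es (\<lambda>n. xi n ^ 2)"
      using S iz by (intro expectation_factor all_moments_W am_site) (auto simp: W_def)
    also have "\<dots> = \<rho> * (\<alpha> + \<rho>) * chi \<alpha> \<rho>"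
      by (simp only: expectation_W[OF S] expectation_xi2)
    finally show ?thesis by (simp add: power2_eq_square mult.assoc)
  qed
  fix j assume j: "j \<in> I" "i \<noteq> j"
  have "EE S (\<lambda>\<eta>. (W z \<eta> * X i \<eta>) * X j \<eta>) = EE S (\<lambda>\<eta>. W z \<eta> * X i \<eta>) * Es xi"
    using S j I i iz
    by (intro expectation_factor all_moments_mult all_moments_W all_moments_xi *) (auto simp: W_def)
  then show "EE S (\<lambda>\<eta>. W z \<eta> * X i \<eta> * X j \<eta>) = 0" by (simp add: expectation_xi)
qed

text \<open>
  The second moment of \<open>\<xi>\<^sub>z + \<xi>\<^bsub>z+1\<^esub>\<close> under the bond weight, of order \<open>\<alpha>\<^sup>-\<^sup>2\<close>; it is responsible for the
  summand \<open>1 / \<alpha>\<close> of the final estimate.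
\<close>

definition bond_moment :: real where
  "bond_moment = (\<alpha> + \<rho>) * (kappa3 + \<rho> * chi \<alpha> \<rho>) + \<rho> * (kappa3 + (\<alpha> + \<rho>) * chi \<alpha> \<rho>) + 2 * (chi \<alpha> \<rho>)\<^sup>2"

lemma expectation_real_xi:
  "Es (\<lambda>n. real n * xi n) = chi \<alpha> \<rho>" "Es (\<lambda>n. real n * xi n ^ 2) = kappa3 + \<rho> * chi \<alpha> \<rho>"
proof -
  have "(\<lambda>n. real n * xi n) = (\<lambda>n. xi n ^ 2 + \<rho> * xi n)"
    by (auto simp: algebra_simps power2_eq_square)
  then show "Es (\<lambda>n. real n * xi n) = chi \<alpha> \<rho>"
    by (simp add: expectation_xi expectation_xi2 del: right_diff_distrib_numeral)
  have "(\<lambda>n. real n * xi n ^ 2) = (\<lambda>n. xi n ^ 3 + \<rho> * xi n ^ 2)"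
    by (auto simp: algebra_simps power2_eq_square power3_eq_cube)
  then show "Es (\<lambda>n. real n * xi n ^ 2) = kappa3 + \<rho> * chi \<alpha> \<rho>"
    by (simp add: expectation_xi3 expectation_xi2)
qed

lemma expectation_alpha_xi:
  "Es (\<lambda>n. (\<alpha> + real n) * xi n) = chi \<alpha> \<rho>"
  "Es (\<lambda>n. (\<alpha> + real n) * xi n ^ 2) = kappa3 + (\<alpha> + \<rho>) * chi \<alpha> \<rho>"
proof -
  have i: "integrable (measure_pmf site_pmf) (\<lambda>n. real n * xi n)"
      "integrable (measure_pmf site_pmf) (\<lambda>n. real n * xi n ^ 2)"
    by (intro all_moments_integrable am_site)+
  have "(\<lambda>n. (\<alpha> + real n) * xi n) = (\<lambda>n. \<alpha> * xi n + real n * xi n)"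
    by (auto simp: algebra_simps)
  then show "Es (\<lambda>n. (\<alpha> + real n) * xi n) = chi \<alpha> \<rho>"
    using i by (simp add: expectation_real_xi expectation_xi)
  have "(\<lambda>n. (\<alpha> + real n) * xi n ^ 2) = (\<lambda>n. \<alpha> * xi n ^ 2 + real n * xi n ^ 2)"
    by (auto simp: algebra_simps)
  then show "Es (\<lambda>n. (\<alpha> + real n) * xi n ^ 2) = kappa3 + (\<alpha> + \<rho>) * chi \<alpha> \<rho>"
    using i by (simp add: expectation_real_xi expectation_xi2 algebra_simps)
qed

lemma expectation_W_bond_square:
  assumes S: "finite S" "z \<in> S" "z + 1 \<in> S"
  shows "EE S (\<lambda>\<eta>. W z \<eta> * (X z \<eta> + X (z + 1) \<eta>)\<^sup>2) = bond_moment"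
proof -
  let ?a = "\<lambda>\<eta>. (real (\<eta> z) * xi (\<eta> z) ^ 2) * (\<alpha> + real (\<eta> (z+1)))"
  let ?b = "\<lambda>\<eta>. real (\<eta> z) * ((\<alpha> + real (\<eta> (z+1))) * xi (\<eta> (z+1)) ^ 2)"
  let ?c = "\<lambda>\<eta>. (real (\<eta> z) * xi (\<eta> z)) * ((\<alpha> + real (\<eta> (z+1))) * xi (\<eta> (z+1)))"
  have i: "integrable (measure_pmf (config_pmf S)) ?a" "integrable (measure_pmf (config_pmf S)) ?b"
     "integrable (measure_pmf (config_pmf S)) ?c"
    by (intro all_moments_integrable all_moments_intros all_moments_coord S)+
  have "(\<lambda>\<eta>. W z \<eta> * (X z \<eta> + X (z + 1) \<eta>)\<^sup>2) = (\<lambda>\<eta>. ?a \<eta> + ?b \<eta> + 2 * ?c \<eta>)"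
    unfolding W_def by (rule ext) algebra
  then have "EE S (\<lambda>\<eta>. W z \<eta> * (X z \<eta> + X (z + 1) \<eta>)\<^sup>2) = EE S ?a + EE S ?b + 2 * EE S ?c"
    using i by (simp only: Bochner_Integration.integral_add Bochner_Integration.integrable_add
        integral_mult_right_zero integrable_mult_right)
  also have "EE S ?a = (kappa3 + \<rho> * chi \<alpha> \<rho>) * (\<alpha> + \<rho>)"
    using expectation_two_sites[OF S, of "\<lambda>n. real n * xi n ^ 2" "\<lambda>n. \<alpha> + real n"]
    by (simp only: am_site expectation_real_xi) (simp add: expectation_real)
  also have "EE S ?b = \<rho> * (kappa3 + (\<alpha> + \<rho>) * chi \<alpha> \<rho>)"
    using expectation_two_sites[OF S, of real "\<lambda>n. (\<alpha> + real n) * xi n ^ 2"]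
    by (simp only: am_site expectation_alpha_xi expectation_real)
  also have "EE S ?c = chi \<alpha> \<rho> * chi \<alpha> \<rho>"
    using expectation_two_sites[OF S, of "\<lambda>n. real n * xi n" "\<lambda>n. (\<alpha> + real n) * xi n"]
    by (simp only: am_site expectation_alpha_xi expectation_real_xi)
  finally show ?thesis by (simp add: bond_moment_def power2_eq_square)
qed

text \<open>
  The two ends of the bond are correlated with the weight and are separated from the rest of the block;
  they cost a constant instead of a multiple of the block length.
\<close>

lemma expectation_W_block_square:
  assumes S: "finite S" "I \<subseteq> S" and z: "z \<in> I" "z + 1 \<in> I"
  shows "EE S (\<lambda>\<eta>. W z \<eta> * (\<Sum>i\<in>I. X i \<eta>)\<^sup>2) \<le>
    2 * (\<rho> * (\<alpha> + \<rho>) * chi \<alpha> \<rho>) * real (card I) + 2 * bond_moment"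
proof -
  define J where "J = I - {z, z + 1}"
  have fin: "finite I" using S finite_subset by auto
  have zS: "z \<in> S" "z + 1 \<in> S" using S z by auto
  have "(\<Sum>i\<in>I. X i \<eta>) = (\<Sum>i\<in>J. X i \<eta>) + (X z \<eta> + X (z+1) \<eta>)" for \<eta>
  proof -
    have "I = insert z (insert (z+1) J)" using z by (auto simp: J_def)
    moreover have "finite J" "z \<notin> J" "z + 1 \<notin> J" using fin by (auto simp: J_def)
    ultimately show ?thesis by simp
  qed
  moreover have "(a + b)\<^sup>2 \<le> 2 * a\<^sup>2 + 2 * b\<^sup>2" for a b :: real
    using sum_squares_bound[of a b] by (simp add: power2_sum)
  ultimately have "W z \<eta> * (\<Sum>i\<in>I. X i \<eta>)\<^sup>2 \<le>
      2 * (W z \<eta> * (\<Sum>i\<in>J. 1 * X i \<eta>)\<^sup>2) + 2 * (W z \<eta> * (X z \<eta> + X (z+1) \<eta>)\<^sup>2)" for \<eta>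
    using mult_left_mono[OF _ W_nonneg, of "(\<Sum>i\<in>I. X i \<eta>)\<^sup>2"
        "2 * (\<Sum>i\<in>J. X i \<eta>)\<^sup>2 + 2 * (X z \<eta> + X (z+1) \<eta>)\<^sup>2" z \<eta>]
    by (simp only: mult_1 distrib_left mult.left_commute[of _ 2])
  then have "EE S (\<lambda>\<eta>. W z \<eta> * (\<Sum>i\<in>I. X i \<eta>)\<^sup>2) \<le>
    EE S (\<lambda>\<eta>. 2 * (W z \<eta> * (\<Sum>i\<in>J. 1 * X i \<eta>)\<^sup>2) + 2 * (W z \<eta> * (X z \<eta> + X (z+1) \<eta>)\<^sup>2))"
    by (intro integral_mono all_moments_integrable all_moments_intros all_moments_W all_moments_coord S zS)
      (use S J_def in auto)
  also have "\<dots> = 2 * EE S (\<lambda>\<eta>. W z \<eta> * (\<Sum>i\<in>J. 1 * X i \<eta>)\<^sup>2) + 2 * EE S (\<lambda>\<eta>. W z \<eta> * (X z \<eta> + X (z+1) \<eta>)\<^sup>2)"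
  proof -
    have "integrable (measure_pmf (config_pmf S)) (\<lambda>\<eta>. W z \<eta> * (\<Sum>i\<in>J. 1 * X i \<eta>)\<^sup>2)"
      by (intro all_moments_integrable all_moments_intros all_moments_W all_moments_coord S zS)
        (use S J_def in auto)
    moreover have "integrable (measure_pmf (config_pmf S)) (\<lambda>\<eta>. W z \<eta> * (X z \<eta> + X (z+1) \<eta>)\<^sup>2)"
      by (intro all_moments_integrable all_moments_intros all_moments_W all_moments_coord S zS)
    ultimately show ?thesis
      by (simp only: Bochner_Integration.integral_add integral_mult_right_zero integrable_mult_right)
  qed
  also have "\<dots> \<le> 2 * (\<rho> * (\<alpha> + \<rho>) * chi \<alpha> \<rho> * (\<Sum>i\<in>J. 1\<^sup>2)) + 2 * bond_moment"
  proof -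
    have "EE S (\<lambda>\<eta>. W z \<eta> * (\<Sum>i\<in>J. 1 * X i \<eta>)\<^sup>2) \<le> \<rho> * (\<alpha> + \<rho>) * chi \<alpha> \<rho> * (\<Sum>i\<in>J. 1\<^sup>2)"
      using S by (intro expectation_W_linear_square zS) (auto simp: J_def)
    then show ?thesis by (simp only: expectation_W_bond_square[OF S(1) zS])
  qed
  also have "(\<Sum>i\<in>J. 1\<^sup>2) \<le> real (card I)"
    using fin by (auto simp: J_def intro!: card_mono)
  then have "2 * (\<rho> * (\<alpha> + \<rho>) * chi \<alpha> \<rho> * (\<Sum>i\<in>J. 1\<^sup>2)) \<le> 2 * (\<rho> * (\<alpha> + \<rho>) * chi \<alpha> \<rho> * real (card I))"
    using alpha_pos rho_pos by (intro mult_left_mono) (auto simp: chi_eq)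
  finally show ?thesis by (simp only: mult.assoc)
qed

lemma expectation_site_square_sum:
  assumes S: "finite S" "I \<subseteq> S"
  shows "EE S (\<lambda>\<eta>. (\<Sum>i\<in>I. c i * ((X i \<eta>)\<^sup>2 - chi \<alpha> \<rho>))\<^sup>2) \<le> mu4 * (\<Sum>i\<in>I. (c i)\<^sup>2)"
proof -
  have "EE S (\<lambda>\<eta>. 1 * (\<Sum>i\<in>I. c i * ((X i \<eta>)\<^sup>2 - chi \<alpha> \<rho>))\<^sup>2) \<le> mu4 * (\<Sum>i\<in>I. (c i)\<^sup>2)"
  proof (rule expectation_orthogonal_square)
    show "finite I" using S by (auto intro: finite_subset)
    show "all_moments (config_pmf S) (\<lambda>_. 1)" by (rule all_moments_const)
    show *: "all_moments (config_pmf S) (\<lambda>\<eta>. (X i \<eta>)\<^sup>2 - chi \<alpha> \<rho>)" if "i \<in> I" for i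
      using that S by (intro all_moments_intros all_moments_coord) auto
    fix i assume i: "i \<in> I"
    have "EE S (\<lambda>\<eta>. ((X i \<eta>)\<^sup>2 - chi \<alpha> \<rho>) * ((X i \<eta>)\<^sup>2 - chi \<alpha> \<rho>)) =
        Es (\<lambda>n. (xi n ^ 2 - chi \<alpha> \<rho>) * (xi n ^ 2 - chi \<alpha> \<rho>))"
      using expectation_coord[of S i "\<lambda>n. (xi n ^ 2 - chi \<alpha> \<rho>) * (xi n ^ 2 - chi \<alpha> \<rho>)"] S i by auto
    also have "\<dots> = Es (\<lambda>n. xi n ^ 4 - 2 * chi \<alpha> \<rho> * xi n ^ 2 + (chi \<alpha> \<rho>)\<^sup>2)"
      by (intro arg_cong[of _ _ Es] ext) (simp add: power4_eq_xxxx power2_eq_square algebra_simps)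
    also have "\<dots> = mu4 - (chi \<alpha> \<rho>)\<^sup>2"
      by (simp add: expectation_xi4 expectation_xi2 power2_eq_square[of "chi _ _"])
    also have "\<dots> \<le> mu4" by simp
    finally show "EE S (\<lambda>\<eta>. 1 * ((X i \<eta>)\<^sup>2 - chi \<alpha> \<rho>) * ((X i \<eta>)\<^sup>2 - chi \<alpha> \<rho>)) \<le> mu4"
      by (simp only: mult_1)
    fix j assume j: "j \<in> I" "i \<noteq> j"
    have "EE S (\<lambda>\<eta>. ((X i \<eta>)\<^sup>2 - chi \<alpha> \<rho>) * ((X j \<eta>)\<^sup>2 - chi \<alpha> \<rho>)) =
        EE S (\<lambda>\<eta>. (X i \<eta>)\<^sup>2 - chi \<alpha> \<rho>) * Es (\<lambda>n. xi n ^ 2 - chi \<alpha> \<rho>)"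
      using S j i by (intro expectation_factor[where g = "\<lambda>n. xi n ^ 2 - chi \<alpha> \<rho>"] * am_site) auto
    then show "EE S (\<lambda>\<eta>. 1 * ((X i \<eta>)\<^sup>2 - chi \<alpha> \<rho>) * ((X j \<eta>)\<^sup>2 - chi \<alpha> \<rho>)) = 0"
      by (simp add: expectation_xi2)
  qed
  then show ?thesis by simp
qed

text \<open>
  Two different ordered pairs always leave a site that occurs in only one of them, and exactly once.
  Its centred occupation number factors out of the product of all four.
\<close>

lemma expectation_pair_sum_square:
  assumes S: "finite S" and J: "\<And>x y. (x, y) \<in> J \<Longrightarrow> x \<in> S \<and> y \<in> S \<and> x < y"
  shows "EE S (\<lambda>\<eta>. (\<Sum>(x, y)\<in>J. c (x, y) * (X x \<eta> * X y \<eta>))\<^sup>2) \<le> (chi \<alpha> \<rho>)\<^sup>2 * (\<Sum>q\<in>J. (c q)\<^sup>2)"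
proof -
  let ?f = "\<lambda>q \<eta>. X (fst q) \<eta> * X (snd q) \<eta>"
  have J': "fst q \<in> S" "snd q \<in> S" "fst q < snd q" if "q \<in> J" for q
    using J[of "fst q" "snd q"] that by auto
  have "EE S (\<lambda>\<eta>. 1 * (\<Sum>q\<in>J. c q * ?f q \<eta>)\<^sup>2) \<le> (chi \<alpha> \<rho>)\<^sup>2 * (\<Sum>q\<in>J. (c q)\<^sup>2)"
  proof (rule expectation_orthogonal_square)
    have "J \<subseteq> S \<times> S" using J by auto
    then show "finite J" using S by (auto intro: finite_subset)
    show "all_moments (config_pmf S) (\<lambda>_. 1)" by (rule all_moments_const)
    show *: "all_moments (config_pmf S) (?f q)" if "q \<in> J" for q
      using J'[OF that] S by (intro all_moments_intros all_moments_coord)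
    fix q assume q: "q \<in> J"
    have "EE S (\<lambda>\<eta>. X (fst q) \<eta> ^ 2 * X (snd q) \<eta> ^ 2) = EE S (\<lambda>\<eta>. X (fst q) \<eta> ^ 2) * Es (\<lambda>n. xi n ^ 2)"
      using S J'[OF q] by (intro expectation_factor[where g = "\<lambda>n. xi n ^ 2"] am_site all_moments_coord) auto
    also have "EE S (\<lambda>\<eta>. X (fst q) \<eta> ^ 2) = chi \<alpha> \<rho>"
      using expectation_coord[of S "fst q" "\<lambda>n. xi n ^ 2"] S J'[OF q] by (simp add: expectation_xi2)
    finally have "EE S (\<lambda>\<eta>. X (fst q) \<eta> ^ 2 * X (snd q) \<eta> ^ 2) = (chi \<alpha> \<rho>)\<^sup>2"
      by (simp only: expectation_xi2 power2_eq_square[of "chi _ _"])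
    then show "EE S (\<lambda>\<eta>. 1 * ?f q \<eta> * ?f q \<eta>) \<le> (chi \<alpha> \<rho>)\<^sup>2"
      by (simp add: power2_eq_square mult_ac)
    fix r assume r: "r \<in> J" "q \<noteq> r"
    have zero: "EE S (\<lambda>\<eta>. (X a \<eta> * X b \<eta> * X d \<eta>) * X e \<eta>) = 0"
      if "a \<in> S" "b \<in> S" "d \<in> S" "e \<in> S" "e \<noteq> a" "e \<noteq> b" "e \<noteq> d" for a b d e
      using S that by (subst expectation_factor)
        (auto intro!: all_moments_intros all_moments_site all_moments_coord simp: expectation_xi)
    have "fst q \<noteq> fst r \<or> snd q \<noteq> snd r" using r(2) by (auto simp: prod_eq_iff)
    moreover have "fst q < snd q" "fst r < snd r" using J'[OF q] J'[OF r(1)] by auto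
    ultimately consider "snd r \<noteq> fst q" "snd r \<noteq> snd q" | "snd q \<noteq> fst r" "snd q \<noteq> snd r"
      | "fst q \<noteq> fst r" "snd q = snd r"
      by linarith
    then have "EE S (\<lambda>\<eta>. ?f q \<eta> * ?f r \<eta>) = 0"
    proof cases
      case 1
      then show ?thesis
        using zero[of "fst q" "snd q" "fst r" "snd r"] J'[OF q] J'[OF r(1)] by (simp add: mult_ac)
    next
      case 2
      then show ?thesis
        using zero[of "fst r" "snd r" "fst q" "snd q"] J'[OF q] J'[OF r(1)] by (simp add: mult_ac)
    next
      case 3
      then show ?thesis
        using zero[of "snd q" "snd r" "fst q" "fst r"] J'[OF q] J'[OF r(1)] by (simp add: mult_ac)
    qed
    then show "EE S (\<lambda>\<eta>. 1 * ?f q \<eta> * ?f r \<eta>) = 0" by simp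
  qed
  then show ?thesis by (simp add: split_def)
qed

end

section \<open>Additive functionals of finite Markov chains\<close>

text \<open>
  A function on the half-line is continued by its tangent at the origin to a continuously differentiable
  function on the whole line.
\<close>

lemma has_real_derivative_glue_line:
  fixes k :: "real \<Rightarrow> real"
  assumes k: "\<And>h. 0 \<le> h \<Longrightarrow> (k has_real_derivative k' h) (at h within {0..})"
  shows "((\<lambda>h. if 0 \<le> h then k h else k 0 + h * k' 0) has_real_derivative k' (max 0 h)) (at h)"
    (is "(?K has_real_derivative _) _")
proof -
  consider "h > 0" | "h < 0" | "h = 0" by linarith
  then show ?thesis
  proof cases
    case 1
    have "(k has_real_derivative k' h) (at h)"
      using k[of h] 1 at_within_interior[of h "{0..}"] by (simp add: interior_real_atLeast)
    moreover have "\<forall>\<^sub>F x in nhds h. ?K x = k x"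
      using eventually_nhds_in_open[of "{0<..}" h] 1 by (auto elim: eventually_mono)
    ultimately show ?thesis
      using 1 by (subst DERIV_cong_ev[OF refl _ refl, of _ k]) auto
  next
    case 2
    have "((\<lambda>h. k 0 + h * k' 0) has_real_derivative k' 0) (at h)"
      by (auto intro!: derivative_eq_intros)
    moreover have "\<forall>\<^sub>F x in nhds h. ?K x = k 0 + x * k' 0"
      using eventually_nhds_in_open[of "{..<0}" h] 2 by (auto elim: eventually_mono)
    ultimately show ?thesis
      using 2 by (subst DERIV_cong_ev[OF refl _ refl, of _ "\<lambda>h. k 0 + h * k' 0"]) auto
  next
    case 3
    have "(?K has_real_derivative k' 0) (at 0 within {0..})"
      by (rule has_field_derivative_transform_within[OF k[of 0], of 1]) auto
    moreover have "((\<lambda>h. k 0 + h * k' 0) has_real_derivative k' 0) (at 0 within {..0})"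
      by (auto intro!: derivative_eq_intros)
    then have "(?K has_real_derivative k' 0) (at 0 within {..0})"
      by (rule has_field_derivative_transform_within[of _ _ _ _ 1]) auto
    ultimately have "(?K has_real_derivative k' 0) (at 0 within {..0} \<union> {0..})"
      unfolding has_field_derivative_iff by (subst at_within_union) (intro filterlim_sup)
    moreover have "{..0} \<union> {0..} = (UNIV :: real set)" by auto
    ultimately show ?thesis using 3 by simp
  qed
qed

text \<open>
  With the kernel continued to negative times by its tangent, the moving lower limit becomes a fixed
  domain of integration minus an explicit term, and Leibniz' rule applies.
\<close>

lemma has_real_derivative_convolution:
  fixes k k' \<phi> :: "real \<Rightarrow> real"
  assumes k: "\<And>h. 0 \<le> h \<Longrightarrow> (k has_real_derivative k' h) (at h within {0..})"
    and k': "continuous_on {0..} k'" and \<phi>: "continuous_on {0..t} \<phi>" and s: "s \<in> {0..t}"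
  shows "((\<lambda>s. integral {s..t} (\<lambda>r. k (r - s) * \<phi> r)) has_real_derivative
    - (k 0 * \<phi> s) - integral {s..t} (\<lambda>r. k' (r - s) * \<phi> r)) (at s within {0..t})"
proof -
  define K where "K h = (if 0 \<le> h then k h else k 0 + h * k' 0)" for h
  have K: "(K has_real_derivative k' (max 0 h)) (at h)" for h
    using has_real_derivative_glue_line[OF k] unfolding K_def[abs_def] .
  have Kc: "continuous_on UNIV K"
    by (intro continuous_at_imp_continuous_on ballI DERIV_isCont) (rule K)
  have mc: "continuous_on A (\<lambda>h. k' (max 0 h))" for A :: "real set"
    by (rule continuous_on_compose2[OF k']) (auto intro!: continuous_intros)
  have \<phi>i: "(\<lambda>r. g r * \<phi> r) integrable_on {0..t}" if "continuous_on UNIV g" for g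
    by (intro integrable_continuous_interval continuous_intros \<phi> continuous_on_subset[OF that]) auto
  have split: "integral {s..t} (\<lambda>r. g r * \<phi> r) =
      integral {0..t} (\<lambda>r. g r * \<phi> r) - integral {0..s} (\<lambda>r. g r * \<phi> r)"
    if "s \<in> {0..t}" "continuous_on UNIV g" for s g
    using Henstock_Kurzweil_Integration.integral_combine[of 0 s t "\<lambda>r. g r * \<phi> r"] \<phi>i that by auto
  have Kshift: "continuous_on UNIV (\<lambda>r. K (r - s))" for s
    by (rule continuous_on_compose2[OF Kc]) (auto intro!: continuous_intros)
  have eq1: "integral {s..t} (\<lambda>r. k (r - s) * \<phi> r) = integral {0..t} (\<lambda>r. K (r - s) * \<phi> r)
      - (k 0 - s * k' 0) * integral {0..s} \<phi> - k' 0 * integral {0..s} (\<lambda>r. r * \<phi> r)"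
    if s: "s \<in> {0..t}" for s
  proof -
    have sub: "continuous_on {0..s} \<phi>" using \<phi> s by (auto intro: continuous_on_subset)
    have "integral {s..t} (\<lambda>r. k (r - s) * \<phi> r) = integral {s..t} (\<lambda>r. K (r - s) * \<phi> r)"
      by (rule integral_cong) (auto simp: K_def)
    also have "\<dots> = integral {0..t} (\<lambda>r. K (r - s) * \<phi> r) - integral {0..s} (\<lambda>r. K (r - s) * \<phi> r)"
      by (rule split[OF s Kshift])
    also have "integral {0..s} (\<lambda>r. K (r - s) * \<phi> r) =
        integral {0..s} (\<lambda>r. (k 0 - s * k' 0) * \<phi> r + k' 0 * (r * \<phi> r))"
      by (rule integral_cong) (auto simp: K_def algebra_simps)
    also have "\<dots> = (k 0 - s * k' 0) * integral {0..s} \<phi> + k' 0 * integral {0..s} (\<lambda>r. r * \<phi> r)"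
      by (subst Henstock_Kurzweil_Integration.integral_add)
        (auto intro!: integrable_continuous_interval continuous_intros sub)
    finally show ?thesis by simp
  qed
  have D1: "((\<lambda>s. integral (cbox 0 t) (\<lambda>r. K (r - s) * \<phi> r)) has_real_derivative
      integral (cbox 0 t) (\<lambda>r. - k' (max 0 (r - s)) * \<phi> r)) (at s within {0..t})"
  proof (rule leibniz_rule_field_derivative)
    show "((\<lambda>x. K (r - x) * \<phi> r) has_real_derivative - k' (max 0 (r - x)) * \<phi> r) (at x within {0..t})"
      for x r
    proof -
      have "((\<lambda>x. K (r - x)) has_real_derivative k' (max 0 (r - x)) * (-1)) (at x)"
        by (rule DERIV_chain2[OF K]) (auto intro!: derivative_eq_intros)
      from DERIV_cmult_right[OF this, of "\<phi> r"] show ?thesis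
        by (auto intro: has_field_derivative_at_within)
    qed
    show "(\<lambda>r. K (r - x) * \<phi> r) integrable_on cbox 0 t" for x
      using \<phi>i[OF Kshift] by simp
    have "continuous_on ({0..t} \<times> cbox 0 t) (\<lambda>z. - k' (max 0 (snd z - fst z)) * \<phi> (snd z))"
      by (intro continuous_intros continuous_on_compose2[OF mc[of UNIV]] continuous_on_compose2[OF \<phi>]) auto
    then show "continuous_on ({0..t} \<times> cbox 0 t) (\<lambda>(x, r). - k' (max 0 (r - x)) * \<phi> r)"
      by (simp add: split_def)
  qed (use s in auto)
  have sphi: "continuous_on {0..t} (\<lambda>r. r * \<phi> r)" by (intro continuous_intros \<phi>)
  have "((\<lambda>s. integral {0..t} (\<lambda>r. K (r - s) * \<phi> r)
      - (k 0 - s * k' 0) * integral {0..s} \<phi> - k' 0 * integral {0..s} (\<lambda>r. r * \<phi> r)) has_real_derivative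
      integral {0..t} (\<lambda>r. - k' (max 0 (r - s)) * \<phi> r) -
      ((k 0 - s * k' 0) * \<phi> s + (- k' 0) * integral {0..s} \<phi>) - k' 0 * (s * \<phi> s)) (at s within {0..t})"
    using D1 by (intro DERIV_diff DERIV_mult' DERIV_cmult integral_has_real_derivative \<phi> sphi s)
      (auto intro!: derivative_eq_intros)
  moreover have "integral {0..t} (\<lambda>r. - k' (max 0 (r - s)) * \<phi> r) -
      ((k 0 - s * k' 0) * \<phi> s + (- k' 0) * integral {0..s} \<phi>) - k' 0 * (s * \<phi> s) =
      - (k 0 * \<phi> s) - integral {s..t} (\<lambda>r. k' (r - s) * \<phi> r)"
  proof -
    have "integral {s..t} (\<lambda>r. k' (r - s) * \<phi> r) = integral {s..t} (\<lambda>r. k' (max 0 (r - s)) * \<phi> r)"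
      by (rule integral_cong) auto
    also have "\<dots> = integral {0..t} (\<lambda>r. k' (max 0 (r - s)) * \<phi> r) - integral {0..s} (\<lambda>r. k' (max 0 (r - s)) * \<phi> r)"
      by (rule split[OF s]) (rule continuous_on_compose2[OF mc[of UNIV]], auto intro!: continuous_intros)
    also have "integral {0..s} (\<lambda>r. k' (max 0 (r - s)) * \<phi> r) = integral {0..s} (\<lambda>r. k' 0 * \<phi> r)"
      by (rule integral_cong) auto
    finally show ?thesis by (simp add: algebra_simps)
  qed
  ultimately show ?thesis
    using s eq1 by (auto intro: has_field_derivative_transform_within[of _ _ _ _ 1])
qed

lemma mult_le_average_square: "b * c \<le> ((b + c) / 2)\<^sup>2" for b c :: real
proof -
  have "0 \<le> (b - c)\<^sup>2" by simp
  also have "(b - c)\<^sup>2 = (b + c)\<^sup>2 - 4 * (b * c)" by algebra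
  finally show ?thesis by (simp add: power_divide)
qed

locale finite_markov_chain =
  fixes C :: "'s set" and \<mu> :: "'s \<Rightarrow> real" and q :: "'s \<Rightarrow> 's \<Rightarrow> real"
    and p :: "real \<Rightarrow> 's \<Rightarrow> 's \<Rightarrow> real"
  assumes fin: "finite C"
    and p0: "\<And>x y. x \<in> C \<Longrightarrow> y \<in> C \<Longrightarrow> p 0 x y = of_bool (x = y)"
    and backward: "\<And>h x y. 0 \<le> h \<Longrightarrow> x \<in> C \<Longrightarrow> y \<in> C \<Longrightarrow>
      ((\<lambda>h. p h x y) has_real_derivative (\<Sum>z\<in>C. q x z * (p h z y - p h x y))) (at h within {0..})"
    and invariant: "\<And>g. (\<Sum>x\<in>C. \<mu> x * (\<Sum>z\<in>C. q x z * (g z - g x))) = 0"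
begin

definition dirichlet :: "('s \<Rightarrow> real) \<Rightarrow> real" where
  "dirichlet g = (\<Sum>x\<in>C. \<Sum>z\<in>C. \<mu> x * q x z * (g z - g x)\<^sup>2) / 2"

text \<open>
  Applying invariance to \<open>g\<^sup>2\<close> shows that the antisymmetric part of the generator does not contribute to
  the energy.
\<close>

lemma dirichlet_eq: "(\<Sum>x\<in>C. \<mu> x * (g x * (\<Sum>z\<in>C. q x z * (g z - g x)))) = - dirichlet g"
proof -
  have "0 = (\<Sum>x\<in>C. \<mu> x * (\<Sum>z\<in>C. q x z * ((g z)\<^sup>2 - (g x)\<^sup>2)))"
    using invariant[of "\<lambda>x. (g x)\<^sup>2"] by simp
  also have "\<dots> = (\<Sum>x\<in>C. \<Sum>z\<in>C. \<mu> x * q x z * (g z - g x)\<^sup>2 + 2 * (\<mu> x * (g x * (q x z * (g z - g x)))))"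
    by (simp add: sum_distrib_left power2_eq_square algebra_simps)
  also have "\<dots> = 2 * dirichlet g + 2 * (\<Sum>x\<in>C. \<mu> x * (g x * (\<Sum>z\<in>C. q x z * (g z - g x))))"
    unfolding sum.distrib dirichlet_def by (simp only: sum_distrib_left)
  finally show ?thesis by linarith
qed

text \<open>
  The backward equation and invariance make the left-hand side constant in time.
\<close>

lemma stationary: "0 \<le> h \<Longrightarrow> y \<in> C \<Longrightarrow> (\<Sum>x\<in>C. \<mu> x * p h x y) = \<mu> y"
proof -
  assume h: "0 \<le> h" and y: "y \<in> C"
  have "((\<lambda>h. \<Sum>x\<in>C. \<mu> x * p h x y) has_real_derivative 0) (at h within {0..})" if "0 \<le> h" for h
  proof -
    have "((\<lambda>h. \<Sum>x\<in>C. \<mu> x * p h x y) has_real_derivative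
        (\<Sum>x\<in>C. \<mu> x * (\<Sum>z\<in>C. q x z * (p h z y - p h x y)))) (at h within {0..})"
      using y that by (intro DERIV_sum DERIV_cmult backward)
    then show ?thesis by (simp only: invariant)
  qed
  then obtain c where "\<And>h. h \<in> {0..} \<Longrightarrow> (\<Sum>x\<in>C. \<mu> x * p h x y) = c"
    using has_field_derivative_zero_constant[of "{0..}" "\<lambda>h. \<Sum>x\<in>C. \<mu> x * p h x y"] by auto
  then have "(\<Sum>x\<in>C. \<mu> x * p h x y) = (\<Sum>x\<in>C. \<mu> x * p 0 x y)" using h by simp
  also have "\<dots> = (\<Sum>x\<in>C. if x = y then \<mu> x else 0)"
    using y by (intro sum.cong) (auto simp: p0)
  also have "\<dots> = \<mu> y" using y fin by simp
  finally show ?thesis .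
qed

text \<open>
  The mean of the additive functional of \<open>F\<close> over \<open>[s, t]\<close> for the chain started from \<open>x\<close> at time \<open>s\<close>.
\<close>

definition potential :: "real \<Rightarrow> (real \<Rightarrow> 's \<Rightarrow> real) \<Rightarrow> real \<Rightarrow> 's \<Rightarrow> real" where
  "potential t F s x = (\<Sum>y\<in>C. integral {s..t} (\<lambda>r. p (r - s) x y * F r y))"

lemma continuous_p: "x \<in> C \<Longrightarrow> y \<in> C \<Longrightarrow> continuous_on {0..} (\<lambda>h. p h x y)"
  using backward by (intro DERIV_continuous_on) auto

lemma potential_derivative:
  assumes F: "\<And>y. y \<in> C \<Longrightarrow> continuous_on {0..t} (\<lambda>r. F r y)" and s: "s \<in> {0..t}" and x: "x \<in> C"
  shows "((\<lambda>s. potential t F s x) has_real_derivative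
    - F s x - (\<Sum>z\<in>C. q x z * (potential t F s z - potential t F s x))) (at s within {0..t})"
proof -
  let ?k' = "\<lambda>h y. \<Sum>z\<in>C. q x z * (p h z y - p h x y)"
  have shift: "continuous_on {s..t} (\<lambda>r. p (r - s) z y)" if "z \<in> C" "y \<in> C" for z y
    by (rule continuous_on_compose2[OF continuous_p[OF that]]) (auto intro!: continuous_intros)
  have F': "continuous_on {s..t} (\<lambda>r. F r y)" if "y \<in> C" for y
    using F[OF that] s by (auto intro: continuous_on_subset)
  have "((\<lambda>s. potential t F s x) has_real_derivative
      (\<Sum>y\<in>C. - (p 0 x y * F s y) - integral {s..t} (\<lambda>r. ?k' (r - s) y * F r y))) (at s within {0..t})"
    unfolding potential_def
    by (intro DERIV_sum has_real_derivative_convolution backward F s x continuous_intros continuous_p) auto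
  also have "(\<Sum>y\<in>C. - (p 0 x y * F s y) - integral {s..t} (\<lambda>r. ?k' (r - s) y * F r y)) =
      - (\<Sum>y\<in>C. if x = y then F s y else 0) - (\<Sum>y\<in>C. integral {s..t} (\<lambda>r. ?k' (r - s) y * F r y))"
    using x by (simp add: sum_subtractf sum_negf p0 of_bool_def if_distrib[of "\<lambda>b. b * _"] cong: if_cong)
  also have "(\<Sum>y\<in>C. if x = y then F s y else 0) = F s x"
    using fin x by simp
  also have "(\<Sum>y\<in>C. integral {s..t} (\<lambda>r. ?k' (r - s) y * F r y)) =
      (\<Sum>y\<in>C. \<Sum>z\<in>C. q x z * (integral {s..t} (\<lambda>r. p (r - s) z y * F r y)
        - integral {s..t} (\<lambda>r. p (r - s) x y * F r y)))"
  proof (rule sum.cong[OF refl])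
    fix y assume y: "y \<in> C"
    have int: "(\<lambda>r. p (r - s) z y * F r y) integrable_on {s..t}" if "z \<in> C" for z
      using that y by (intro integrable_continuous_interval continuous_intros shift F')
    have "((\<lambda>r. \<Sum>z\<in>C. q x z * (p (r - s) z y * F r y - p (r - s) x y * F r y)) has_integral
        (\<Sum>z\<in>C. q x z * (integral {s..t} (\<lambda>r. p (r - s) z y * F r y)
        - integral {s..t} (\<lambda>r. p (r - s) x y * F r y)))) {s..t}"
      using x by (intro has_integral_sum fin has_integral_mult_right has_integral_diff integrable_integral int)
    moreover have "(\<Sum>z\<in>C. q x z * (p (r - s) z y * F r y - p (r - s) x y * F r y)) = ?k' (r - s) y * F r y" for r
      unfolding sum_distrib_right by (intro sum.cong refl) algebra
    ultimately show "integral {s..t} (\<lambda>r. ?k' (r - s) y * F r y) =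
      (\<Sum>z\<in>C. q x z * (integral {s..t} (\<lambda>r. p (r - s) z y * F r y)
        - integral {s..t} (\<lambda>r. p (r - s) x y * F r y)))"
      by (simp only: integral_unique)
  qed
  also have "\<dots> = (\<Sum>z\<in>C. q x z * (potential t F s z - potential t F s x))"
    unfolding potential_def by (subst sum.swap) (simp only: sum_distrib_left[symmetric] sum_subtractf)
  finally show ?thesis .
qed

text \<open>
  The potential \<open>u\<close> vanishes at time \<open>t\<close>, so integrating the derivative of its squared norm gives
  \<open>\<integral> D(u) \<le> \<integral> \<langle>F, u\<rangle>\<close>. The bound on the pairing and the inequality of the means give
  \<open>\<integral> \<langle>F, u\<rangle> \<le> (\<integral> a + \<integral> D(u)) / 2\<close>, and the Dirichlet form is absorbed into the left-hand side.
\<close>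

theorem kipnis_varadhan:
  assumes t: "0 \<le> t"
    and F: "\<And>y. y \<in> C \<Longrightarrow> continuous_on {0..t} (\<lambda>r. F r y)"
    and a: "continuous_on {0..t} a" "\<And>s. s \<in> {0..t} \<Longrightarrow> 0 \<le> a s"
    and bound: "\<And>s g. s \<in> {0..t} \<Longrightarrow> (\<Sum>x\<in>C. \<mu> x * (F s x * g x))\<^sup>2 \<le> a s * dirichlet g"
    and D: "\<And>g. 0 \<le> dirichlet g"
    and \<mu>: "\<And>x. x \<in> C \<Longrightarrow> 0 \<le> \<mu> x"
  shows "integral {0..t} (\<lambda>s. \<Sum>x\<in>C. \<mu> x * (F s x * potential t F s x)) \<le> integral {0..t} a"
proof -
  let ?u = "potential t F"
  let ?I = "\<lambda>s. \<Sum>x\<in>C. \<mu> x * (F s x * ?u s x)"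
  have u: "continuous_on {0..t} (\<lambda>s. ?u s x)" if "x \<in> C" for x
    by (rule DERIV_continuous_on) (rule potential_derivative[OF F _ that])
  have cI: "continuous_on {0..t} ?I" by (intro continuous_intros F u)
  have cD: "continuous_on {0..t} (\<lambda>s. dirichlet (?u s))"
    unfolding dirichlet_def by (intro continuous_intros u) auto
  have "((\<lambda>s. \<Sum>x\<in>C. \<mu> x * (?u s x)\<^sup>2) has_real_derivative 2 * dirichlet (?u s) - 2 * ?I s) (at s within {0..t})"
    if s: "s \<in> {0..t}" for s
  proof -
    have "((\<lambda>s. \<Sum>x\<in>C. \<mu> x * (?u s x)\<^sup>2) has_real_derivative
        (\<Sum>x\<in>C. \<mu> x * (2 * ?u s x * (- F s x - (\<Sum>z\<in>C. q x z * (?u s z - ?u s x)))))) (at s within {0..t})"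
    proof (intro DERIV_sum DERIV_cmult)
      fix x assume x: "x \<in> C"
      show "((\<lambda>s. (?u s x)\<^sup>2) has_real_derivative
          2 * ?u s x * (- F s x - (\<Sum>z\<in>C. q x z * (?u s z - ?u s x)))) (at s within {0..t})"
      proof (rule DERIV_cong[OF DERIV_power[OF potential_derivative[OF F s x], where n = 2]])
        show "real 2 * (d * w ^ (2 - Suc 0)) = 2 * w * d" for d w :: real by simp
      qed
    qed
    also have "(\<Sum>x\<in>C. \<mu> x * (2 * ?u s x * (- F s x - (\<Sum>z\<in>C. q x z * (?u s z - ?u s x))))) =
        - 2 * ?I s - 2 * (\<Sum>x\<in>C. \<mu> x * (?u s x * (\<Sum>z\<in>C. q x z * (?u s z - ?u s x))))"
    proof -
      have "\<mu> x * (2 * ?u s x * (- F s x - G)) = - 2 * (\<mu> x * (F s x * ?u s x)) - 2 * (\<mu> x * (?u s x * G))"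
        for x G by algebra
      then show ?thesis by (simp only: sum_subtractf sum_distrib_left)
    qed
    finally show ?thesis unfolding dirichlet_eq by (simp add: algebra_simps)
  qed
  then have "((\<lambda>s. 2 * dirichlet (?u s) - 2 * ?I s) has_integral
      (\<Sum>x\<in>C. \<mu> x * (?u t x)\<^sup>2) - (\<Sum>x\<in>C. \<mu> x * (?u 0 x)\<^sup>2)) {0..t}"
    using t by (intro fundamental_theorem_of_calculus)
      (simp_all only: has_real_derivative_iff_has_vector_derivative[symmetric])
  moreover have "((\<lambda>s. 2 * dirichlet (?u s) - 2 * ?I s) has_integral
      (2 * integral {0..t} (\<lambda>s. dirichlet (?u s)) - 2 * integral {0..t} ?I)) {0..t}"
    by (intro has_integral_diff has_integral_mult_right integrable_integral
        integrable_continuous_interval cD cI)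
  ultimately have "2 * integral {0..t} (\<lambda>s. dirichlet (?u s)) - 2 * integral {0..t} ?I =
      (\<Sum>x\<in>C. \<mu> x * (?u t x)\<^sup>2) - (\<Sum>x\<in>C. \<mu> x * (?u 0 x)\<^sup>2)"
    by (rule has_integral_unique[symmetric])
  moreover have "(\<Sum>x\<in>C. \<mu> x * (?u t x)\<^sup>2) = 0" by (simp add: potential_def)
  moreover have "0 \<le> (\<Sum>x\<in>C. \<mu> x * (?u 0 x)\<^sup>2)" using \<mu> by (intro sum_nonneg) simp
  ultimately have 1: "integral {0..t} (\<lambda>s. dirichlet (?u s)) \<le> integral {0..t} ?I" by linarith
  have "?I s \<le> (a s + dirichlet (?u s)) / 2" if "s \<in> {0..t}" for s
  proof -
    have "(?I s)\<^sup>2 \<le> a s * dirichlet (?u s)" by (rule bound[OF that])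
    also have "\<dots> \<le> ((a s + dirichlet (?u s)) / 2)\<^sup>2" by (rule mult_le_average_square)
    finally show ?thesis
    proof (rule power2_le_imp_le)
      show "0 \<le> (a s + dirichlet (?u s)) / 2"
        by (intro divide_nonneg_pos add_nonneg_nonneg a(2)[OF that] D) simp
    qed
  qed
  then have "integral {0..t} ?I \<le> integral {0..t} (\<lambda>s. (a s + dirichlet (?u s)) / 2)"
    by (intro integral_le integrable_continuous_interval continuous_intros cI cD a(1)) simp
  also have "\<dots> = (integral {0..t} a + integral {0..t} (\<lambda>s. dirichlet (?u s))) / 2"
    by (intro integral_unique has_integral_divide has_integral_add integrable_integral
        integrable_continuous_interval cD a(1))
  finally show ?thesis using 1 by simp
qed

end

section \<open>Integer-valued cadlag paths\<close>

lemma space_path_space [simp]: "space (path_space :: (real \<Rightarrow> 'a::topological_space) measure) = cadlag_paths"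
  unfolding path_space_def by (auto simp: space_restrict_space space_PiM cadlag_paths_def PiE_def)

lemma measurable_path_eval:
  assumes "0 \<le> t"
  shows "(\<lambda>w. w t) \<in> path_space \<rightarrow>\<^sub>M (borel :: 'a::topological_space measure)"
  unfolding path_space_def using assms
  by (intro measurable_restrict_space1 measurable_component_singleton) auto

lemma measurable_coord_real [measurable]: "(\<lambda>\<eta> :: config. real (\<eta> i)) \<in> borel_measurable borel"
  by (intro borel_measurable_continuous_onI continuous_on_of_nat continuous_on_product_coordinates
     continuous_on_compose2[OF continuous_on_of_nat[OF continuous_on_id]]) auto

lemma tendsto_coord:
  fixes l :: config
  assumes "(w \<longlongrightarrow> l) F" shows "((\<lambda>r. w r i) \<longlongrightarrow> l i) F"
  by (rule continuous_on_tendsto_compose[OF continuous_on_product_coordinates assms]) auto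

lemma cadlag_right: "w \<in> cadlag_paths \<Longrightarrow> 0 \<le> s \<Longrightarrow> (w \<longlongrightarrow> w s) (at_right s)"
  unfolding cadlag_paths_def by blast

text \<open>
  The topology of \<^typ>\<open>nat\<close> is discrete, so one-sided limits of a coordinate are attained on one-sided
  neighbourhoods.
\<close>

lemma cadlag_coordinate_jump:
  fixes w :: "real \<Rightarrow> config"
  assumes w: "w \<in> cadlag_paths" and s: "0 \<le> s"
  obtains \<delta> l where "\<delta> > 0" "\<And>r. s < r \<Longrightarrow> r < s + \<delta> \<Longrightarrow> w r i = w s i"
    "\<And>r. 0 \<le> r \<Longrightarrow> s - \<delta> < r \<Longrightarrow> r < s \<Longrightarrow> w r i = l"
proof -
  have coord: "\<forall>\<^sub>F r in F. w r i = l i" if "(w \<longlongrightarrow> l) F" for l F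
    using tendsto_coord[OF that, of i] tendsto_discrete[of "\<lambda>r. w r i" "l i" F] by blast
  have "\<forall>\<^sub>F r in at_right s. w r i = w s i"
    by (rule coord[OF cadlag_right[OF w s]])
  then have "\<exists>b>s. \<forall>r>s. r < b \<longrightarrow> w r i = w s i"
    unfolding eventually_at_right_field .
  then obtain d1 where d1: "d1 > s" "\<And>r. s < r \<Longrightarrow> r < d1 \<Longrightarrow> w r i = w s i"
    by blast
  show thesis
  proof (cases "s = 0")
    case True
    show ?thesis
    proof (rule that[of "d1 - s" 0])
      show "0 < d1 - s" using d1(1) by simp
      show "w r i = w s i" if "s < r" "r < s + (d1 - s)" for r
        by (rule d1(2)) (use that in simp_all)
      show "w r i = 0" if "0 \<le> r" "r < s" for r using that True by simp
    qed
  next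
    case False
    then obtain l where "(w \<longlongrightarrow> l) (at_left s)"
    proof -
      have "0 < s" using s False by simp
      then show thesis using w that unfolding cadlag_paths_def by blast
    qed
    then have "\<forall>\<^sub>F r in at_left s. w r i = l i" by (rule coord)
    then have "\<exists>b<s. \<forall>r>b. r < s \<longrightarrow> w r i = l i"
      unfolding eventually_at_left_field .
    then obtain d2 where d2: "d2 < s" "\<And>r. d2 < r \<Longrightarrow> r < s \<Longrightarrow> w r i = l i"
      by blast
    show ?thesis
    proof (rule that[of "min (d1 - s) (s - d2)" "l i"])
      show "0 < min (d1 - s) (s - d2)" using d1(1) d2(1) by simp
      show "w r i = w s i" if "s < r" "r < s + min (d1 - s) (s - d2)" for r
        by (rule d1(2)) (use that in simp_all)
      show "w r i = l i" if "s - min (d1 - s) (s - d2) < r" "r < s" for r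
        by (rule d2(2)) (use that in simp_all)
    qed
  qed
qed

text \<open>
  Cover the compact interval by the neighbourhoods on which the coordinate jumps at most at the centre.
  The centres of a finite subcover contain all jumps, and the coordinate takes finitely many values.
\<close>

lemma cadlag_coordinate_finite_jumps:
  fixes w :: "real \<Rightarrow> config"
  assumes w: "w \<in> cadlag_paths"
  shows "\<exists>B D. finite D \<and> (\<forall>s\<in>{0..T}. w s i \<le> B) \<and>
    (\<forall>s\<in>{0..T} - D. \<exists>\<delta>>0. \<forall>r\<in>{0..T}. \<bar>r - s\<bar> < \<delta> \<longrightarrow> w r i = w s i)"
proof -
  have "\<forall>s\<in>{0..T}. \<exists>\<delta> l. \<delta> > 0 \<and> (\<forall>r. s < r \<longrightarrow> r < s + \<delta> \<longrightarrow> w r i = w s i) \<and>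
     (\<forall>r. 0 \<le> r \<longrightarrow> s - \<delta> < r \<longrightarrow> r < s \<longrightarrow> w r i = l)"
  proof
    fix s assume "s \<in> {0..T}"
    then have "0 \<le> s" by simp
    from cadlag_coordinate_jump[OF w this, of i] show "\<exists>\<delta> l. \<delta> > 0 \<and> (\<forall>r. s < r \<longrightarrow> r < s + \<delta> \<longrightarrow> w r i = w s i) \<and>
     (\<forall>r. 0 \<le> r \<longrightarrow> s - \<delta> < r \<longrightarrow> r < s \<longrightarrow> w r i = l)" by metis
  qed
  then obtain \<delta> l where \<delta>: "\<And>s. s \<in> {0..T} \<Longrightarrow> \<delta> s > 0"
    "\<And>s r. s \<in> {0..T} \<Longrightarrow> s < r \<Longrightarrow> r < s + \<delta> s \<Longrightarrow> w r i = w s i"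
    "\<And>s r. s \<in> {0..T} \<Longrightarrow> 0 \<le> r \<Longrightarrow> s - \<delta> s < r \<Longrightarrow> r < s \<Longrightarrow> w r i = l s"
    by metis
  have "compact {0..T}" by simp
  then obtain D where D: "D \<subseteq> {0..T}" "finite D" "{0..T} \<subseteq> (\<Union>s\<in>D. {s - \<delta> s<..<s + \<delta> s})"
  proof (rule compactE_image)
    show "{0..T} \<subseteq> (\<Union>s\<in>{0..T}. {s - \<delta> s<..<s + \<delta> s})" using \<delta>(1) by fastforce
  qed auto
  define B where "B = Max (insert 0 ((\<lambda>s. max (w s i) (l s)) ` D))"
  have B: "w s i \<le> B \<and> l s \<le> B" if "s \<in> D" for s
  proof -
    have "max (w s i) (l s) \<le> B" unfolding B_def using D that by (intro Max_ge) auto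
    then show ?thesis by simp
  qed
  have 1: "w r i \<le> B" if r: "r \<in> {0..T}" for r
  proof -
    obtain s where s: "s \<in> D" "s - \<delta> s < r" "r < s + \<delta> s" using D r by fastforce
    then have sT: "s \<in> {0..T}" using D by auto
    consider "r = s" | "s < r" | "r < s" by linarith
    then show ?thesis
      by cases (use B[OF s(1)] \<delta>(2)[OF sT, of r] \<delta>(3)[OF sT, of r] s r in auto)
  qed
  have 2: "\<exists>d>0. \<forall>r\<in>{0..T}. \<bar>r - a\<bar> < d \<longrightarrow> w r i = w a i" if a: "a \<in> {0..T} - D" for a
  proof -
    obtain s where s: "s \<in> D" "s - \<delta> s < a" "a < s + \<delta> s" using D a by fastforce
    then have sT: "s \<in> {0..T}" using D by auto
    have "a \<noteq> s" using s a by auto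
    then consider "s < a" | "a < s" by linarith
    then show ?thesis
    proof cases
      case 1
      have "w r i = w a i" if "r \<in> {0..T}" "\<bar>r - a\<bar> < min (a - s) (s + \<delta> s - a)" for r
        using \<delta>(2)[OF sT, of r] \<delta>(2)[OF sT, of a] that s 1 by auto
      then show ?thesis using 1 s by (intro exI[of _ "min (a - s) (s + \<delta> s - a)"]) auto
    next
      case 2
      have "w r i = w a i" if "r \<in> {0..T}" "\<bar>r - a\<bar> < min (s - a) (a - (s - \<delta> s))" for r
        using \<delta>(3)[OF sT, of r] \<delta>(3)[OF sT, of a] that s 2 a by auto
      then show ?thesis using 2 s by (intro exI[of _ "min (s - a) (a - (s - \<delta> s))"]) auto
    qed
  qed
  show ?thesis using D(2) 1 2 by blast
qed

lemma cadlag_local_finite_jumps: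
  fixes w :: "real \<Rightarrow> config"
  assumes w: "w \<in> cadlag_paths" and Z: "finite Z"
  shows "\<exists>B D. finite D \<and> (\<forall>s\<in>{0..T}. \<forall>i\<in>Z. w s i \<le> B) \<and>
    (\<forall>s\<in>{0..T} - D. \<exists>\<delta>>0. \<forall>r\<in>{0..T}. \<bar>r - s\<bar> < \<delta> \<longrightarrow> (\<forall>i\<in>Z. w r i = w s i))"
  using Z
proof (induction Z)
  case empty
  show ?case by (auto intro!: exI[of _ "{}"] exI[of _ 1])
next
  case (insert i Z)
  then obtain B D where BD: "finite D" "\<And>s i. s \<in> {0..T} \<Longrightarrow> i \<in> Z \<Longrightarrow> w s i \<le> B"
    "\<And>s. s \<in> {0..T} - D \<Longrightarrow> \<exists>\<delta>>0. \<forall>r\<in>{0..T}. \<bar>r - s\<bar> < \<delta> \<longrightarrow> (\<forall>i\<in>Z. w r i = w s i)"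
    by blast
  obtain B' D' where BD': "finite D'" "\<And>s. s \<in> {0..T} \<Longrightarrow> w s i \<le> B'"
    "\<And>s. s \<in> {0..T} - D' \<Longrightarrow> \<exists>\<delta>>0. \<forall>r\<in>{0..T}. \<bar>r - s\<bar> < \<delta> \<longrightarrow> w r i = w s i"
    using cadlag_coordinate_finite_jumps[OF w, of T i] by blast
  have "\<exists>\<delta>>0. \<forall>r\<in>{0..T}. \<bar>r - s\<bar> < \<delta> \<longrightarrow> (\<forall>i\<in>insert i Z. w r i = w s i)"
    if "s \<in> {0..T} - (D \<union> D')" for s
  proof -
    have s: "s \<in> {0..T} - D" "s \<in> {0..T} - D'" using that by auto
    obtain a where a: "a > 0" "\<And>r. r \<in> {0..T} \<Longrightarrow> \<bar>r - s\<bar> < a \<Longrightarrow> \<forall>i\<in>Z. w r i = w s i"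
      using BD(3)[OF s(1)] by blast
    obtain b where b: "b > 0" "\<And>r. r \<in> {0..T} \<Longrightarrow> \<bar>r - s\<bar> < b \<Longrightarrow> w r i = w s i"
      using BD'(3)[OF s(2)] by blast
    show ?thesis
      by (rule exI[of _ "min a b"]) (use a b in auto)
  qed
  moreover have "\<forall>s\<in>{0..T}. \<forall>j\<in>insert i Z. w s j \<le> max B B'"
    using BD(2) BD'(2) by (auto simp: le_max_iff_disj)
  ultimately show ?case
    using BD(1) BD'(1) by (intro exI[of _ "max B B'"] exI[of _ "D \<union> D'"]) auto
qed

text \<open>
  Uniform distance below one between natural numbers means equality: after the time change, the
  approximating path shows the same local configurations as the limit, at times that differ by less
  than \<open>e\<close>. The interval is enlarged to \<open>[0, t + 1]\<close> because the time change may exceed \<open>t\<close>.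
\<close>

lemma skorokhod_converges_local:
  assumes conv: "skorokhod_converges X w" and Z: "finite Z" and t: "0 \<le> t" and e: "e > 0"
  shows "\<forall>\<^sub>F n in sequentially. \<forall>s\<in>{0..t}. \<exists>r\<in>{0..t+1}. \<bar>r - s\<bar> < e \<and> (\<forall>i\<in>Z. X n s i = w r i)"
proof -
  obtain l where l: "\<And>n. l n \<in> time_changes"
    and lim: "uniform_limit {0..t+1} l (\<lambda>t. t) sequentially"
    and limX: "\<And>z. uniform_limit {0..t+1} (\<lambda>n s. real (X n (l n s) z)) (\<lambda>s. real (w s z)) sequentially"
  proof -
    obtain l where l: "\<forall>n. l n \<in> time_changes" "\<forall>T>0. uniform_limit {0..T} l (\<lambda>t. t) sequentially \<and>
        (\<forall>z. uniform_limit {0..T} (\<lambda>n t. real (X n (l n t) z)) (\<lambda>t. real (w t z)) sequentially)"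
      using conv unfolding skorokhod_converges_def by blast
    have "0 < t + 1" using t by simp
    with l that[of l] show thesis by blast
  qed
  have "\<forall>\<^sub>F n in sequentially. \<forall>s\<in>{0..t+1}. dist (l n s) s < min e 1"
    using lim e by (intro uniform_limitD) auto
  moreover have "\<forall>\<^sub>F n in sequentially. \<forall>i\<in>Z. \<forall>s\<in>{0..t+1}. dist (real (X n (l n s) i)) (real (w s i)) < 1"
    using Z uniform_limitD[OF limX, of 1] by (intro eventually_ball_finite) auto
  ultimately show ?thesis
  proof eventually_elim
    case (elim n)
    show ?case
    proof
      fix s assume s: "s \<in> {0..t}"
      have mono: "strict_mono_on {0..} (l n)" and bij: "bij_betw (l n) {0..} {0..}"
        using l[of n] by (auto simp: time_changes_def)
      obtain r where r: "r \<ge> 0" "l n r = s"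
      proof -
        have "s \<in> l n ` {0..}" using bij s by (auto simp: bij_betw_def)
        with that show thesis by auto
      qed
      have "r \<le> t + 1"
      proof (rule ccontr)
        assume "\<not> r \<le> t + 1"
        then have "l n (t + 1) < l n r" using mono t r by (auto simp: strict_mono_on_def)
        moreover have "\<bar>l n (t + 1) - (t + 1)\<bar> < 1" using bspec[OF elim(1), of "t + 1"] t by (simp add: dist_real_def)
        ultimately show False using r s by auto
      qed
      then have rt: "r \<in> {0..t+1}" using r by auto
      moreover have "\<bar>r - s\<bar> < e" using bspec[OF elim(1) rt] r(2) by (simp add: dist_real_def abs_minus_commute)
      moreover have "X n s i = w r i" if "i \<in> Z" for i
      proof -
        have "\<bar>real (X n s i) - real (w r i)\<bar> < 1" using bspec[OF bspec[OF elim(2) that] rt] r(2) by (simp add: dist_real_def)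
        then show ?thesis by linarith
      qed
      ultimately show "\<exists>r\<in>{0..t+1}. \<bar>r - s\<bar> < e \<and> (\<forall>i\<in>Z. X n s i = w r i)" by blast
    qed
  qed
qed

text \<open>
  By right-continuity the coordinates are limits of functions that are constant in time on intervals \<open>[k / n, (k + 1) / n)\<close>. The maximum with zero keeps the time inside the domain of the paths.
\<close>

lemma measurable_pair_path_eval:
  "(\<lambda>(s, w). w (max 0 s)) \<in> (lborel :: real measure) \<Otimes>\<^sub>M path_space \<rightarrow>\<^sub>M (borel :: config measure)"
proof -
  have coord: "(\<lambda>(s, w). real (w (max 0 s) i)) \<in> borel_measurable ((lborel :: real measure) \<Otimes>\<^sub>M (path_space :: (real \<Rightarrow> config) measure))" for i
  proof (rule borel_measurable_LIMSEQ_real)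
    \<comment> \<open>the right end point of the interval of length \<open>1 / (n + 1)\<close> that contains the time; it approaches the time strictly from the right\<close>
    define a where "a n s = (real_of_int \<lfloor>real (Suc n) * max 0 s\<rfloor> + 1) / real (Suc n)" for n s
    have a: "max 0 s < a n s" "a n s \<le> max 0 s + 1 / real (Suc n)" for n s
    proof -
      have y: "real (Suc n) * max 0 s < real_of_int \<lfloor>real (Suc n) * max 0 s\<rfloor> + 1"
          "real_of_int \<lfloor>real (Suc n) * max 0 s\<rfloor> \<le> real (Suc n) * max 0 s" by linarith+
      show "max 0 s < a n s"
        unfolding a_def using y(1) by (subst pos_less_divide_eq) (simp_all only: mult.commute of_nat_0_less_iff zero_less_Suc)
      have "a n s \<le> (real (Suc n) * max 0 s + 1) / real (Suc n)"
        unfolding a_def using y(2) by (intro divide_right_mono) simp_all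
      then show "a n s \<le> max 0 s + 1 / real (Suc n)"
        by (simp add: add_divide_distrib del: of_nat_Suc)
    qed
    show "(\<lambda>n. case z of (s, w) \<Rightarrow> real (w (a n s) i)) \<longlonglongrightarrow> (case z of (s, w) \<Rightarrow> real (w (max 0 s) i))"
      if "z \<in> space (lborel \<Otimes>\<^sub>M path_space)" for z :: "real \<times> (real \<Rightarrow> config)"
    proof -
      obtain s w where z: "z = (s, w)" by force
      then have w: "w \<in> cadlag_paths" using that by (auto simp: space_pair_measure)
      have "(\<lambda>n. a n s) \<longlonglongrightarrow> max 0 s"
      proof (rule tendsto_sandwich[of "\<lambda>_. max 0 s" _ _ "\<lambda>n. max 0 s + 1 / real (Suc n)"])
        show "(\<lambda>n. max 0 s + 1 / real (Suc n)) \<longlonglongrightarrow> max 0 s"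
          using tendsto_add[OF tendsto_const LIMSEQ_inverse_real_of_nat, of "max 0 s"]
          by (simp add: inverse_eq_divide)
      qed (use a in \<open>auto intro!: always_eventually less_imp_le\<close>)
      moreover have "\<forall>\<^sub>F n in sequentially. a n s \<in> {max 0 s<..} \<and> a n s \<noteq> max 0 s"
        using a(1)[where s = s] by (intro always_eventually allI) (metis greaterThan_iff less_irrefl)
      ultimately have "filterlim (\<lambda>n. a n s) (at_right (max 0 s)) sequentially"
        by (simp add: filterlim_at)
      moreover have "(w \<longlongrightarrow> w (max 0 s)) (at_right (max 0 s))"
        using w by (intro cadlag_right) auto
      ultimately have "(\<lambda>n. w (a n s)) \<longlonglongrightarrow> w (max 0 s)"
        by (rule filterlim_compose[rotated])
      then have "(\<lambda>n. w (a n s) i) \<longlonglongrightarrow> w (max 0 s) i"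
        by (rule tendsto_coord)
      then have "\<forall>\<^sub>F n in sequentially. w (a n s) i = w (max 0 s) i"
        unfolding tendsto_discrete .
      then show ?thesis unfolding z by (auto intro!: tendsto_eventually elim: eventually_mono)
    qed
    show "(\<lambda>z. case z of (s, w) \<Rightarrow> real (w (a n s) i)) \<in> borel_measurable ((lborel :: real measure) \<Otimes>\<^sub>M (path_space :: (real \<Rightarrow> config) measure))" for n
    proof -
      have "(\<lambda>z. (\<lambda>k z. real (snd z (max 0 ((real_of_int k + 1) / real (Suc n))) i))
          \<lfloor>real (Suc n) * max 0 (fst z)\<rfloor> z) \<in> borel_measurable ((lborel :: real measure) \<Otimes>\<^sub>M (path_space :: (real \<Rightarrow> config) measure))"
      proof (rule measurable_compose_countable[where
            f = "\<lambda>k z. real (snd z (max 0 ((real_of_int k + 1) / real (Suc n))) i)"])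
        show "(\<lambda>z. real (snd z (max 0 ((real_of_int k + 1) / real (Suc n))) i)) \<in> borel_measurable ((lborel :: real measure) \<Otimes>\<^sub>M (path_space :: (real \<Rightarrow> config) measure))" for k
          by (rule measurable_compose[OF measurable_compose[OF measurable_snd measurable_path_eval] measurable_coord_real]) simp
        show "(\<lambda>z. \<lfloor>real (Suc n) * max 0 (fst z)\<rfloor>) \<in> (lborel :: real measure) \<Otimes>\<^sub>M (path_space :: (real \<Rightarrow> config) measure) \<rightarrow>\<^sub>M count_space UNIV"
          by measurable
      qed
      moreover have "(real_of_int \<lfloor>real (Suc n) * max 0 s\<rfloor> + 1) / real (Suc n) \<ge> 0" for s
        using a(1)[where n = n and s = s] unfolding a_def by linarith
      ultimately show ?thesis by (simp add: a_def split_def max_absorb2 del: of_nat_Suc)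
    qed
  qed
  have "(\<lambda>(s, w) i. w (max 0 s) i) \<in> (lborel :: real measure) \<Otimes>\<^sub>M path_space \<rightarrow>\<^sub>M (Pi\<^sub>M UNIV (\<lambda>_. borel) :: config measure)"
  proof (rule measurable_PiM_single')
    fix i :: int
    have "(\<lambda>z. nat \<lfloor>case z of (s, w) \<Rightarrow> real (w (max 0 s) i)\<rfloor>) \<in> (lborel :: real measure) \<Otimes>\<^sub>M (path_space :: (real \<Rightarrow> config) measure) \<rightarrow>\<^sub>M borel"
      using coord[of i] by measurable
    then show "(\<lambda>z. (case z of (s, w) \<Rightarrow> \<lambda>i. w (max 0 s) i) i) \<in> (lborel :: real measure) \<Otimes>\<^sub>M (path_space :: (real \<Rightarrow> config) measure) \<rightarrow>\<^sub>M borel"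
      by (simp add: split_def)
  qed auto
  then show ?thesis
    by (simp add: measurable_cong_sets[OF refl sets_PiM_equal_borel])
qed

section \<open>Time integrals of local observables and Skorokhod convergence\<close>

lemma topspace_skorokhod [simp]: "topspace skorokhod_topology = cadlag_paths"
proof -
  have "openin skorokhod_topology cadlag_paths"
    by (auto simp: openin_skorokhod_topology)
  moreover have "topspace skorokhod_topology \<subseteq> cadlag_paths"
    using openin_topspace[of skorokhod_topology] by (simp only: openin_skorokhod_topology)
  ultimately show ?thesis by (metis openin_subset subset_antisym)
qed

text \<open>
  Open sets of the Skorokhod topology are the sequentially open ones, so sequential continuity suffices.
\<close>

lemma continuous_map_skorokhodI:
  fixes F :: "(real \<Rightarrow> config) \<Rightarrow> real"
  assumes "\<And>X w. (\<And>n. X n \<in> cadlag_paths) \<Longrightarrow> w \<in> cadlag_paths \<Longrightarrow> skorokhod_converges X w \<Longrightarrow>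
    (\<lambda>n. F (X n)) \<longlonglongrightarrow> F w"
  shows "continuous_map skorokhod_topology euclideanreal F"
  unfolding continuous_map_def
proof (intro conjI allI impI)
  fix U :: "real set" assume "openin euclideanreal U"
  then have U: "open U" by simp
  show "openin skorokhod_topology {x \<in> topspace skorokhod_topology. F x \<in> U}"
    unfolding openin_skorokhod_topology topspace_skorokhod
  proof (intro conjI ballI allI impI)
    fix w X assume w: "w \<in> {x \<in> cadlag_paths. F x \<in> U}"
      and X: "(\<forall>n. X n \<in> cadlag_paths) \<and> skorokhod_converges X w"
    have "(\<lambda>n. F (X n)) \<longlonglongrightarrow> F w" using assms w X by blast
    then have "\<forall>\<^sub>F n in sequentially. F (X n) \<in> U"
      by (rule topological_tendstoD) (use U w in auto)
    then show "\<forall>\<^sub>F n in sequentially. X n \<in> {x \<in> cadlag_paths. F x \<in> U}"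
      by (rule eventually_mono) (use X in auto)
  qed auto
qed auto

lemma integrable_indicator_const: "integrable lborel (\<lambda>s. indicator {a..b::real} s *\<^sub>R (c::real))"
proof -
  have "integrable lborel (indicat_real {a..b})"
    by (rule integrable_real_indicator) (auto simp: emeasure_lborel_Icc_eq)
  then show ?thesis by simp
qed

text \<open>
  Finite sums \<open>\<Sum>\<^sub>x v\<^sub>s\<^sub>,\<^sub>x g\<^sub>x(\<eta>)\<close> with time-continuous coefficients and functions \<open>g\<^sub>x\<close> of the occupation
  numbers in a finite set \<open>Z\<close>. The functions \<open>g\<^sub>x\<close> may be unbounded.
\<close>

locale local_observable =
  fixes t :: real and J :: "'j set" and v :: "real \<Rightarrow> 'j \<Rightarrow> real"
    and g :: "'j \<Rightarrow> config \<Rightarrow> real" and Z :: "int set"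
  assumes t_nonneg: "0 \<le> t" and fin_J: "finite J" and fin_Z: "finite Z"
    and cont_v: "\<And>x. x \<in> J \<Longrightarrow> continuous_on {0..t} (\<lambda>s. v s x)"
    and meas_g: "\<And>x. x \<in> J \<Longrightarrow> g x \<in> borel_measurable borel"
    and local_g: "\<And>x \<eta> \<xi>. x \<in> J \<Longrightarrow> (\<And>i. i \<in> Z \<Longrightarrow> \<eta> i = \<xi> i) \<Longrightarrow> g x \<eta> = g x \<xi>"
begin

definition H :: "real \<Rightarrow> config \<Rightarrow> real" where
  "H s \<eta> = (\<Sum>x\<in>J. v s x * g x \<eta>)"

definition I :: "(real \<Rightarrow> config) \<Rightarrow> real" where
  "I w = (LBINT s:{0..t}. H s (w s))"

lemma H_local: "(\<And>i. i \<in> Z \<Longrightarrow> \<eta> i = \<xi> i) \<Longrightarrow> H s \<eta> = H s \<xi>"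
  unfolding H_def by (intro sum.cong refl arg_cong2[of _ _ _ _ "(*)"] local_g) auto

text \<open>
  Bounded occupation numbers leave only finitely many local configurations.
\<close>

lemma H_bounded: "\<exists>M\<ge>0. \<forall>s\<in>{0..t}. \<forall>\<eta>. (\<forall>i\<in>Z. \<eta> i \<le> b) \<longrightarrow> \<bar>H s \<eta>\<bar> \<le> M"
proof -
  define A where "A = {f :: config. \<forall>i. (i \<in> Z \<longrightarrow> f i \<in> {..b}) \<and> (i \<notin> Z \<longrightarrow> f i = 0)}"
  have A: "finite A" unfolding A_def by (intro finite_set_of_finite_funs fin_Z) simp
  have "\<exists>c. \<forall>s\<in>{0..t}. \<bar>v s x\<bar> \<le> c" if "x \<in> J" for x
  proof -
    have "bounded ((\<lambda>s. v s x) ` {0..t})"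
      by (intro compact_imp_bounded compact_continuous_image cont_v that compact_Icc)
    then show ?thesis unfolding bounded_iff by auto
  qed
  then obtain c where c: "\<And>x s. x \<in> J \<Longrightarrow> s \<in> {0..t} \<Longrightarrow> \<bar>v s x\<bar> \<le> c x" by metis
  define d where "d x = (\<Sum>\<xi>\<in>A. \<bar>g x \<xi>\<bar>)" for x
  have d: "\<bar>g x \<eta>\<bar> \<le> d x" if "x \<in> J" "\<forall>i\<in>Z. \<eta> i \<le> b" for x \<eta>
  proof -
    \<comment> \<open>a representative of the local configuration in the finite set \<open>A\<close>\<close>
    define \<xi> where "\<xi> i = (if i \<in> Z then \<eta> i else 0)" for i
    have "\<xi> \<in> A" using that(2) by (auto simp: A_def \<xi>_def)
    then have "\<bar>g x \<xi>\<bar> \<le> d x" unfolding d_def using A by (intro member_le_sum) auto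
    moreover have "g x \<eta> = g x \<xi>" using that(1) by (intro local_g) (auto simp: \<xi>_def)
    ultimately show ?thesis by simp
  qed
  have d0: "0 \<le> d x" for x unfolding d_def by (intro sum_nonneg) simp
  have c0: "0 \<le> c x" if "x \<in> J" for x
    using c[OF that, of 0] t_nonneg by auto
  have "\<bar>H s \<eta>\<bar> \<le> (\<Sum>x\<in>J. c x * d x)" if s: "s \<in> {0..t}" and \<eta>: "\<forall>i\<in>Z. \<eta> i \<le> b" for s \<eta>
  proof -
    have "\<bar>H s \<eta>\<bar> \<le> (\<Sum>x\<in>J. \<bar>v s x * g x \<eta>\<bar>)" unfolding H_def by (rule sum_abs)
    also have "\<dots> \<le> (\<Sum>x\<in>J. c x * d x)"
      unfolding abs_mult by (intro sum_mono mult_mono c d s \<eta> c0) simp_all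
    finally show ?thesis .
  qed
  moreover have "0 \<le> (\<Sum>x\<in>J. c x * d x)" by (intro sum_nonneg mult_nonneg_nonneg c0 d0)
  ultimately show ?thesis by blast
qed

lemma measurable_pair:
  "(\<lambda>(s, w). indicator {0..t} s *\<^sub>R H s (w s)) \<in> borel_measurable ((lborel :: real measure) \<Otimes>\<^sub>M path_space)"
proof -
  have eq: "(\<lambda>(s, w). indicator {0..t} s *\<^sub>R H s (w s)) =
      (\<lambda>z. \<Sum>x\<in>J. (indicator {0..t} (fst z) *\<^sub>R v (fst z) x) * g x (case z of (s, w) \<Rightarrow> w (max 0 s)))"
    by (auto simp: H_def sum_distrib_left max_def indicator_def fun_eq_iff)
  have "(\<lambda>s. indicator {0..t} s *\<^sub>R v s x) \<in> borel_measurable lborel" if "x \<in> J" for x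
    using borel_measurable_continuous_on_indicator[OF _ cont_v[OF that]] by simp
  then show ?thesis unfolding eq
    by (intro borel_measurable_sum borel_measurable_times
       measurable_compose[OF measurable_fst] measurable_compose[OF measurable_pair_path_eval meas_g])
qed

lemma measurable_section:
  assumes "w \<in> cadlag_paths"
  shows "(\<lambda>s. indicator {0..t} s *\<^sub>R H s (w s)) \<in> borel_measurable lborel"
proof -
  have "(\<lambda>s. (s, w)) \<in> (lborel :: real measure) \<rightarrow>\<^sub>M lborel \<Otimes>\<^sub>M path_space"
    using assms by (intro measurable_Pair2') simp
  from measurable_compose[OF this measurable_pair] show ?thesis by simp
qed

lemma measurable_I: "I \<in> borel_measurable path_space"
proof -
  have "(\<lambda>(w, s). indicator {0..t} s *\<^sub>R H s (w s)) \<in> borel_measurable (path_space \<Otimes>\<^sub>M (lborel :: real measure))"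
    using measurable_pair_swap[OF measurable_pair] by (simp add: split_def)
  from lborel.borel_measurable_lebesgue_integral[OF this] show ?thesis
    unfolding I_def[abs_def] set_lebesgue_integral_def by simp
qed

lemma set_integrable_H:
  assumes "w \<in> cadlag_paths" shows "set_integrable lborel {0..t} (\<lambda>s. H s (w s))"
proof -
  obtain b D where b: "\<And>s i. s \<in> {0..t} \<Longrightarrow> i \<in> Z \<Longrightarrow> w s i \<le> b"
    using cadlag_local_finite_jumps[OF assms fin_Z, of t] by blast
  obtain M where M: "M \<ge> 0" "\<And>s \<eta>. s \<in> {0..t} \<Longrightarrow> (\<forall>i\<in>Z. \<eta> i \<le> b) \<Longrightarrow> \<bar>H s \<eta>\<bar> \<le> M"
    using H_bounded[of b] by blast
  show ?thesis unfolding set_integrable_def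
  proof (rule Bochner_Integration.integrable_bound)
    show "integrable lborel (\<lambda>s. indicator {0..t} s *\<^sub>R M)" by (rule integrable_indicator_const)
    show "(\<lambda>s. indicator {0..t} s *\<^sub>R H s (w s)) \<in> borel_measurable lborel"
      by (rule measurable_section[OF assms])
    show "AE s in lborel. norm (indicator {0..t} s *\<^sub>R H s (w s)) \<le> norm (indicator {0..t} s *\<^sub>R M)"
    proof (rule AE_I2)
      fix s :: real
      show "norm (indicator {0..t} s *\<^sub>R H s (w s)) \<le> norm (indicator {0..t} s *\<^sub>R M)"
        using M(1) M(2)[of s "w s"] b[of s] by (cases "s \<in> {0..t}") auto
    qed
  qed
qed

text \<open>
  Off the finitely many jump times of the limit on \<open>Z\<close>, the local configurations of the approximating
  paths are eventually equal to that of the limit. They are bounded uniformly on \<open>[0, t]\<close>, so dominated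
  convergence applies although the observable itself is unbounded.
\<close>

lemma I_skorokhod_continuous:
  assumes X: "\<And>n. X n \<in> cadlag_paths" and w: "w \<in> cadlag_paths" and conv: "skorokhod_converges X w"
  shows "(\<lambda>n. I (X n)) \<longlonglongrightarrow> I w"
proof -
  obtain b D where D: "finite D" and b: "\<And>s i. s \<in> {0..t+1} \<Longrightarrow> i \<in> Z \<Longrightarrow> w s i \<le> b"
    and jump: "\<And>s. s \<in> {0..t+1} - D \<Longrightarrow> \<exists>\<delta>>0. \<forall>r\<in>{0..t+1}. \<bar>r - s\<bar> < \<delta> \<longrightarrow> (\<forall>i\<in>Z. w r i = w s i)"
    using cadlag_local_finite_jumps[OF w fin_Z, of "t + 1"] by blast
  obtain M where M: "M \<ge> 0" "\<And>s \<eta>. s \<in> {0..t} \<Longrightarrow> (\<forall>i\<in>Z. \<eta> i \<le> b) \<Longrightarrow> \<bar>H s \<eta>\<bar> \<le> M"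
    using H_bounded[of b] by blast
  have "\<forall>\<^sub>F n in sequentially. \<forall>s\<in>{0..t}. \<exists>r\<in>{0..t+1}. \<bar>r - s\<bar> < 1 \<and> (\<forall>i\<in>Z. X n s i = w r i)"
    by (rule skorokhod_converges_local[OF conv fin_Z t_nonneg]) simp
  then obtain N where "\<And>n s. n \<ge> N \<Longrightarrow> s \<in> {0..t} \<Longrightarrow> \<exists>r\<in>{0..t+1}. \<bar>r - s\<bar> < 1 \<and> (\<forall>i\<in>Z. X n s i = w r i)"
    unfolding eventually_sequentially by blast
  then have bX: "X (n + N) s i \<le> b" if "s \<in> {0..t}" "i \<in> Z" for n s i
    using that b by (metis le_add2)
  have lim: "(\<lambda>n. H s (X (n + N) s)) \<longlonglongrightarrow> H s (w s)" if s: "s \<in> {0..t} - D" for s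
  proof -
    have "s \<in> {0..t+1} - D" using s by auto
    then obtain \<delta> where \<delta>: "\<delta> > 0" "\<And>r. r \<in> {0..t+1} \<Longrightarrow> \<bar>r - s\<bar> < \<delta> \<Longrightarrow> \<forall>i\<in>Z. w r i = w s i"
      using jump by blast
    have "\<forall>\<^sub>F n in sequentially. \<forall>s\<in>{0..t}. \<exists>r\<in>{0..t+1}. \<bar>r - s\<bar> < \<delta> \<and> (\<forall>i\<in>Z. X n s i = w r i)"
      by (rule skorokhod_converges_local[OF conv fin_Z t_nonneg \<delta>(1)])
    then have "\<forall>\<^sub>F n in sequentially. H s (X n s) = H s (w s)"
    proof (rule eventually_mono)
      fix n assume "\<forall>s\<in>{0..t}. \<exists>r\<in>{0..t+1}. \<bar>r - s\<bar> < \<delta> \<and> (\<forall>i\<in>Z. X n s i = w r i)"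
      then obtain r where r: "r \<in> {0..t+1}" "\<bar>r - s\<bar> < \<delta>" "\<forall>i\<in>Z. X n s i = w r i" using s by blast
      show "H s (X n s) = H s (w s)"
        by (rule H_local) (use r \<delta>(2)[OF r(1,2)] in simp)
    qed
    then have "(\<lambda>n. H s (X n s)) \<longlonglongrightarrow> H s (w s)" by (rule tendsto_eventually)
    then show ?thesis by (rule LIMSEQ_ignore_initial_segment)
  qed
  have "(\<lambda>n. I (X (n + N))) \<longlonglongrightarrow> I w"
    unfolding I_def set_lebesgue_integral_def
  proof (rule integral_dominated_convergence[where w = "\<lambda>s. indicator {0..t} s *\<^sub>R M"])
    show "integrable lborel (\<lambda>s. indicator {0..t} s *\<^sub>R M)" by (rule integrable_indicator_const)
    have "AE s in lborel. s \<notin> D"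
      by (rule AE_not_in[OF countable_imp_null_set_lborel[OF countable_finite[OF D]]])
    then show "AE s in lborel. (\<lambda>n. indicator {0..t} s *\<^sub>R H s (X (n + N) s)) \<longlonglongrightarrow> indicator {0..t} s *\<^sub>R H s (w s)"
    proof (rule AE_mp[OF _ AE_I2], intro impI)
      fix s assume "s \<notin> D"
      then show "(\<lambda>n. indicator {0..t} s *\<^sub>R H s (X (n + N) s)) \<longlonglongrightarrow> indicator {0..t} s *\<^sub>R H s (w s)"
        using lim[of s] by (cases "s \<in> {0..t}") auto
    qed
    show "AE s in lborel. norm (indicator {0..t} s *\<^sub>R H s (X (n + N) s)) \<le> indicator {0..t} s *\<^sub>R M" for n
    proof (rule AE_I2)
      fix s :: real
      show "norm (indicator {0..t} s *\<^sub>R H s (X (n + N) s)) \<le> indicator {0..t} s *\<^sub>R M"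
        using M(2)[of s "X (n + N) s"] bX[of s] by (cases "s \<in> {0..t}") auto
    qed
  qed (use measurable_section X w in auto)
  then show ?thesis by (rule LIMSEQ_offset)
qed

text \<open>
  Weak convergence is used for the bounded continuous functionals \<open>min (\<phi> (I w)) m\<close>; monotone convergence
  in \<open>m\<close> then removes the truncation.
\<close>

theorem weak_limit_bound:
  fixes \<phi> :: "real \<Rightarrow> real"
  assumes weak: "skorokhod_weakly_converges N P"
    and P: "prob_space P" "sets P = sets path_space"
    and N: "\<And>K. K \<ge> K0 \<Longrightarrow> prob_space (N K)" "\<And>K. K \<ge> K0 \<Longrightarrow> sets (N K) = sets path_space"
    and \<phi>: "continuous_on UNIV \<phi>" "\<And>x. 0 \<le> \<phi> x"
    and bound: "\<And>K. K \<ge> K0 \<Longrightarrow> (\<integral>\<^sup>+w. ennreal (\<phi> (I w)) \<partial>N K) \<le> ennreal c"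
    and c: "0 \<le> c"
  shows "(\<integral>\<^sup>+w. ennreal (\<phi> (I w)) \<partial>P) \<le> ennreal c"
proof -
  define F where "F m w = min (\<phi> (I w)) (real m)" for m w
  have F0: "0 \<le> F m w" "F m w \<le> real m" for m w using \<phi>(2) by (auto simp: F_def)
  have \<phi>m: "\<phi> \<in> borel_measurable borel" using \<phi>(1) by (rule borel_measurable_continuous_onI)
  have Fm: "F m \<in> borel_measurable path_space" for m
    unfolding F_def[abs_def] by (intro borel_measurable_min measurable_compose[OF measurable_I \<phi>m] borel_measurable_const)
  have Fmeas: "F m \<in> borel_measurable Q" if "sets Q = sets path_space" for m Q
    using Fm measurable_cong_sets[OF that refl] by blast
  have int: "integrable Q (F m)" if "prob_space Q" "sets Q = sets path_space" for Q m
  proof -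
    interpret prob_space Q by fact
    show ?thesis by (rule integrable_const_bound[of _ "real m"]) (use F0 Fmeas[OF that(2)] in auto)
  qed
  have "(\<integral>w. F m w \<partial>P) \<le> c" for m
  proof (rule LIMSEQ_le_const2)
    have "continuous_map skorokhod_topology euclideanreal (F m)"
    proof (rule continuous_map_skorokhodI)
      fix X w assume *: "\<And>n. X n \<in> cadlag_paths" "w \<in> cadlag_paths" "skorokhod_converges X w"
      have "(\<lambda>n. \<phi> (I (X n))) \<longlonglongrightarrow> \<phi> (I w)"
        using \<phi>(1) I_skorokhod_continuous[OF *] by (rule continuous_on_tendsto_compose) auto
      then show "(\<lambda>n. F m (X n)) \<longlonglongrightarrow> F m w"
        unfolding F_def by (intro tendsto_min tendsto_const)
    qed
    moreover have "bounded (F m ` cadlag_paths)"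
      unfolding bounded_iff using F0 by (intro exI[of _ "real m"]) auto
    ultimately show "(\<lambda>K. \<integral>w. F m w \<partial>N K) \<longlonglongrightarrow> (\<integral>w. F m w \<partial>P)"
      using weak unfolding skorokhod_weakly_converges_def by blast
    have "(\<integral>w. F m w \<partial>N K) \<le> c" if K: "K \<ge> K0" for K
    proof -
      have "ennreal (\<integral>w. F m w \<partial>N K) = (\<integral>\<^sup>+w. ennreal (F m w) \<partial>N K)"
        by (intro nn_integral_eq_integral[symmetric] int N K) (use F0 in auto)
      also have "\<dots> \<le> (\<integral>\<^sup>+w. ennreal (\<phi> (I w)) \<partial>N K)"
        by (intro nn_integral_mono ennreal_leI) (auto simp: F_def)
      also have "\<dots> \<le> ennreal c" by (rule bound[OF K])
      finally show ?thesis using c by (simp add: ennreal_le_iff)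
    qed
    then show "\<exists>K1. \<forall>K\<ge>K1. (\<integral>w. F m w \<partial>N K) \<le> c" by blast
  qed
  then have Fc: "(\<integral>\<^sup>+w. ennreal (F m w) \<partial>P) \<le> ennreal c" for m
    by (subst nn_integral_eq_integral[OF int[OF P]]) (use F0 in \<open>auto intro: ennreal_leI\<close>)
  have "(\<integral>\<^sup>+w. ennreal (\<phi> (I w)) \<partial>P) = (\<integral>\<^sup>+w. (SUP m. ennreal (F m w)) \<partial>P)"
  proof (rule nn_integral_cong)
    fix w
    obtain k :: nat where k: "\<phi> (I w) \<le> real k" using real_arch_simple by blast
    show "ennreal (\<phi> (I w)) = (SUP m. ennreal (F m w))"
    proof (rule antisym)
      have "ennreal (\<phi> (I w)) = ennreal (F k w)" using k by (simp add: F_def)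
      also have "\<dots> \<le> (SUP m. ennreal (F m w))" by (rule SUP_upper) simp
      finally show "ennreal (\<phi> (I w)) \<le> (SUP m. ennreal (F m w))" .
      show "(SUP m. ennreal (F m w)) \<le> ennreal (\<phi> (I w))"
        by (intro SUP_least ennreal_leI) (simp add: F_def)
    qed
  qed
  also have "\<dots> = (SUP m. \<integral>\<^sup>+w. ennreal (F m w) \<partial>P)"
  proof (rule nn_integral_monotone_convergence_SUP)
    show "incseq (\<lambda>m w. ennreal (F m w))"
      by (auto simp: incseq_def le_fun_def F_def intro!: ennreal_leI)
    show "(\<lambda>w. ennreal (F m w)) \<in> borel_measurable P" for m
      using Fmeas[OF P(2)] by measurable
  qed
  also have "\<dots> \<le> ennreal c" by (intro SUP_least Fc)
  finally show ?thesis .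
qed

end

section \<open>The generator on the torus\<close>

lemma sum_move:
  assumes "finite I" "x \<in> I" "y \<in> I" "x \<noteq> y" "0 < \<eta> x"
  shows "(\<Sum>i\<in>I. move x y \<eta> i) = (\<Sum>i\<in>I. \<eta> i)"
proof -
  have I: "I = insert x (insert y (I - {x, y}))" using assms by auto
  have "(\<Sum>i\<in>I - {x, y}. move x y \<eta> i) = (\<Sum>i\<in>I - {x, y}. \<eta> i)"
    by (intro sum.cong) (auto simp: move_def)
  moreover have "(\<Sum>i\<in>I. f i) = f x + (f y + (\<Sum>i\<in>I - {x, y}. f i))" for f :: "int \<Rightarrow> nat"
    using assms by (subst I) simp
  ultimately show ?thesis using assms(4,5) by (simp add: move_def)
qed

lemma finite_torus [simp]: "finite (torus K)"
  by (simp add: torus_def)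

lemma torus_rep_in [simp]: "torus_rep K z \<in> torus K"
  unfolding torus_rep_def torus_def
  using pos_mod_bound[of "2 * int K + 1" "z + int K"] pos_mod_sign[of "2 * int K + 1" "z + int K"]
  by auto

lemma torus_rep_id: "z \<in> torus K \<Longrightarrow> torus_rep K z = z"
  unfolding torus_rep_def torus_def by (subst mod_pos_pos_trivial) auto

lemma torus_rep_cong: "z mod (2 * int K + 1) = z' mod (2 * int K + 1) \<Longrightarrow> torus_rep K z = torus_rep K z'"
  unfolding torus_rep_def by (metis mod_add_left_eq)

lemma torus_rep_mod: "torus_rep K z mod (2 * int K + 1) = z mod (2 * int K + 1)"
  unfolding torus_rep_def by (simp add: mod_diff_left_eq)

lemma torus_rep_shift_inverse:
  assumes "x \<in> torus K" shows "torus_rep K (torus_rep K (x + d) - d) = x"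
proof -
  have "(torus_rep K (x + d) - d) mod (2 * int K + 1) = (x + d - d) mod (2 * int K + 1)"
    by (intro mod_diff_cong torus_rep_mod refl)
  then have "torus_rep K (torus_rep K (x + d) - d) = torus_rep K x"
    by (intro torus_rep_cong) simp
  then show ?thesis using torus_rep_id[OF assms] by simp
qed

lemma sum_torus_shift:
  "(\<Sum>x\<in>torus K. f (torus_rep K (x + d))) = (\<Sum>x\<in>torus K. f x)"
proof (rule sum.reindex_bij_witness[of _ "\<lambda>x. torus_rep K (x - d)" "\<lambda>x. torus_rep K (x + d)"])
  show "torus_rep K (torus_rep K (a + d) - d) = a" if "a \<in> torus K" for a
    by (rule torus_rep_shift_inverse[OF that])
  show "torus_rep K (torus_rep K (a - d) + d) = a" if "a \<in> torus K" for a
    using torus_rep_shift_inverse[OF that, of "-d"] by simp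
qed auto

lemma torus_rep_neq:
  assumes K: "1 \<le> K" and x: "x \<in> torus K" and d: "d = 1 \<or> d = -1"
  shows "torus_rep K (x + d) \<noteq> x"
proof
  assume "torus_rep K (x + d) = x"
  then have "x mod (2 * int K + 1) = (x + d) mod (2 * int K + 1)" using torus_rep_mod[of K "x + d"] by simp
  then have "(2 * int K + 1) dvd (x - (x + d))" by (simp only: mod_eq_dvd_iff)
  then have "(2 * int K + 1) dvd d" by simp
  then have "\<bar>2 * int K + 1\<bar> \<le> \<bar>d\<bar>" using d by (intro dvd_imp_le_int) auto
  then show False using d K by auto
qed

context inclusion_law
begin

definition \<mu> :: "nat \<Rightarrow> config \<Rightarrow> real" where
  "\<mu> K \<eta> = pmf (config_pmf (torus K)) \<eta>"

lemma mu_eq: "\<eta> \<in> torus_configs K \<Longrightarrow> \<mu> K \<eta> = (\<Prod>i\<in>torus K. pmf site_pmf (\<eta> i))"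
  unfolding \<mu>_def config_pmf_def torus_configs_def by (subst pmf_Pi) (auto simp: PiE_def extensional_def)

lemma mu_pos: "\<eta> \<in> torus_configs K \<Longrightarrow> 0 < \<mu> K \<eta>"
  by (simp add: mu_eq prod_pos pmf_site_pos)

lemma mu_nonneg: "0 \<le> \<mu> K \<eta>"
  by (simp add: \<mu>_def)

lemma measure_torus_measure:
  assumes "\<eta> \<in> torus_configs K"
  shows "measure (torus_measure \<alpha> \<rho> K) {\<eta>} = \<mu> K \<eta>"
proof -
  interpret product_sigma_finite "\<lambda>_ :: int. measure_pmf site_pmf"
    by unfold_locales
  have "{\<eta>} = (\<Pi>\<^sub>E i\<in>torus K. {\<eta> i})"
    using assms by (intro PiE_singleton[symmetric]) (auto simp: torus_configs_def PiE_iff)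
  then have "emeasure (torus_measure \<alpha> \<rho> K) {\<eta>} = (\<Prod>i\<in>torus K. emeasure (measure_pmf site_pmf) {\<eta> i})"
    unfolding torus_measure_def site_measure_eq by (simp only:) (rule emeasure_PiM, simp_all)
  also have "\<dots> = ennreal (\<mu> K \<eta>)"
    by (simp add: mu_eq[OF assms] emeasure_pmf_single prod_ennreal)
  finally show ?thesis by (simp add: measure_def mu_nonneg)
qed

text \<open>
  Configurations with particle number in \<open>J\<close>. They form a finite set if \<open>J\<close> is finite, and the dynamics
  does not leave it.
\<close>

definition level :: "nat \<Rightarrow> nat set \<Rightarrow> config set" where
  "level K J = {\<eta> \<in> torus_configs K. (\<Sum>i\<in>torus K. \<eta> i) \<in> J}"

lemma finite_level:
  assumes "finite J" shows "finite (level K J)"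
proof -
  have "\<eta> i \<le> Max J" if "\<eta> \<in> level K J" "i \<in> torus K" for \<eta> i
  proof -
    have "\<eta> i \<le> (\<Sum>i\<in>torus K. \<eta> i)" using that(2) by (intro member_le_sum) auto
    also have "\<dots> \<le> Max J" using that(1) assms by (intro Max_ge) (auto simp: level_def)
    finally show ?thesis .
  qed
  then have "level K J \<subseteq> (\<Pi>\<^sub>E i\<in>torus K. {..Max J})"
    by (force simp: level_def torus_configs_def PiE_iff)
  then show ?thesis by (rule finite_subset) (simp add: finite_PiE)
qed

lemma move_apply: "move x y \<eta> z = \<eta> z + of_bool (z = y) - of_bool (z = x)"
  by (simp add: move_def)

lemma move_inverse: "x \<noteq> y \<Longrightarrow> 0 < \<eta> x \<Longrightarrow> move y x (move x y \<eta>) = \<eta>"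
  by (auto simp: move_def fun_eq_iff)

lemma move_level:
  assumes "\<eta> \<in> level K J" "x \<in> torus K" "y \<in> torus K" "x \<noteq> y" "0 < \<eta> x"
  shows "move x y \<eta> \<in> level K J"
proof -
  let ?T = "torus K"
  have "(\<Sum>i\<in>?T. move x y \<eta> i) = (\<Sum>i\<in>?T. \<eta> i)"
    using assms by (intro sum_move) auto
  moreover have "move x y \<eta> \<in> torus_configs K"
    using assms by (auto simp: level_def torus_configs_def PiE_iff extensional_def move_apply)
  ultimately show ?thesis using assms by (simp add: level_def)
qed

text \<open>
  Reversibility of the symmetric inclusion process: the one-site weights satisfy
  \<open>(n + 1) w(n + 1) = \<phi> (\<alpha> + n) w(n)\<close>, and the factor \<open>\<phi>\<close> cancels between the two ends of the jump.
\<close>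

lemma detailed_balance:
  assumes \<eta>: "\<eta> \<in> level K J" and xy: "x \<in> torus K" "y \<in> torus K" "x \<noteq> y" and pos: "0 < \<eta> x"
  shows "\<mu> K \<eta> * (real (\<eta> x) * (\<alpha> + real (\<eta> y))) =
    \<mu> K (move x y \<eta>) * (real (move x y \<eta> y) * (\<alpha> + real (move x y \<eta> x)))"
proof -
  let ?T = "torus K" and ?\<xi> = "move x y \<eta>" and ?w = "pmf site_pmf"
  obtain a where a: "\<eta> x = Suc a" using pos by (cases "\<eta> x") auto
  have \<xi>: "?\<xi> x = a" "?\<xi> y = Suc (\<eta> y)" using xy a by (auto simp: move_apply)
  have T: "?T = insert x (insert y (?T - {x, y}))" using xy by auto
  have split: "(\<Prod>i\<in>?T. f i) = f x * (f y * (\<Prod>i\<in>?T - {x, y}. f i))" for f :: "int \<Rightarrow> real"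
    using xy(3) by (subst T) simp
  have rest: "(\<Prod>i\<in>?T - {x, y}. ?w (?\<xi> i)) = (\<Prod>i\<in>?T - {x, y}. ?w (\<eta> i))"
    by (intro prod.cong) (auto simp: move_apply)
  define R where "R = (\<Prod>i\<in>?T - {x, y}. ?w (\<eta> i))"
  have \<mu>: "\<mu> K \<eta> = ?w (Suc a) * (?w (\<eta> y) * R)" "\<mu> K ?\<xi> = ?w a * (?w (Suc (\<eta> y)) * R)"
    using \<eta> move_level[OF \<eta> xy pos]
    by (simp_all add: level_def mu_eq split rest a \<xi> R_def)
  have e1: "(\<alpha> + \<rho>) * (real (Suc a) * ?w (Suc a)) = \<rho> * ((\<alpha> + real a) * ?w a)"
    and e2: "(\<alpha> + \<rho>) * (real (Suc (\<eta> y)) * ?w (Suc (\<eta> y))) = \<rho> * ((\<alpha> + real (\<eta> y)) * ?w (\<eta> y))"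
    by (rule pmf_site_Suc)+
  have "(\<alpha> + \<rho>) * \<rho> * ((real (Suc a) * ?w (Suc a)) * ((\<alpha> + real (\<eta> y)) * ?w (\<eta> y))) =
    (\<alpha> + \<rho>) * \<rho> * (((\<alpha> + real a) * ?w a) * (real (Suc (\<eta> y)) * ?w (Suc (\<eta> y))))"
    using e1 e2 by algebra
  then have "(real (Suc a) * ?w (Suc a)) * ((\<alpha> + real (\<eta> y)) * ?w (\<eta> y)) =
    ((\<alpha> + real a) * ?w a) * (real (Suc (\<eta> y)) * ?w (Suc (\<eta> y)))"
    using alpha_pos rho_pos by simp
  then show ?thesis unfolding \<mu> a \<xi> by algebra
qed

text \<open>
  Detailed balance in weak form. The map \<open>\<eta> \<mapsto> \<eta>\<^bsup>x,y\<^esup>\<close> is a bijection from the configurations with a particle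
  at \<open>x\<close> to those with a particle at \<open>y\<close>; all other configurations have rate zero.
\<close>

lemma change_of_variables:
  assumes J: "finite J" and xy: "x \<in> torus K" "y \<in> torus K" "x \<noteq> y"
  shows "(\<Sum>\<eta>\<in>level K J. \<mu> K \<eta> * (real (\<eta> x) * (\<alpha> + real (\<eta> y))) * f \<eta> (move x y \<eta>)) =
    (\<Sum>\<eta>\<in>level K J. \<mu> K \<eta> * (real (\<eta> y) * (\<alpha> + real (\<eta> x))) * f (move y x \<eta>) \<eta>)"
proof -
  let ?C = "level K J"
  have fin: "finite ?C" by (rule finite_level[OF J])
  have "(\<Sum>\<eta>\<in>?C. \<mu> K \<eta> * (real (\<eta> x) * (\<alpha> + real (\<eta> y))) * f \<eta> (move x y \<eta>)) =
      (\<Sum>\<eta>\<in>{\<eta>\<in>?C. 0 < \<eta> x}. \<mu> K \<eta> * (real (\<eta> x) * (\<alpha> + real (\<eta> y))) * f \<eta> (move x y \<eta>))"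
    by (rule sum.mono_neutral_right) (use fin in auto)
  also have "\<dots> = (\<Sum>\<eta>\<in>{\<eta>\<in>?C. 0 < \<eta> y}. \<mu> K \<eta> * (real (\<eta> y) * (\<alpha> + real (\<eta> x))) * f (move y x \<eta>) \<eta>)"
  proof (rule sum.reindex_bij_witness[of _ "move y x" "move x y"])
    fix \<eta> assume \<eta>: "\<eta> \<in> {\<eta>\<in>?C. 0 < \<eta> x}"
    show "move y x (move x y \<eta>) = \<eta>" using move_inverse xy \<eta> by auto
    show "move x y \<eta> \<in> {\<eta>\<in>?C. 0 < \<eta> y}"
      using move_level[of \<eta> K J x y] xy \<eta> by (auto simp: move_apply)
    show "\<mu> K (move x y \<eta>) * (real (move x y \<eta> y) * (\<alpha> + real (move x y \<eta> x))) *
        f (move y x (move x y \<eta>)) (move x y \<eta>) =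
        \<mu> K \<eta> * (real (\<eta> x) * (\<alpha> + real (\<eta> y))) * f \<eta> (move x y \<eta>)"
      using detailed_balance[of \<eta> K J x y] move_inverse[of x y \<eta>] xy \<eta> by simp
  next
    fix \<eta> assume \<eta>: "\<eta> \<in> {\<eta>\<in>?C. 0 < \<eta> y}"
    show "move x y (move y x \<eta>) = \<eta>" using move_inverse xy \<eta> by auto
    show "move y x \<eta> \<in> {\<eta>\<in>?C. 0 < \<eta> x}"
      using move_level[of \<eta> K J y x] xy \<eta> by (auto simp: move_apply)
  qed
  also have "\<dots> = (\<Sum>\<eta>\<in>?C. \<mu> K \<eta> * (real (\<eta> y) * (\<alpha> + real (\<eta> x))) * f (move y x \<eta>) \<eta>)"
    by (rule sum.mono_neutral_left) (use fin in auto)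
  finally show ?thesis .
qed

end

locale torus_process = inclusion_law +
  fixes \<beta> :: real and L K :: nat
  assumes beta_pos: "0 < \<beta>" and beta_L: "\<beta>\<^sup>2 \<le> real L" and K_pos: "1 \<le> K"
begin

abbreviation "T \<equiv> torus K"
abbreviation "S \<equiv> torus_configs K"
abbreviation "rate \<equiv> torus_rate \<alpha> \<beta> L K"
abbreviation "m \<equiv> \<mu> K"
abbreviation "lev \<equiv> level K"
abbreviation nxt :: "int \<Rightarrow> int" where "nxt x \<equiv> torus_rep K (x + 1)"
abbreviation prv :: "int \<Rightarrow> int" where "prv x \<equiv> torus_rep K (x - 1)"
text \<open>
  The speeded-up probabilities of jumps to the right and to the left.
\<close>

definition P :: real where "P = (real L)\<^sup>2 * p_rate \<beta> L"
definition Q :: real where "Q = (real L)\<^sup>2 * q_rate \<beta> L"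

lemma L_pos: "0 < real L"
  using beta_pos beta_L by (smt (verit) zero_less_power)

lemma rate_bounds: "(real L)\<^sup>2 / 2 \<le> P" "0 \<le> Q"
proof -
  have "\<beta> \<le> sqrt (real L)" using beta_L by (rule real_le_rsqrt)
  then have "\<beta> / sqrt (real L) \<le> 1" using L_pos by (simp add: divide_le_eq)
  then show "0 \<le> Q" unfolding Q_def q_rate_def by (intro mult_nonneg_nonneg) auto
  have "0 \<le> \<beta> / sqrt (real L)" using beta_pos by simp
  then have "1 / 2 \<le> p_rate \<beta> L" unfolding p_rate_def by simp
  from mult_left_mono[OF this, of "(real L)\<^sup>2"] show "(real L)\<^sup>2 / 2 \<le> P"
    unfolding P_def by simp
qed

lemma neighbours: "x \<in> T \<Longrightarrow> nxt x \<noteq> x" "x \<in> T \<Longrightarrow> prv x \<noteq> x"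
  using torus_rep_neq[OF K_pos, of x 1] torus_rep_neq[OF K_pos, of x "-1"] by auto

lemma rate_nonneg: "0 \<le> rate \<eta> \<xi>"
  unfolding torus_rate_def Let_def P_def[symmetric] Q_def[symmetric]
  using rate_bounds alpha_pos L_pos
  by (intro sum_nonneg add_nonneg_nonneg mult_nonneg_nonneg) (auto intro: order_trans[OF _ rate_bounds(1)])

lemma rate_outside:
  assumes "\<eta> \<in> lev J" "\<xi> \<notin> lev J" shows "rate \<eta> \<xi> = 0"
  unfolding torus_rate_def Let_def
proof (rule sum.neutral, rule ballI)
  fix x assume x: "x \<in> T"
  have "\<eta> x = 0 \<or> \<xi> \<noteq> move x y \<eta>" if "y \<in> T" "y \<noteq> x" for y
    using move_level[OF assms(1) x that(1)] that(2) assms(2) by auto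
  from this[of "nxt x"] this[of "prv x"] neighbours[OF x]
  show "(real L)\<^sup>2 * p_rate \<beta> L * real (\<eta> x) * (\<alpha> + real (\<eta> (nxt x))) * of_bool (\<xi> = move x (nxt x) \<eta>) +
     (real L)\<^sup>2 * q_rate \<beta> L * real (\<eta> x) * (\<alpha> + real (\<eta> (prv x))) * of_bool (\<xi> = move x (prv x) \<eta>) = 0"
    by auto
qed

text \<open>
  The sum over target configurations in the definition of the rates is traded for a sum over bonds. A jump
  from an empty site has rate zero, and every other jump stays in the level set.
\<close>

lemma sum_rate:
  assumes J: "finite J" and \<eta>: "\<eta> \<in> lev J"
  shows "(\<Sum>\<xi>\<in>lev J. rate \<eta> \<xi> * h \<xi>) = (\<Sum>x\<in>T.
     P * (real (\<eta> x) * (\<alpha> + real (\<eta> (nxt x))) * h (move x (nxt x) \<eta>)) +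
     Q * (real (\<eta> x) * (\<alpha> + real (\<eta> (prv x))) * h (move x (prv x) \<eta>)))"
proof -
  let ?C = "lev J"
  have fin: "finite ?C" by (rule finite_level[OF J])
  have one: "(\<Sum>\<xi>\<in>?C. real (\<eta> x) * b * of_bool (\<xi> = move x y \<eta>) * h \<xi>) = real (\<eta> x) * b * h (move x y \<eta>)"
    if "x \<in> T" "y \<in> T" "y \<noteq> x" for x y b
  proof (cases "\<eta> x = 0")
    case False
    then have mv: "move x y \<eta> \<in> ?C" using that \<eta> by (intro move_level) auto
    have "(\<Sum>\<xi>\<in>?C. real (\<eta> x) * b * of_bool (\<xi> = move x y \<eta>) * h \<xi>) =
        (\<Sum>\<xi>\<in>?C. if \<xi> = move x y \<eta> then real (\<eta> x) * b * h (move x y \<eta>) else 0)"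
      by (intro sum.cong) auto
    then show ?thesis using fin mv by simp
  qed simp
  have "(\<Sum>\<xi>\<in>?C. rate \<eta> \<xi> * h \<xi>) = (\<Sum>\<xi>\<in>?C. \<Sum>x\<in>T.
      P * (real (\<eta> x) * (\<alpha> + real (\<eta> (nxt x))) * of_bool (\<xi> = move x (nxt x) \<eta>) * h \<xi>) +
      Q * (real (\<eta> x) * (\<alpha> + real (\<eta> (prv x))) * of_bool (\<xi> = move x (prv x) \<eta>) * h \<xi>))"
    unfolding torus_rate_def Let_def P_def Q_def sum_distrib_right
    by (intro sum.cong refl) (simp only: ring_distribs mult.assoc)
  also have "\<dots> = (\<Sum>x\<in>T.
      P * (\<Sum>\<xi>\<in>?C. real (\<eta> x) * (\<alpha> + real (\<eta> (nxt x))) * of_bool (\<xi> = move x (nxt x) \<eta>) * h \<xi>) +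
      Q * (\<Sum>\<xi>\<in>?C. real (\<eta> x) * (\<alpha> + real (\<eta> (prv x))) * of_bool (\<xi> = move x (prv x) \<eta>) * h \<xi>))"
    by (subst sum.swap) (simp only: sum.distrib sum_distrib_left)
  also have "\<dots> = (\<Sum>x\<in>T.
     P * (real (\<eta> x) * (\<alpha> + real (\<eta> (nxt x))) * h (move x (nxt x) \<eta>)) +
     Q * (real (\<eta> x) * (\<alpha> + real (\<eta> (prv x))) * h (move x (prv x) \<eta>)))"
    by (intro sum.cong refl arg_cong2[of _ _ _ _ "(+)"] arg_cong2[of _ _ _ _ "(*)"] one)
     (simp_all add: neighbours)
  finally show ?thesis .
qed

text \<open>
  Each bond contributes \<open>\<alpha> (\<eta>\<^sub>y - \<eta>\<^sub>x)\<close> after the change of variables, and these differences sum to zero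
  around the torus. This is why the asymmetric dynamics has the same invariant measure.
\<close>

lemma invariance:
  assumes J: "finite J"
  shows "(\<Sum>\<eta>\<in>lev J. m \<eta> * (\<Sum>\<xi>\<in>lev J. rate \<eta> \<xi> * (g \<xi> - g \<eta>))) = 0"
proof -
  let ?C = "lev J"
  let ?A = "\<lambda>x y \<eta>. real (\<eta> x) * (\<alpha> + real (\<eta> y))"
  have hop: "(\<Sum>\<eta>\<in>?C. m \<eta> * (?A x y \<eta> * (g (move x y \<eta>) - g \<eta>))) =
      (\<Sum>\<eta>\<in>?C. \<alpha> * (m \<eta> * g \<eta>) * (real (\<eta> y) - real (\<eta> x)))"
    if "x \<in> T" "y \<in> T" "y \<noteq> x" for x y
  proof -
    have "(\<Sum>\<eta>\<in>?C. m \<eta> * ?A x y \<eta> * g (move x y \<eta>)) = (\<Sum>\<eta>\<in>?C. m \<eta> * ?A y x \<eta> * g \<eta>)"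
      using change_of_variables[OF J that(1,2), of "\<lambda>_. g"] that(3) by simp
    moreover have "(\<Sum>\<eta>\<in>?C. m \<eta> * (?A x y \<eta> * (g (move x y \<eta>) - g \<eta>))) =
       (\<Sum>\<eta>\<in>?C. m \<eta> * ?A x y \<eta> * g (move x y \<eta>)) - (\<Sum>\<eta>\<in>?C. m \<eta> * ?A x y \<eta> * g \<eta>)"
      unfolding sum_subtractf[symmetric] by (intro sum.cong refl) algebra
    moreover have "(\<Sum>\<eta>\<in>?C. \<alpha> * (m \<eta> * g \<eta>) * (real (\<eta> y) - real (\<eta> x))) =
       (\<Sum>\<eta>\<in>?C. m \<eta> * ?A y x \<eta> * g \<eta>) - (\<Sum>\<eta>\<in>?C. m \<eta> * ?A x y \<eta> * g \<eta>)"
      unfolding sum_subtractf[symmetric] by (intro sum.cong refl) algebra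
    ultimately show ?thesis by simp
  qed
  have drift: "(\<Sum>x\<in>T. real (\<eta> (nxt x)) - real (\<eta> x)) = 0"
    "(\<Sum>x\<in>T. real (\<eta> (prv x)) - real (\<eta> x)) = 0" for \<eta> :: config
    using sum_torus_shift[of "\<lambda>x. real (\<eta> x)" K 1] sum_torus_shift[of "\<lambda>x. real (\<eta> x)" K "-1"]
    by (simp_all add: sum_subtractf)
  have "(\<Sum>\<eta>\<in>?C. m \<eta> * (\<Sum>\<xi>\<in>?C. rate \<eta> \<xi> * (g \<xi> - g \<eta>))) =
     (\<Sum>\<eta>\<in>?C. \<Sum>x\<in>T. P * (m \<eta> * (?A x (nxt x) \<eta> * (g (move x (nxt x) \<eta>) - g \<eta>))) +
       Q * (m \<eta> * (?A x (prv x) \<eta> * (g (move x (prv x) \<eta>) - g \<eta>))))"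
  proof (rule sum.cong[OF refl])
    fix \<eta> assume "\<eta> \<in> ?C"
    from sum_rate[OF J this, of "\<lambda>\<xi>. g \<xi> - g \<eta>"]
    show "m \<eta> * (\<Sum>\<xi>\<in>?C. rate \<eta> \<xi> * (g \<xi> - g \<eta>)) =
      (\<Sum>x\<in>T. P * (m \<eta> * (?A x (nxt x) \<eta> * (g (move x (nxt x) \<eta>) - g \<eta>))) +
       Q * (m \<eta> * (?A x (prv x) \<eta> * (g (move x (prv x) \<eta>) - g \<eta>))))"
      by (simp only: sum_distrib_left ring_distribs(1) mult.left_commute[of "m \<eta>"])
  qed
  also have "\<dots> = (\<Sum>x\<in>T. P * (\<Sum>\<eta>\<in>?C. m \<eta> * (?A x (nxt x) \<eta> * (g (move x (nxt x) \<eta>) - g \<eta>))) +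
       Q * (\<Sum>\<eta>\<in>?C. m \<eta> * (?A x (prv x) \<eta> * (g (move x (prv x) \<eta>) - g \<eta>))))"
    by (subst sum.swap) (simp only: sum.distrib sum_distrib_left)
  also have "\<dots> = (\<Sum>x\<in>T. P * (\<Sum>\<eta>\<in>?C. \<alpha> * (m \<eta> * g \<eta>) * (real (\<eta> (nxt x)) - real (\<eta> x))) +
       Q * (\<Sum>\<eta>\<in>?C. \<alpha> * (m \<eta> * g \<eta>) * (real (\<eta> (prv x)) - real (\<eta> x))))"
    by (intro sum.cong refl arg_cong2[of _ _ _ _ "(+)"] arg_cong2[of _ _ _ _ "(*)"] hop)
      (simp_all add: neighbours)
  also have "\<dots> = P * (\<Sum>\<eta>\<in>?C. \<alpha> * (m \<eta> * g \<eta>) * (\<Sum>x\<in>T. real (\<eta> (nxt x)) - real (\<eta> x))) +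
       Q * (\<Sum>\<eta>\<in>?C. \<alpha> * (m \<eta> * g \<eta>) * (\<Sum>x\<in>T. real (\<eta> (prv x)) - real (\<eta> x)))"
    unfolding sum.distrib sum_distrib_left[symmetric] by (simp only: sum.swap[of _ ?C T] sum_distrib_left)
  also have "\<dots> = 0"
    by (simp only: drift mult_zero_right sum.neutral_const add_0)
  finally show ?thesis .
qed

text \<open>
  Only the jumps to the right across the bonds in \<open>B\<close> are kept. Since \<open>\<beta>\<close> is positive their probability is at
  least one half, so they carry at least a quarter of \<open>L\<^sup>2\<close> in the Dirichlet form.
\<close>

lemma bond_dirichlet_le:
  assumes J: "finite J" and B: "\<And>z. z \<in> B \<Longrightarrow> z \<in> T \<and> z + 1 \<in> T"
  shows "(\<Sum>z\<in>B. \<Sum>\<eta>\<in>lev J. m \<eta> * W z \<eta> * (g (move z (z + 1) \<eta>) - g \<eta>)\<^sup>2) \<le>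
    4 / (real L)\<^sup>2 * ((\<Sum>\<eta>\<in>lev J. \<Sum>\<xi>\<in>lev J. m \<eta> * rate \<eta> \<xi> * (g \<xi> - g \<eta>)\<^sup>2) / 2)"
proof -
  let ?C = "lev J"
  let ?A = "\<lambda>x y \<eta>. real (\<eta> x) * (\<alpha> + real (\<eta> y))"
  let ?X = "\<lambda>x y. \<Sum>\<eta>\<in>?C. m \<eta> * ?A x y \<eta> * (g (move x y \<eta>) - g \<eta>)\<^sup>2"
  have X0: "0 \<le> ?X x y" for x y
    using alpha_pos by (intro sum_nonneg mult_nonneg_nonneg mu_nonneg) auto
  have "(\<Sum>\<eta>\<in>?C. \<Sum>\<xi>\<in>?C. m \<eta> * rate \<eta> \<xi> * (g \<xi> - g \<eta>)\<^sup>2) =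
      (\<Sum>\<eta>\<in>?C. \<Sum>x\<in>T. P * (m \<eta> * ?A x (nxt x) \<eta> * (g (move x (nxt x) \<eta>) - g \<eta>)\<^sup>2) +
       Q * (m \<eta> * ?A x (prv x) \<eta> * (g (move x (prv x) \<eta>) - g \<eta>)\<^sup>2))"
  proof (rule sum.cong[OF refl])
    fix \<eta> assume "\<eta> \<in> ?C"
    from sum_rate[OF J this, of "\<lambda>\<xi>. (g \<xi> - g \<eta>)\<^sup>2"]
    show "(\<Sum>\<xi>\<in>?C. m \<eta> * rate \<eta> \<xi> * (g \<xi> - g \<eta>)\<^sup>2) =
      (\<Sum>x\<in>T. P * (m \<eta> * ?A x (nxt x) \<eta> * (g (move x (nxt x) \<eta>) - g \<eta>)\<^sup>2) +
       Q * (m \<eta> * ?A x (prv x) \<eta> * (g (move x (prv x) \<eta>) - g \<eta>)\<^sup>2))"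
      by (simp only: mult.assoc sum_distrib_left[symmetric])
        (simp only: sum_distrib_left ring_distribs(1) mult.left_commute[of "m \<eta>"] mult.assoc)
  qed
  also have "\<dots> = (\<Sum>x\<in>T. P * ?X x (nxt x) + Q * ?X x (prv x))"
    by (subst sum.swap) (simp only: sum.distrib sum_distrib_left)
  also have "\<dots> \<ge> (\<Sum>x\<in>T. (real L)\<^sup>2 / 2 * ?X x (nxt x))"
  proof (rule sum_mono)
    fix x
    show "(real L)\<^sup>2 / 2 * ?X x (nxt x) \<le> P * ?X x (nxt x) + Q * ?X x (prv x)"
      using mult_right_mono[OF rate_bounds(1) X0[of x "nxt x"]] mult_nonneg_nonneg[OF rate_bounds(2) X0[of x "prv x"]]
      by linarith
  qed
  also have "(\<Sum>x\<in>T. (real L)\<^sup>2 / 2 * ?X x (nxt x)) \<ge> (\<Sum>x\<in>B. (real L)\<^sup>2 / 2 * ?X x (nxt x))"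
    using B X0 by (intro sum_mono2) auto
  also have "(\<Sum>x\<in>B. (real L)\<^sup>2 / 2 * ?X x (nxt x)) = (\<Sum>x\<in>B. (real L)\<^sup>2 / 2 * ?X x (x + 1))"
    using B by (intro sum.cong refl) (simp add: torus_rep_id)
  finally have "(real L)\<^sup>2 / 2 * (\<Sum>z\<in>B. ?X z (z + 1)) \<le> (\<Sum>\<eta>\<in>?C. \<Sum>\<xi>\<in>?C. m \<eta> * rate \<eta> \<xi> * (g \<xi> - g \<eta>)\<^sup>2)"
    by (simp only: sum_distrib_left)
  then show ?thesis unfolding W_def using L_pos by (simp add: field_simps)
qed

text \<open>
  The gradient is \<open>\<alpha>\<^sup>-\<^sup>1\<close> times the difference of the rates of the jump across the bond and of its reversal:
  \<open>\<alpha> (\<eta>\<^sub>x - \<eta>\<^sub>y) = \<eta>\<^sub>x (\<alpha> + \<eta>\<^sub>y) - \<eta>\<^sub>y (\<alpha> + \<eta>\<^sub>x)\<close>. Detailed balance moves the second summand back onto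
  the first, at the price of evaluating \<open>h\<close> and \<open>g\<close> after the jump.
\<close>

lemma bond_pairing:
  assumes J: "finite J" and z: "z \<in> T" "z + 1 \<in> T"
    and h: "\<And>\<eta>. 0 < \<eta> z \<Longrightarrow> h (move z (z + 1) \<eta>) = h \<eta>"
  shows "\<alpha> * (\<Sum>\<eta>\<in>lev J. m \<eta> * ((real (\<eta> z) - real (\<eta> (z + 1))) * h \<eta> * g \<eta>)) =
    (\<Sum>\<eta>\<in>lev J. m \<eta> * W z \<eta> * h \<eta> * (g \<eta> - g (move z (z + 1) \<eta>)))"
proof -
  let ?C = "lev J"
  have "(\<Sum>\<eta>\<in>?C. m \<eta> * W z \<eta> * (h \<eta> * g (move z (z + 1) \<eta>))) =
     (\<Sum>\<eta>\<in>?C. m \<eta> * W z \<eta> * (h (move z (z + 1) \<eta>) * g (move z (z + 1) \<eta>)))"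
  proof (rule sum.cong[OF refl])
    fix \<eta>
    show "m \<eta> * W z \<eta> * (h \<eta> * g (move z (z + 1) \<eta>)) =
        m \<eta> * W z \<eta> * (h (move z (z + 1) \<eta>) * g (move z (z + 1) \<eta>))"
      using h[of \<eta>] by (cases "\<eta> z = 0") (auto simp: W_def)
  qed
  also have "\<dots> = (\<Sum>\<eta>\<in>?C. m \<eta> * (real (\<eta> (z + 1)) * (\<alpha> + real (\<eta> z))) * (h \<eta> * g \<eta>))"
    unfolding W_def using change_of_variables[OF J z, of "\<lambda>_ \<xi>. h \<xi> * g \<xi>"] by simp
  finally have "(\<Sum>\<eta>\<in>?C. m \<eta> * W z \<eta> * h \<eta> * (g \<eta> - g (move z (z + 1) \<eta>))) =
     (\<Sum>\<eta>\<in>?C. m \<eta> * W z \<eta> * (h \<eta> * g \<eta>)) - (\<Sum>\<eta>\<in>?C. m \<eta> * (real (\<eta> (z + 1)) * (\<alpha> + real (\<eta> z))) * (h \<eta> * g \<eta>))"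
    by (simp only: ring_distribs sum_subtractf mult.assoc)
  also have "\<dots> = (\<Sum>\<eta>\<in>?C. \<alpha> * (m \<eta> * ((real (\<eta> z) - real (\<eta> (z + 1))) * h \<eta> * g \<eta>)))"
    unfolding sum_subtractf[symmetric] W_def by (intro sum.cong refl) algebra
  finally show ?thesis by (simp only: sum_distrib_left)
qed

text \<open>
  Cauchy--Schwarz over bonds and configurations, with the rates as weights.
\<close>

lemma bond_sum_bound:
  assumes J: "finite J" and B: "finite B" "\<And>z. z \<in> B \<Longrightarrow> z \<in> T \<and> z + 1 \<in> T"
    and h: "\<And>z \<eta>. z \<in> B \<Longrightarrow> 0 < \<eta> z \<Longrightarrow> h z (move z (z + 1) \<eta>) = h z \<eta>"
    and bnd: "(\<Sum>z\<in>B. \<Sum>\<eta>\<in>lev J. m \<eta> * (W z \<eta> * (h z \<eta>)\<^sup>2)) \<le> b"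
  shows "(\<Sum>\<eta>\<in>lev J. m \<eta> * ((\<Sum>z\<in>B. (real (\<eta> z) - real (\<eta> (z + 1))) * h z \<eta>) * g \<eta>))\<^sup>2 \<le>
    (4 / (\<alpha>\<^sup>2 * (real L)\<^sup>2) * b) * ((\<Sum>\<eta>\<in>lev J. \<Sum>\<xi>\<in>lev J. m \<eta> * rate \<eta> \<xi> * (g \<xi> - g \<eta>)\<^sup>2) / 2)"
    (is "?l\<^sup>2 \<le> _ * ?D")
proof -
  let ?C = "lev J"
  let ?r = "\<lambda>q. sqrt (m (snd q) * W (fst q) (snd q))"
  let ?d = "\<lambda>q. g (snd q) - g (move (fst q) (fst q + 1) (snd q))"
  have r2: "?r q * ?r q = m (snd q) * W (fst q) (snd q)" for q
    using mu_nonneg W_nonneg by (simp flip: power2_eq_square)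
  have "\<alpha> * ?l = (\<Sum>z\<in>B. \<alpha> * (\<Sum>\<eta>\<in>?C. m \<eta> * ((real (\<eta> z) - real (\<eta> (z + 1))) * h z \<eta> * g \<eta>)))"
    by (simp only: sum_distrib_left sum_distrib_right sum.swap[of _ ?C B])
  also have "\<dots> = (\<Sum>z\<in>B. \<Sum>\<eta>\<in>?C. m \<eta> * W z \<eta> * h z \<eta> * (g \<eta> - g (move z (z + 1) \<eta>)))"
    using B(2) h by (intro sum.cong refl bond_pairing[OF J]) auto
  also have "\<dots> = (\<Sum>q\<in>B \<times> ?C. (?r q * h (fst q) (snd q)) * (?r q * ?d q))"
    unfolding sum.cartesian_product
  proof (rule sum.cong[OF refl])
    fix q
    have "(case q of (z, \<eta>) \<Rightarrow> m \<eta> * W z \<eta> * h z \<eta> * (g \<eta> - g (move z (z + 1) \<eta>))) =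
        (?r q * ?r q) * h (fst q) (snd q) * ?d q"
      unfolding r2 by (simp add: split_def)
    also have "\<dots> = (?r q * h (fst q) (snd q)) * (?r q * ?d q)" by (simp only: mult_ac)
    finally show "(case q of (z, \<eta>) \<Rightarrow> m \<eta> * W z \<eta> * h z \<eta> * (g \<eta> - g (move z (z + 1) \<eta>))) =
        (?r q * h (fst q) (snd q)) * (?r q * ?d q)" .
  qed
  finally have "(\<alpha> * ?l)\<^sup>2 \<le> (\<Sum>q\<in>B \<times> ?C. (?r q * h (fst q) (snd q))\<^sup>2) * (\<Sum>q\<in>B \<times> ?C. (?r q * ?d q)\<^sup>2)"
    using Cauchy_Schwarz_ineq_sum[of "\<lambda>q. ?r q * h (fst q) (snd q)" "\<lambda>q. ?r q * ?d q" "B \<times> ?C"] by simp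
  also have "(\<Sum>q\<in>B \<times> ?C. (?r q * h (fst q) (snd q))\<^sup>2) = (\<Sum>z\<in>B. \<Sum>\<eta>\<in>?C. m \<eta> * (W z \<eta> * (h z \<eta>)\<^sup>2))"
    unfolding sum.cartesian_product
    by (intro sum.cong refl) (simp add: split_def power_mult_distrib mu_nonneg W_nonneg mult.assoc)
  also have "(\<Sum>q\<in>B \<times> ?C. (?r q * ?d q)\<^sup>2) = (\<Sum>z\<in>B. \<Sum>\<eta>\<in>?C. m \<eta> * W z \<eta> * (g (move z (z + 1) \<eta>) - g \<eta>)\<^sup>2)"
    unfolding sum.cartesian_product
    by (intro sum.cong refl) (simp add: split_def power_mult_distrib mu_nonneg W_nonneg power2_commute)
  also have "(\<Sum>z\<in>B. \<Sum>\<eta>\<in>?C. m \<eta> * (W z \<eta> * (h z \<eta>)\<^sup>2)) * (\<Sum>z\<in>B. \<Sum>\<eta>\<in>?C. m \<eta> * W z \<eta> * (g (move z (z + 1) \<eta>) - g \<eta>)\<^sup>2)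
     \<le> b * (4 / (real L)\<^sup>2 * ?D)"
  proof (rule mult_mono[OF bnd bond_dirichlet_le[OF J B(2)]])
    show "0 \<le> (\<Sum>z\<in>B. \<Sum>\<eta>\<in>?C. m \<eta> * W z \<eta> * (g (move z (z + 1) \<eta>) - g \<eta>)\<^sup>2)"
      by (intro sum_nonneg mult_nonneg_nonneg mu_nonneg W_nonneg) simp
    have "0 \<le> (\<Sum>z\<in>B. \<Sum>\<eta>\<in>?C. m \<eta> * (W z \<eta> * (h z \<eta>)\<^sup>2))"
      by (intro sum_nonneg mult_nonneg_nonneg mu_nonneg W_nonneg) simp
    then show "0 \<le> b" using bnd by linarith
  qed
  finally have "\<alpha>\<^sup>2 * ?l\<^sup>2 \<le> b * (4 / (real L)\<^sup>2 * ?D)" by (simp only: power_mult_distrib)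
  moreover have "\<alpha>\<^sup>2 * u \<le> w \<Longrightarrow> u \<le> w / \<alpha>\<^sup>2" for u w :: real
    using alpha_pos by (simp add: field_simps)
  ultimately have "?l\<^sup>2 \<le> b * (4 / (real L)\<^sup>2 * ?D) / \<alpha>\<^sup>2" by blast
  also have "\<dots> = (4 / (\<alpha>\<^sup>2 * (real L)\<^sup>2) * b) * ?D" by (simp add: mult_ac)
  finally show ?thesis .
qed

end

section \<open>The gradient part and the remainder\<close>

lemma square_add_le: "(a + b)\<^sup>2 \<le> 2 * a\<^sup>2 + 2 * b\<^sup>2" for a b :: real
  using sum_squares_bound[of a b] by (simp add: power2_sum)

lemma square_diff_le: "(a - b)\<^sup>2 \<le> 2 * a\<^sup>2 + 2 * b\<^sup>2" for a b :: real
  using square_add_le[of a "-b"] by simp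

lemma sum_block: "(\<Sum>y<l. f (x + int y)) = (\<Sum>i\<in>{x..<x + int l}. f i)"
  by (rule sum.reindex_bij_witness[of _ "\<lambda>i. nat (i - x)" "\<lambda>y. x + int y"]) auto

context inclusion_law
begin

definition avg :: "nat \<Rightarrow> int \<Rightarrow> config \<Rightarrow> real" where
  "avg l x \<eta> = (\<Sum>i\<in>{x..<x + int l}. X i \<eta>) / real l"

definition bonds :: "nat \<Rightarrow> nat \<Rightarrow> int set" where
  "bonds n l = {- int n..int n + int l - 2}"

definition sites :: "nat \<Rightarrow> int set" where
  "sites n = {- int n..int n}"

definition covers :: "nat \<Rightarrow> int \<Rightarrow> int \<Rightarrow> bool" where
  "covers l x z \<longleftrightarrow> x \<le> z \<and> z \<le> x + int l - 2"

text \<open>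
  The factor of the gradient across \<open>(z, z + 1)\<close>, collected from all blocks that contain this bond.
\<close>

definition flux :: "nat \<Rightarrow> nat \<Rightarrow> (int \<Rightarrow> real) \<Rightarrow> int \<Rightarrow> config \<Rightarrow> real" where
  "flux n l v z \<eta> = (\<Sum>x\<in>{x\<in>sites n. covers l x z}.
     v x * (coef_pair l (nat (z - x)) * X x \<eta> + coef_block l (nat (z - x)) * avg l x \<eta>))"

definition gradient_part :: "nat \<Rightarrow> nat \<Rightarrow> (int \<Rightarrow> real) \<Rightarrow> config \<Rightarrow> real" where
  "gradient_part n l v \<eta> = (\<Sum>z\<in>bonds n l. (real (\<eta> z) - real (\<eta> (z + 1))) * flux n l v z \<eta>)"

definition remainder :: "nat \<Rightarrow> nat \<Rightarrow> (int \<Rightarrow> real) \<Rightarrow> config \<Rightarrow> real" where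
  "remainder n l v \<eta> = (\<Sum>x\<in>sites n. v x * (X x \<eta> * (\<Sum>i\<in>{x+1..<x + int l}. X i \<eta>) / (real l * (real l - 1))
     - ((X x \<eta>)\<^sup>2 - chi \<alpha> \<rho>) / real l))"

definition observable :: "nat \<Rightarrow> int \<Rightarrow> config \<Rightarrow> real" where
  "observable l x = shift_fun x (\<lambda>\<xi>. local_product \<rho> \<xi> - block_quadratic \<alpha> \<rho> l \<xi>)"

lemma observable_eq:
  assumes l: "2 \<le> l"
  shows "observable l x \<eta> = X x \<eta> * X (x + 1) \<eta> - ((avg l x \<eta>)\<^sup>2 - chi \<alpha> \<rho> / real l)"
proof -
  have "block_average l (shift x \<eta>) - \<rho> = avg l x \<eta>"
    unfolding block_average_def shift_def avg_def using l sum_block[of "\<lambda>i. real (\<eta> i)" x l]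
    by (simp add: sum_subtractf field_simps)
  then show ?thesis
    unfolding observable_def shift_fun_def local_product_def block_quadratic_def by (simp add: shift_def)
qed

lemma observable_decomposition:
  assumes l: "2 \<le> l"
  shows "observable l x \<eta> = (\<Sum>z\<in>{x..x + int l - 2}. (real (\<eta> z) - real (\<eta> (z + 1))) *
      (coef_pair l (nat (z - x)) * X x \<eta> + coef_block l (nat (z - x)) * avg l x \<eta>)) +
    (X x \<eta> * (\<Sum>i\<in>{x+1..<x + int l}. X i \<eta>) / (real l * (real l - 1)) - ((X x \<eta>)\<^sup>2 - chi \<alpha> \<rho>) / real l)"
proof -
  let ?g = "\<lambda>y. X (x + int y) \<eta>"
  have avg: "avg l x \<eta> = (\<Sum>y<l. ?g y) / real l"
    unfolding avg_def using sum_block[of "\<lambda>i. X i \<eta>" x l] by simp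
  have "observable l x \<eta> = ?g 0 * ?g 1 - ((avg l x \<eta>)\<^sup>2 - chi \<alpha> \<rho> / real l)"
    by (simp add: observable_eq[OF l])
  also have "\<dots> = (\<Sum>y<l-1. (?g y - ?g (Suc y)) * (coef_pair l y * ?g 0 + coef_block l y * avg l x \<eta>)) +
    (?g 0 * (\<Sum>y\<in>{1..<l}. ?g y) / (real l * (real l - 1)) - ((?g 0)\<^sup>2 - chi \<alpha> \<rho>) / real l)"
    unfolding avg by (rule block_replacement_identity[OF l])
  also have "(\<Sum>y<l-1. (?g y - ?g (Suc y)) * (coef_pair l y * ?g 0 + coef_block l y * avg l x \<eta>)) =
      (\<Sum>z\<in>{x..x + int l - 2}. (real (\<eta> z) - real (\<eta> (z + 1))) *
      (coef_pair l (nat (z - x)) * X x \<eta> + coef_block l (nat (z - x)) * avg l x \<eta>))"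
    by (rule sum.reindex_bij_witness[of _ "\<lambda>z. nat (z - x)" "\<lambda>y. x + int y"])
      (use l in \<open>auto simp: algebra_simps\<close>)
  also have "(\<Sum>y\<in>{1..<l}. ?g y) = (\<Sum>i\<in>{x+1..<x + int l}. X i \<eta>)"
    by (rule sum.reindex_bij_witness[of _ "\<lambda>z. nat (z - x)" "\<lambda>y. x + int y"]) auto
  finally show ?thesis by simp
qed

lemma sum_observable_decomposition:
  assumes l: "2 \<le> l"
  shows "(\<Sum>x\<in>sites n. v x * observable l x \<eta>) = gradient_part n l v \<eta> + remainder n l v \<eta>"
proof -
  let ?c = "\<lambda>x z. v x * (coef_pair l (nat (z - x)) * X x \<eta> + coef_block l (nat (z - x)) * avg l x \<eta>)"
  let ?d = "\<lambda>z. real (\<eta> z) - real (\<eta> (z + 1))"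
  have "{x..x + int l - 2} = {z\<in>bonds n l. covers l x z}" if "x \<in> sites n" for x
    using that by (auto simp: bonds_def covers_def sites_def)
  then have "(\<Sum>x\<in>sites n. v x * observable l x \<eta>) =
      (\<Sum>x\<in>sites n. \<Sum>z\<in>{z\<in>bonds n l. covers l x z}. ?d z * ?c x z) + remainder n l v \<eta>"
    unfolding remainder_def sum.distrib[symmetric] observable_decomposition[OF l] ring_distribs(1)
    by (intro sum.cong refl arg_cong2[of _ _ _ _ "(+)"]) (simp add: sum_distrib_left algebra_simps)
  also have "(\<Sum>x\<in>sites n. \<Sum>z\<in>{z\<in>bonds n l. covers l x z}. ?d z * ?c x z) =
      (\<Sum>z\<in>bonds n l. \<Sum>x\<in>{x\<in>sites n. covers l x z}. ?d z * ?c x z)"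
    by (rule sum.swap_restrict) (auto simp: sites_def bonds_def)
  also have "\<dots> = gradient_part n l v \<eta>"
    unfolding gradient_part_def flux_def by (simp only: sum_distrib_left)
  finally show ?thesis .
qed

text \<open>
  At \<open>x = z\<close> the coefficient of \<open>\<xi>\<^sub>x\<close> vanishes, for \<open>x < z\<close> the site \<open>x\<close> is not touched by the jump, and
  averages over blocks that contain the bond are preserved.
\<close>

lemma flux_move:
  assumes "0 < \<eta> z"
  shows "flux n l v z (move z (z + 1) \<eta>) = flux n l v z \<eta>"
  unfolding flux_def
proof (rule sum.cong[OF refl])
  fix x assume "x \<in> {x\<in>sites n. covers l x z}"
  then have x: "x \<le> z" "z + 1 \<le> x + int l - 1" by (auto simp: covers_def)
  have 1: "coef_pair l (nat (z - x)) * X x (move z (z + 1) \<eta>) = coef_pair l (nat (z - x)) * X x \<eta>"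
    using x by (cases "x = z") (auto simp: coef_pair_def move_def)
  have "(\<Sum>i\<in>{x..<x + int l}. move z (z + 1) \<eta> i) = (\<Sum>i\<in>{x..<x + int l}. \<eta> i)"
    using x assms by (intro sum_move) auto
  then have "(\<Sum>i\<in>{x..<x + int l}. real (move z (z + 1) \<eta> i)) = (\<Sum>i\<in>{x..<x + int l}. real (\<eta> i))"
    by (metis of_nat_sum)
  then have 2: "avg l x (move z (z + 1) \<eta>) = avg l x \<eta>"
    by (simp add: avg_def sum_subtractf)
  show "v x * (coef_pair l (nat (z - x)) * X x (move z (z + 1) \<eta>) + coef_block l (nat (z - x)) * avg l x (move z (z + 1) \<eta>)) =
      v x * (coef_pair l (nat (z - x)) * X x \<eta> + coef_block l (nat (z - x)) * avg l x \<eta>)"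
    by (simp only: 1 2)
qed

definition flux_const :: "nat \<Rightarrow> real" where
  "flux_const l = 6 * (\<rho> * (\<alpha> + \<rho>) * chi \<alpha> \<rho>) * real l + 4 * bond_moment"

lemma covering_sum_le:
  assumes l: "2 \<le> l"
  shows "(\<Sum>z\<in>bonds n l. \<Sum>x\<in>{x\<in>sites n. covers l x z}. (v x)\<^sup>2) \<le> real l * (\<Sum>x\<in>sites n. (v x)\<^sup>2)"
proof -
  have "(\<Sum>z\<in>bonds n l. \<Sum>x\<in>{x\<in>sites n. covers l x z}. (v x)\<^sup>2) =
      (\<Sum>x\<in>sites n. \<Sum>z\<in>{z\<in>bonds n l. covers l x z}. (v x)\<^sup>2)"
    by (rule sum.swap_restrict) (auto simp: sites_def bonds_def)
  also have "\<dots> \<le> (\<Sum>x\<in>sites n. real l * (v x)\<^sup>2)"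
  proof (rule sum_mono)
    fix x
    have "card {z\<in>bonds n l. covers l x z} \<le> card {x..x + int l - 2}"
      by (intro card_mono) (auto simp: covers_def)
    also have "\<dots> \<le> l" by simp
    finally show "(\<Sum>z\<in>{z\<in>bonds n l. covers l x z}. (v x)\<^sup>2) \<le> real l * (v x)\<^sup>2"
      by (simp add: mult_right_mono)
  qed
  finally show ?thesis by (simp add: sum_distrib_left)
qed

lemma all_moments_avg:
  assumes "finite S" "{x..<x + int l} \<subseteq> S" shows "all_moments (config_pmf S) (avg l x)"
proof -
  have "avg l x = (\<lambda>\<eta>. (1 / real l) * (\<Sum>i\<in>{x..<x + int l}. X i \<eta>))"
    by (simp add: avg_def fun_eq_iff)
  then show ?thesis
    by (simp only:) (intro all_moments_intros all_moments_coord assms(1), use assms(2) in auto)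
qed

text \<open>
  The summands \<open>\<xi>\<^sub>x\<close> of the flux are orthogonal under the bond weight and cost \<open>\<Sum> v\<^sub>x\<^sup>2\<close> each. The block
  averages are treated by Cauchy--Schwarz: there are at most \<open>l\<close> of them per bond, each has a second
  moment of order \<open>1 / (\<alpha> l) + 1 / (\<alpha> l)\<^sup>2\<close>, and every \<open>v\<^sub>x\<close> enters for at most \<open>l\<close> bonds.
\<close>

lemma flux_bound:
  assumes l: "2 \<le> l" and S: "finite S" "{- int n..int n + int l} \<subseteq> S"
  shows "(\<Sum>z\<in>bonds n l. EE S (\<lambda>\<eta>. W z \<eta> * (flux n l v z \<eta>)\<^sup>2)) \<le> flux_const l * (\<Sum>x\<in>sites n. (v x)\<^sup>2)"
proof -
  define c where "c = \<rho> * (\<alpha> + \<rho>) * chi \<alpha> \<rho>"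
  have c0: "0 \<le> c" using alpha_pos rho_pos by (simp add: c_def chi_eq)
  define e where "e = (2 * c * real l + 2 * bond_moment) / (real l)\<^sup>2"
  have one: "EE S (\<lambda>\<eta>. W z \<eta> * (flux n l v z \<eta>)\<^sup>2) \<le>
      (2 * c + 2 * (real l * e)) * (\<Sum>x\<in>{x\<in>sites n. covers l x z}. (v x)\<^sup>2)"
    if z: "z \<in> bonds n l" for z
  proof -
    define A where "A = {x\<in>sites n. covers l x z}"
    \<comment> \<open>at \<open>x = z\<close> the coefficient of \<open>\<xi>\<^sub>x\<close> is zero, and the remaining sites lie off the bond\<close>
    define A' where "A' = {x\<in>A. x < z}"
    have "finite (sites n)" by (simp add: sites_def)
    then have finA: "finite A" "finite A'" by (simp_all add: A_def A'_def)
    have zS: "z \<in> S" "z + 1 \<in> S" using z S l by (auto simp: bonds_def)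
    have AS: "{x..<x + int l} \<subseteq> S" "z \<in> {x..<x + int l}" "z + 1 \<in> {x..<x + int l}" "x \<in> S" if "x \<in> A" for x
      using that S l by (auto simp: A_def sites_def covers_def)
    define a where "a \<eta> = (\<Sum>x\<in>A'. (v x * coef_pair l (nat (z - x))) * X x \<eta>)" for \<eta>
    define b where "b \<eta> = (\<Sum>x\<in>A. (v x * coef_block l (nat (z - x))) * avg l x \<eta>)" for \<eta>
    have fl: "flux n l v z \<eta> = a \<eta> + b \<eta>" for \<eta>
    proof -
      have "(\<Sum>x\<in>A. (v x * coef_pair l (nat (z - x))) * X x \<eta>) = a \<eta>"
        unfolding a_def
      proof (rule sum.mono_neutral_right[OF finA(1)])
        show "\<forall>x\<in>A - A'. (v x * coef_pair l (nat (z - x))) * X x \<eta> = 0"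
          by (auto simp: A'_def A_def covers_def coef_pair_def)
      qed (auto simp: A'_def)
      then show ?thesis unfolding flux_def A_def[symmetric] b_def
        by (simp only: ring_distribs(1) sum.distrib mult.assoc)
    qed
    have y: "nat (z - x) < l - 1" if "x \<in> A" for x
      using that l by (auto simp: A_def covers_def)
    have am: "all_moments (config_pmf S) a" "all_moments (config_pmf S) b"
      unfolding a_def[abs_def] b_def[abs_def]
      by (intro all_moments_intros all_moments_coord S(1) AS all_moments_avg; simp add: A'_def)+
    have EA: "EE S (\<lambda>\<eta>. W z \<eta> * (a \<eta>)\<^sup>2) \<le> c * (\<Sum>x\<in>A. (v x)\<^sup>2)"
    proof -
      have "EE S (\<lambda>\<eta>. W z \<eta> * (a \<eta>)\<^sup>2) \<le> c * (\<Sum>x\<in>A'. (v x * coef_pair l (nat (z - x)))\<^sup>2)"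
        unfolding a_def c_def using AS
        by (intro expectation_W_linear_square S(1) zS) (auto simp: A'_def)
      also have "(\<Sum>x\<in>A'. (v x * coef_pair l (nat (z - x)))\<^sup>2) \<le> (\<Sum>x\<in>A'. (v x)\<^sup>2)"
        unfolding power_mult_distrib
        by (intro sum_mono mult_left_le coef_pair_sq_le y) (auto simp: A'_def)
      also have "\<dots> \<le> (\<Sum>x\<in>A. (v x)\<^sup>2)" using finA by (intro sum_mono2) (auto simp: A'_def)
      finally show ?thesis using c0 by (simp add: mult_left_mono)
    qed
    have EB: "EE S (\<lambda>\<eta>. W z \<eta> * (b \<eta>)\<^sup>2) \<le> real l * e * (\<Sum>x\<in>A. (v x)\<^sup>2)"
    proof -
      let ?V = "\<Sum>x\<in>A. (v x)\<^sup>2"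
      have int: "integrable (measure_pmf (config_pmf S)) (\<lambda>\<eta>. W z \<eta> * (avg l x \<eta>)\<^sup>2)" if "x \<in> A" for x
        by (intro all_moments_integrable all_moments_intros all_moments_W all_moments_avg S(1) zS AS that)
      have avg2: "EE S (\<lambda>\<eta>. W z \<eta> * (avg l x \<eta>)\<^sup>2) \<le> e" if "x \<in> A" for x
      proof -
        have "(\<lambda>\<eta>. W z \<eta> * (avg l x \<eta>)\<^sup>2) = (\<lambda>\<eta>. (W z \<eta> * (\<Sum>i\<in>{x..<x + int l}. X i \<eta>)\<^sup>2) / (real l)\<^sup>2)"
          by (simp add: avg_def power_divide)
        then have "EE S (\<lambda>\<eta>. W z \<eta> * (avg l x \<eta>)\<^sup>2) = EE S (\<lambda>\<eta>. W z \<eta> * (\<Sum>i\<in>{x..<x + int l}. X i \<eta>)\<^sup>2) / (real l)\<^sup>2"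
          by simp
        also have "\<dots> \<le> (2 * (\<rho> * (\<alpha> + \<rho>) * chi \<alpha> \<rho>) * real (card {x..<x + int l}) + 2 * bond_moment) / (real l)\<^sup>2"
          by (intro divide_right_mono expectation_W_block_square S(1) AS that) simp
        finally show ?thesis by (simp add: e_def c_def)
      qed
      have pw: "W z \<eta> * (b \<eta>)\<^sup>2 \<le> (\<Sum>x\<in>A. ?V * (W z \<eta> * (avg l x \<eta>)\<^sup>2))" for \<eta>
      proof -
        have "(b \<eta>)\<^sup>2 \<le> (\<Sum>x\<in>A. (v x * coef_block l (nat (z - x)))\<^sup>2) * (\<Sum>x\<in>A. (avg l x \<eta>)\<^sup>2)"
          unfolding b_def by (rule Cauchy_Schwarz_ineq_sum)
        also have "\<dots> \<le> ?V * (\<Sum>x\<in>A. (avg l x \<eta>)\<^sup>2)"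
          unfolding power_mult_distrib
          by (intro mult_right_mono sum_mono mult_left_le coef_block_sq_le y sum_nonneg) auto
        finally have "W z \<eta> * (b \<eta>)\<^sup>2 \<le> W z \<eta> * (?V * (\<Sum>x\<in>A. (avg l x \<eta>)\<^sup>2))"
          by (rule mult_left_mono) (rule W_nonneg)
        then show ?thesis by (simp only: sum_distrib_left mult.left_commute[of ?V])
      qed
      have "EE S (\<lambda>\<eta>. W z \<eta> * (b \<eta>)\<^sup>2) \<le> EE S (\<lambda>\<eta>. \<Sum>x\<in>A. ?V * (W z \<eta> * (avg l x \<eta>)\<^sup>2))"
        by (intro integral_mono pw Bochner_Integration.integrable_sum integrable_mult_right int
          all_moments_integrable all_moments_mult all_moments_power all_moments_W am S(1) zS)
      also have "\<dots> = (\<Sum>x\<in>A. ?V * EE S (\<lambda>\<eta>. W z \<eta> * (avg l x \<eta>)\<^sup>2))"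
        using int by (simp add: Bochner_Integration.integral_sum)
      also have "\<dots> \<le> (\<Sum>x\<in>A. ?V * e)"
        by (intro sum_mono mult_left_mono avg2 sum_nonneg) auto
      also have "\<dots> = real (card A) * (?V * e)" by simp
      also have "\<dots> \<le> real l * (?V * e)"
      proof (rule mult_right_mono)
        have "card A \<le> card {z - int l + 2..z}"
          by (intro card_mono) (auto simp: A_def covers_def)
        also have "\<dots> \<le> l" by simp
        finally show "real (card A) \<le> real l" by simp
        show "0 \<le> ?V * e"
        proof (cases "A = {}")
          case False
          then obtain x where x: "x \<in> A" by blast
          have "0 \<le> EE S (\<lambda>\<eta>. W z \<eta> * (avg l x \<eta>)\<^sup>2)"
            by (intro Bochner_Integration.integral_nonneg mult_nonneg_nonneg W_nonneg) simp
          then have "0 \<le> e" using avg2[OF x] by linarith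
          then show ?thesis by (intro mult_nonneg_nonneg sum_nonneg) auto
        qed simp
      qed
      finally show ?thesis by (simp add: mult_ac)
    qed
    have int: "integrable (measure_pmf (config_pmf S)) (\<lambda>\<eta>. W z \<eta> * (a \<eta>)\<^sup>2)"
       "integrable (measure_pmf (config_pmf S)) (\<lambda>\<eta>. W z \<eta> * (b \<eta>)\<^sup>2)"
      by (intro all_moments_integrable all_moments_mult all_moments_power all_moments_W am S(1) zS)+
    have "EE S (\<lambda>\<eta>. W z \<eta> * (flux n l v z \<eta>)\<^sup>2) \<le>
        EE S (\<lambda>\<eta>. 2 * (W z \<eta> * (a \<eta>)\<^sup>2) + 2 * (W z \<eta> * (b \<eta>)\<^sup>2))"
    proof (rule integral_mono)
      show "integrable (measure_pmf (config_pmf S)) (\<lambda>\<eta>. W z \<eta> * (flux n l v z \<eta>)\<^sup>2)"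
        unfolding fl
        by (intro all_moments_integrable all_moments_mult all_moments_power all_moments_add all_moments_W am S(1) zS)
      show "W z \<eta> * (flux n l v z \<eta>)\<^sup>2 \<le> 2 * (W z \<eta> * (a \<eta>)\<^sup>2) + 2 * (W z \<eta> * (b \<eta>)\<^sup>2)" for \<eta>
        using mult_left_mono[OF square_add_le[of "a \<eta>" "b \<eta>"] W_nonneg[of z \<eta>]]
        by (simp only: fl distrib_left mult.left_commute[of _ 2])
    qed (use int in auto)
    also have "\<dots> = 2 * EE S (\<lambda>\<eta>. W z \<eta> * (a \<eta>)\<^sup>2) + 2 * EE S (\<lambda>\<eta>. W z \<eta> * (b \<eta>)\<^sup>2)"
      using int by (simp only: Bochner_Integration.integral_add integral_mult_right_zero integrable_mult_right)
    also have "\<dots> \<le> 2 * (c * (\<Sum>x\<in>A. (v x)\<^sup>2)) + 2 * (real l * e * (\<Sum>x\<in>A. (v x)\<^sup>2))"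
      using EA EB by linarith
    finally show ?thesis unfolding A_def by (simp only: ring_distribs mult.assoc)
  qed
  have le: "real l * (real l * e) = 2 * c * real l + 2 * bond_moment"
    using l by (simp add: e_def power2_eq_square)
  have k0: "0 \<le> 2 * c + 2 * (real l * e)"
  proof -
    have "{- int n..int n + int l} \<subseteq> S" "(0::int) \<in> {- int n..int n + int l}" "(1::int) \<in> {- int n..int n + int l}"
      using S l by auto
    then have zS: "(0::int) \<in> S" "0 + (1::int) \<in> S" by auto
    have "0 \<le> EE S (\<lambda>\<eta>. W 0 \<eta> * (X 0 \<eta> + X (0 + 1) \<eta>)\<^sup>2)"
      by (intro Bochner_Integration.integral_nonneg mult_nonneg_nonneg W_nonneg) simp
    then have "0 \<le> bond_moment" by (simp only: expectation_W_bond_square[OF S(1) zS])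
    then have "0 \<le> e" using c0 by (simp add: e_def)
    then show ?thesis using c0 by simp
  qed
  have "(\<Sum>z\<in>bonds n l. EE S (\<lambda>\<eta>. W z \<eta> * (flux n l v z \<eta>)\<^sup>2)) \<le>
      (\<Sum>z\<in>bonds n l. (2 * c + 2 * (real l * e)) * (\<Sum>x\<in>{x\<in>sites n. covers l x z}. (v x)\<^sup>2))"
    by (intro sum_mono one)
  also have "\<dots> \<le> (2 * c + 2 * (real l * e)) * (real l * (\<Sum>x\<in>sites n. (v x)\<^sup>2))"
    unfolding sum_distrib_left[symmetric] by (intro mult_left_mono covering_sum_le l k0)
  also have "\<dots> = (2 * c * real l + 2 * (real l * (real l * e))) * (\<Sum>x\<in>sites n. (v x)\<^sup>2)"
    by (simp add: algebra_simps)
  also have "\<dots> = flux_const l * (\<Sum>x\<in>sites n. (v x)\<^sup>2)"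
    unfolding le flux_const_def c_def[symmetric] by (simp add: algebra_simps)
  finally show ?thesis .
qed

text \<open>
  Both parts of the remainder are sums of orthogonal functions: products over distinct pairs of sites, and
  centred squares at distinct sites.
\<close>

lemma remainder_bound:
  assumes l: "2 \<le> l" and S: "finite S" "{- int n..int n + int l} \<subseteq> S"
  shows "EE S (\<lambda>\<eta>. (remainder n l v \<eta>)\<^sup>2) \<le> 2 * ((chi \<alpha> \<rho>)\<^sup>2 + mu4) / (real l)\<^sup>2 * (\<Sum>x\<in>sites n. (v x)\<^sup>2)"
    and "all_moments (config_pmf S) (remainder n l v)"
proof -
  define J where "J = Sigma (sites n) (\<lambda>x. {x+1..<x + int l})"
  define k where "k = real l * (real l - 1)"
  define a where "a \<eta> = (\<Sum>(x, y)\<in>J. (\<lambda>q. v (fst q) / k) (x, y) * (X x \<eta> * X y \<eta>))" for \<eta>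
  define b where "b \<eta> = (\<Sum>x\<in>sites n. (v x / real l) * ((X x \<eta>)\<^sup>2 - chi \<alpha> \<rho>))" for \<eta>
  let ?V = "\<Sum>x\<in>sites n. (v x)\<^sup>2"
  have sub: "sites n \<subseteq> S" using S by (auto simp: sites_def)
  have JS: "x \<in> S \<and> y \<in> S \<and> x < y" if "(x, y) \<in> J" for x y
    using that S by (auto simp: J_def sites_def)
  have am: "all_moments (config_pmf S) a" "all_moments (config_pmf S) b"
    unfolding a_def[abs_def] b_def[abs_def] split_def using JS sub
    by (intro all_moments_intros all_moments_coord S(1); force)+
  have R: "remainder n l v \<eta> = a \<eta> - b \<eta>" for \<eta>
  proof -
    have "a \<eta> = (\<Sum>x\<in>sites n. \<Sum>y\<in>{x+1..<x + int l}. v x / k * (X x \<eta> * X y \<eta>))"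
      unfolding a_def J_def by (subst sum.Sigma[symmetric]) (auto simp: sites_def)
    also have "\<dots> = (\<Sum>x\<in>sites n. v x * (X x \<eta> * (\<Sum>i\<in>{x+1..<x + int l}. X i \<eta>) / k))"
      by (simp add: sum_distrib_left sum_divide_distrib)
    finally have a: "a \<eta> = (\<Sum>x\<in>sites n. v x * (X x \<eta> * (\<Sum>i\<in>{x+1..<x + int l}. X i \<eta>) / k))" .
    show ?thesis
      unfolding remainder_def b_def a k_def[symmetric] sum_subtractf[symmetric]
      by (intro sum.cong refl) (simp add: diff_divide_distrib right_diff_distrib)
  qed
  show "all_moments (config_pmf S) (remainder n l v)"
    unfolding R[abs_def] by (intro all_moments_diff am)
  have int: "integrable (measure_pmf (config_pmf S)) (\<lambda>\<eta>. (a \<eta>)\<^sup>2)" "integrable (measure_pmf (config_pmf S)) (\<lambda>\<eta>. (b \<eta>)\<^sup>2)"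
    by (intro all_moments_integrable all_moments_power am)+
  have EA: "EE S (\<lambda>\<eta>. (a \<eta>)\<^sup>2) \<le> (chi \<alpha> \<rho>)\<^sup>2 * (?V / (real l)\<^sup>2)"
  proof -
    have "EE S (\<lambda>\<eta>. (a \<eta>)\<^sup>2) \<le> (chi \<alpha> \<rho>)\<^sup>2 * (\<Sum>q\<in>J. (v (fst q) / k)\<^sup>2)"
      unfolding a_def by (rule expectation_pair_sum_square[OF S(1) JS])
    also have "(\<Sum>q\<in>J. (v (fst q) / k)\<^sup>2) = (\<Sum>x\<in>sites n. (real l - 1) * (v x / k)\<^sup>2)"
      unfolding J_def using l by (subst sum.Sigma[symmetric, where g = "\<lambda>x y. (v x / k)\<^sup>2", unfolded split_def])
       (auto simp: sites_def of_nat_diff nat_diff_distrib)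
    also have "\<dots> \<le> (\<Sum>x\<in>sites n. (v x)\<^sup>2 / (real l)\<^sup>2)"
    proof (rule sum_mono)
      fix x
      have "(real l - 1) * (v x / k)\<^sup>2 = (v x)\<^sup>2 / ((real l)\<^sup>2 * (real l - 1))"
        using l by (simp add: k_def power2_eq_square)
      also have "\<dots> \<le> (v x)\<^sup>2 / ((real l)\<^sup>2 * 1)"
        using l by (intro divide_left_mono mult_left_mono) auto
      finally show "(real l - 1) * (v x / k)\<^sup>2 \<le> (v x)\<^sup>2 / (real l)\<^sup>2" by simp
    qed
    finally show ?thesis by (simp add: sum_divide_distrib mult_left_mono)
  qed
  have EB: "EE S (\<lambda>\<eta>. (b \<eta>)\<^sup>2) \<le> mu4 * (?V / (real l)\<^sup>2)"
    using expectation_site_square_sum[OF S(1) sub, of "\<lambda>x. v x / real l"]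
    by (simp add: b_def[abs_def] power_divide sum_divide_distrib)
  have "EE S (\<lambda>\<eta>. (remainder n l v \<eta>)\<^sup>2) \<le> EE S (\<lambda>\<eta>. 2 * (a \<eta>)\<^sup>2 + 2 * (b \<eta>)\<^sup>2)"
    unfolding R
    by (intro integral_mono all_moments_integrable all_moments_intros am square_diff_le)
  also have "\<dots> = 2 * EE S (\<lambda>\<eta>. (a \<eta>)\<^sup>2) + 2 * EE S (\<lambda>\<eta>. (b \<eta>)\<^sup>2)"
    using int by (simp only: Bochner_Integration.integral_add integral_mult_right_zero integrable_mult_right)
  also have "\<dots> \<le> 2 * ((chi \<alpha> \<rho>)\<^sup>2 * (?V / (real l)\<^sup>2)) + 2 * (mu4 * (?V / (real l)\<^sup>2))"
    using EA EB by linarith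
  also have "\<dots> = 2 * ((chi \<alpha> \<rho>)\<^sup>2 + mu4) / (real l)\<^sup>2 * ?V"
    by (simp add: algebra_simps add_divide_distrib)
  finally show "EE S (\<lambda>\<eta>. (remainder n l v \<eta>)\<^sup>2) \<le> 2 * ((chi \<alpha> \<rho>)\<^sup>2 + mu4) / (real l)\<^sup>2 * ?V" .
qed

end

section \<open>Stationary chains on the torus\<close>

lemma fubini_bounded:
  fixes G :: "'a \<Rightarrow> 'b \<Rightarrow> real"
  assumes M: "sigma_finite_measure M1" "sigma_finite_measure M2"
    and A: "A \<in> sets M1" "emeasure M1 A < \<infinity>" and B: "B \<in> sets M2" "emeasure M2 B < \<infinity>"
    and G: "(\<lambda>(x, y). G x y) \<in> borel_measurable (M1 \<Otimes>\<^sub>M M2)"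
    and bound: "\<And>x y. \<bar>G x y\<bar> \<le> b * (indicator A x * indicator B y)"
  shows "(\<integral>y. (\<integral>x. G x y \<partial>M1) \<partial>M2) = (\<integral>x. (\<integral>y. G x y \<partial>M2) \<partial>M1)"
    and "integrable M1 (\<lambda>x. \<integral>y. G x y \<partial>M2)"
proof -
  interpret sf1: sigma_finite_measure M1 by fact
  interpret sf2: sigma_finite_measure M2 by fact
  interpret pair_sigma_finite M1 M2 ..
  have int: "integrable (M1 \<Otimes>\<^sub>M M2) (\<lambda>(x, y). G x y)"
  proof (rule Bochner_Integration.integrable_bound)
    have "emeasure (M1 \<Otimes>\<^sub>M M2) (A \<times> B) < \<infinity>"
      using A B by (simp add: sf2.emeasure_pair_measure_Times ennreal_mult_less_top)
    then have "integrable (M1 \<Otimes>\<^sub>M M2) (indicat_real (A \<times> B))"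
      using A B by (intro integrable_real_indicator) auto
    then show "integrable (M1 \<Otimes>\<^sub>M M2) (\<lambda>z. b * indicat_real (A \<times> B) z)"
      by (rule integrable_mult_right)
    have "\<bar>G x y\<bar> \<le> \<bar>b * indicat_real (A \<times> B) (x, y)\<bar>" for x y
      using bound[of x y] by (auto simp: indicator_times)
    then show "AE z in M1 \<Otimes>\<^sub>M M2. norm (case z of (x, y) \<Rightarrow> G x y) \<le> norm (b * indicat_real (A \<times> B) z)"
      by (intro AE_I2) auto
  qed (rule G)
  show "(\<integral>y. (\<integral>x. G x y \<partial>M1) \<partial>M2) = (\<integral>x. (\<integral>y. G x y \<partial>M2) \<partial>M1)"
    by (rule Fubini_integral[OF int])
  show "integrable M1 (\<lambda>x. \<integral>y. G x y \<partial>M2)"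
    using integrable_fst'[OF int] by simp
qed

locale torus_chain = torus_process +
  fixes p :: "real \<Rightarrow> config \<Rightarrow> config \<Rightarrow> real" and N :: "(real \<Rightarrow> config) measure"
  assumes transition: "markov_transition_function S rate p"
    and prob_N: "prob_space N" and sets_N: "sets N = sets path_space"
    and fdd: "\<And>n (t :: nat \<Rightarrow> real) x. t 0 = 0 \<Longrightarrow> (\<And>i. i < n \<Longrightarrow> t i \<le> t (Suc i)) \<Longrightarrow> (\<And>i. i \<le> n \<Longrightarrow> x i \<in> S) \<Longrightarrow>
           measure N {w \<in> space N. \<forall>i\<le>n. w (t i) = x i} =
             measure (torus_measure \<alpha> \<rho> K) {x 0} * (\<Prod>i<n. p (t (Suc i) - t i) (x i) (x (Suc i)))"
begin

sublocale prob_space N by (rule prob_N)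

lemma space_N: "space N = cadlag_paths"
  using sets_eq_imp_space_eq[OF sets_N] by simp

lemma p_nonneg: "0 \<le> h \<Longrightarrow> x \<in> S \<Longrightarrow> y \<in> S \<Longrightarrow> 0 \<le> p h x y"
  using transition[unfolded markov_transition_function_def, THEN conjunct1] by simp

lemma p_at_0: "x \<in> S \<Longrightarrow> y \<in> S \<Longrightarrow> p 0 x y = of_bool (x = y)"
  using transition[unfolded markov_transition_function_def, THEN conjunct2, THEN conjunct1] by simp

lemmas p_backward =
  transition[unfolded markov_transition_function_def, THEN conjunct2, THEN conjunct2, THEN conjunct2, rule_format]

lemma finite_chain:
  assumes J: "finite J" shows "finite_markov_chain (lev J) m rate p"
proof
  show "finite (lev J)" by (rule finite_level[OF J])
  have sub: "lev J \<subseteq> S" by (auto simp: level_def)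
  show "p 0 x y = of_bool (x = y)" if "x \<in> lev J" "y \<in> lev J" for x y
    using that sub by (intro p_at_0) auto
  show "((\<lambda>h. p h x y) has_real_derivative (\<Sum>z\<in>lev J. rate x z * (p h z y - p h x y))) (at h within {0..})"
    if h: "0 \<le> h" and x: "x \<in> lev J" and y: "y \<in> lev J" for h x y
  proof -
    have "((\<lambda>s. p s x y) has_real_derivative (\<Sum>\<^sub>\<infinity>z\<in>S. rate x z * (p h z y - p h x y))) (at h within {0..})"
      using h x y sub by (intro p_backward) auto
    also have "(\<Sum>\<^sub>\<infinity>z\<in>S. rate x z * (p h z y - p h x y)) = (\<Sum>\<^sub>\<infinity>z\<in>lev J. rate x z * (p h z y - p h x y))"
      by (rule infsum_cong_neutral) (use sub rate_outside[OF x] in auto)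
    also have "\<dots> = (\<Sum>z\<in>lev J. rate x z * (p h z y - p h x y))"
      by (rule infsum_finite[OF finite_level[OF J]])
    finally show ?thesis .
  qed
  show "(\<Sum>x\<in>lev J. m x * (\<Sum>z\<in>lev J. rate x z * (g z - g x))) = 0" for g
    by (rule invariance[OF J])
qed


abbreviation total :: "config \<Rightarrow> nat" where "total \<eta> \<equiv> \<Sum>i\<in>T. \<eta> i"

text \<open>
  Stationarity on the level sets \<open>{n, n'}\<close> and \<open>{n'}\<close> leaves no mass for transitions from particle number
  \<open>n\<close> to \<open>n'\<close>.
\<close>

lemma p_zero:
  assumes h: "0 \<le> h" and x: "x \<in> S" and y: "y \<in> S" and ne: "total x \<noteq> total y"
  shows "p h x y = 0"
proof -
  have c: "(\<Sum>x\<in>lev J. m x * p h x y) = m y" if "finite J" "total y \<in> J" for J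
    using finite_markov_chain.stationary[OF finite_chain[OF that(1)] h] y that(2) by (simp add: level_def)
  have "lev {total x, total y} = lev {total x} \<union> lev {total y}" "lev {total x} \<inter> lev {total y} = {}"
    using ne by (auto simp: level_def)
  then have "(\<Sum>z\<in>lev {total x, total y}. m z * p h z y) =
      (\<Sum>z\<in>lev {total x}. m z * p h z y) + (\<Sum>z\<in>lev {total y}. m z * p h z y)"
    by (simp add: sum.union_disjoint finite_level)
  then have "(\<Sum>z\<in>lev {total x}. m z * p h z y) = 0" using c[of "{total x, total y}"] c[of "{total y}"] by simp
  then have "\<forall>z\<in>lev {total x}. m z * p h z y = 0"
    by (subst (asm) sum_nonneg_eq_0_iff) (use h y finite_level[of "{total x}" K] in \<open>auto simp: level_def intro!: mult_nonneg_nonneg mu_nonneg p_nonneg\<close>)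
  then have "m x * p h x y = 0" using x by (auto simp: level_def)
  then show ?thesis using mu_pos[OF x] by simp
qed

lemma event_measurable: "0 \<le> t \<Longrightarrow> {w \<in> space N. w t = x} \<in> sets N"
proof -
  assume t: "0 \<le> t"
  have "(\<lambda>w. real (w t i)) \<in> borel_measurable N" for i
    using measurable_compose[OF measurable_path_eval[OF t] measurable_coord_real]
    by (simp add: measurable_cong_sets[OF sets_N refl])
  then have "{w \<in> space N. \<forall>i. real (w t i) = real (x i)} \<in> sets N"
    by (intro sets.sets_Collect_countable_All borel_measurable_eq) auto
  also have "{w \<in> space N. \<forall>i. real (w t i) = real (x i)} = {w \<in> space N. w t = x}"
    by (auto simp: fun_eq_iff)
  finally show ?thesis .
qed

lemma countable_S: "countable S"
  unfolding torus_configs_def by (rule countable_PiE) auto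

lemma AE_in_S:
  assumes t: "0 \<le> t" and law: "\<And>x. x \<in> S \<Longrightarrow> measure N {w \<in> space N. w t = x} = m x"
  shows "AE w in N. w t \<in> S"
proof -
  let ?E = "\<lambda>x. {w \<in> space N. w t = x}"
  have "emeasure N (\<Union>x\<in>S. ?E x) = (\<integral>\<^sup>+x. emeasure N (?E x) \<partial>count_space S)"
    using event_measurable[OF t] countable_S
    by (intro emeasure_UN_countable) (auto simp: disjoint_family_on_def)
  also have "\<dots> = (\<integral>\<^sup>+x. ennreal (pmf (config_pmf T) x) \<partial>count_space S)"
    by (intro nn_integral_cong) (use law in \<open>simp add: emeasure_eq_measure \<mu>_def\<close>)
  also have "\<dots> = emeasure (measure_pmf (config_pmf T)) S" by (rule nn_integral_pmf)
  also have "\<dots> = 1"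
  proof -
    have "set_pmf (config_pmf T) \<subseteq> S"
      using set_Pi_pmf_subset[OF finite_torus, of K undefined "\<lambda>_. site_pmf"]
      unfolding config_pmf_def torus_configs_def by (auto simp: PiE_iff extensional_def)
    then have "AE x in measure_pmf (config_pmf T). x \<in> S" by (auto simp: AE_measure_pmf_iff)
    then show ?thesis using measure_pmf.emeasure_eq_1_AE[of S "config_pmf T"] by simp
  qed
  finally have "prob (\<Union>x\<in>S. ?E x) = 1" by (simp add: emeasure_eq_measure)
  then have "AE w in N. w \<in> (\<Union>x\<in>S. ?E x)" by (rule AE_prob_1)
  then show ?thesis by (rule AE_mp) (rule AE_I2, auto)
qed

lemma law_0: "x \<in> S \<Longrightarrow> measure N {w \<in> space N. w 0 = x} = m x"
  using fdd[of "\<lambda>_. 0" 0 "\<lambda>_. x"] by (simp add: measure_torus_measure)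

text \<open>
  Sum the three-time marginals over the configuration at time zero. Only those with the particle number of
  \<open>x\<close> contribute, so the sum is finite and stationarity evaluates it.
\<close>

lemma two_point_law:
  assumes sr: "0 \<le> s" "s \<le> r" and x: "x \<in> S" and y: "y \<in> S"
  shows "measure N {w \<in> space N. w s = x \<and> w r = y} = m x * p (r - s) x y"
proof -
  define E where "E z = {w \<in> space N. w 0 = z \<and> w s = x \<and> w r = y}" for z
  have Em: "E z \<in> sets N" for z
  proof -
    have "E z = {w \<in> space N. w 0 = z} \<inter> {w \<in> space N. w s = x} \<inter> {w \<in> space N. w r = y}"
      by (auto simp: E_def)
    then show ?thesis by (simp only:) (intro sets.Int event_measurable; use sr in simp)
  qed
  have Ep: "measure N (E z) = m z * (p s z x * p (r - s) x y)" if "z \<in> S" for z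
  proof -
    have "{w \<in> space N. \<forall>i\<le>2. w ((\<lambda>i. [0, s, r] ! i) i) = (\<lambda>i. [z, x, y] ! i) i} = E z"
      by (auto simp: E_def numeral_2_eq_2 le_Suc_eq)
    moreover have "measure N {w \<in> space N. \<forall>i\<le>2. w ((\<lambda>i. [0, s, r] ! i) i) = (\<lambda>i. [z, x, y] ! i) i} =
       measure (torus_measure \<alpha> \<rho> K) {(\<lambda>i. [z, x, y] ! i) 0} *
       (\<Prod>i<2. p ((\<lambda>i. [0, s, r] ! i) (Suc i) - (\<lambda>i. [0, s, r] ! i) i) ((\<lambda>i. [z, x, y] ! i) i) ((\<lambda>i. [z, x, y] ! i) (Suc i)))"
      using sr x y that by (intro fdd) (auto simp: numeral_2_eq_2 less_Suc_eq le_Suc_eq)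
    ultimately show ?thesis
      using that by (simp add: measure_torus_measure numeral_2_eq_2)
  qed
  let ?C = "lev {total x}"
  have fin: "finite ?C" by (rule finite_level) simp
  have "AE w in N. w 0 \<in> S" by (intro AE_in_S law_0) auto
  moreover have "AE w in N. \<forall>z\<in>S - ?C. w \<notin> E z"
  proof (subst AE_ball_countable)
    show "countable (S - ?C)" using countable_S by blast
    show "\<forall>z\<in>S - ?C. AE w in N. w \<notin> E z"
    proof
      fix z assume z: "z \<in> S - ?C"
      then have "total z \<noteq> total x" by (auto simp: level_def)
      then have "measure N (E z) = 0" using z x sr by (simp add: Ep p_zero)
      then have "E z \<in> null_sets N" using Em by (simp add: null_sets_def emeasure_eq_measure)
      then show "AE w in N. w \<notin> E z" by (rule AE_not_in)
    qed
  qed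
  ultimately have "AE w in N. (w \<in> {w \<in> space N. w s = x \<and> w r = y}) = (w \<in> (\<Union>z\<in>?C. E z))"
  proof eventually_elim
    case (elim w)
    then show ?case by (auto simp: E_def)
  qed
  then have "measure N {w \<in> space N. w s = x \<and> w r = y} = measure N (\<Union>z\<in>?C. E z)"
  proof (rule measure_eq_AE)
    have "{w \<in> space N. w s = x \<and> w r = y} = {w \<in> space N. w s = x} \<inter> {w \<in> space N. w r = y}" by auto
    then show "{w \<in> space N. w s = x \<and> w r = y} \<in> sets N"
      by (simp only:) (intro sets.Int event_measurable; use sr in simp)
  qed (use fin Em in auto)
  also have "\<dots> = (\<Sum>z\<in>?C. measure N (E z))"
    by (rule finite_measure_finite_Union[OF fin]) (use Em in \<open>auto simp: disjoint_family_on_def E_def\<close>)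
  also have "\<dots> = (\<Sum>z\<in>?C. m z * p s z x * p (r - s) x y)"
    by (intro sum.cong refl) (auto simp: Ep level_def)
  also have "\<dots> = m x * p (r - s) x y"
    using finite_markov_chain.stationary[OF finite_chain sr(1), of "{total x}" x] x
    unfolding sum_distrib_right[symmetric] by (simp add: level_def)
  finally show ?thesis .
qed

lemma one_point_law:
  assumes "0 \<le> s" "x \<in> S" shows "measure N {w \<in> space N. w s = x} = m x"
proof -
  have "p 0 x x = 1" using assms by (simp add: p_at_0)
  then show ?thesis using two_point_law[of s s x x] assms by simp
qed

text \<open>
  The marginals give the claim at all rational times, and right-continuity of the coordinates off the torus
  extends it to all times.
\<close>

lemma AE_all_in_S: "AE w in N. \<forall>s\<ge>0. w s \<in> S"
proof -
  have "AE w in N. \<forall>q\<in>\<rat> \<inter> {0..}. w q \<in> S"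
    by (subst AE_ball_countable) (auto intro!: AE_in_S one_point_law countable_Int1 countable_rat)
  then show ?thesis
  proof (rule AE_mp, intro AE_I2 impI allI)
    fix w s assume w: "w \<in> space N" and q: "\<forall>q\<in>\<rat> \<inter> {0..}. w q \<in> S" and s: "0 \<le> (s :: real)"
    have "w s i = undefined" if "i \<notin> T" for i
    proof -
      have "w \<in> cadlag_paths" using w by (simp only: space_N)
      from cadlag_coordinate_jump[OF this s, of i]
      have "\<exists>\<delta>>0. \<forall>r. s < r \<longrightarrow> r < s + \<delta> \<longrightarrow> w r i = w s i" by metis
      then obtain \<delta> where \<delta>: "\<delta> > 0" "\<And>r. s < r \<Longrightarrow> r < s + \<delta> \<Longrightarrow> w r i = w s i" by blast
      obtain q' where q': "q' \<in> \<rat>" "s < q'" "q' < s + \<delta>"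
        using Rats_dense_in_real[of s "s + \<delta>"] \<delta>(1) by auto
      then have "w q' \<in> S" using q s by auto
      then show ?thesis
        using that \<delta>(2)[OF q'(2,3)] by (auto simp: torus_configs_def PiE_iff extensional_def)
    qed
    then show "w s \<in> S" by (auto simp: torus_configs_def PiE_iff extensional_def)
  qed
qed

end

text \<open>
  The observable \<open>F\<close>, switched off when the particle number leaves the finite set \<open>J\<close>. All expectations below
  are finite sums.
\<close>

locale truncated_observable = torus_chain +
  fixes J :: "nat set" and t :: real and F :: "real \<Rightarrow> config \<Rightarrow> real"
  assumes J: "finite J" and t_nonneg: "0 \<le> t"
    and contF: "\<And>\<eta>. \<eta> \<in> level K J \<Longrightarrow> continuous_on {0..t} (\<lambda>s. F s \<eta>)"
begin

definition trunc :: "real \<Rightarrow> (real \<Rightarrow> config) \<Rightarrow> real" where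
  "trunc s w = indicator {0..t} s * (\<Sum>\<eta>\<in>lev J. F s \<eta> * of_bool (w (max 0 s) = \<eta>))"

definition trunc_integral :: "(real \<Rightarrow> config) \<Rightarrow> real" where
  "trunc_integral w = (\<integral>s. trunc s w \<partial>lborel)"

lemma finite_levels: "finite (lev J)" by (rule finite_level[OF J])

lemma measurable_singleton_config: "(\<lambda>\<xi>. of_bool (\<xi> = \<eta>) :: real) \<in> borel_measurable borel"
  for \<eta> :: config
proof -
  have "{\<xi> \<in> space borel. \<forall>i. real (\<xi> i) = real (\<eta> i)} \<in> sets (borel :: config measure)"
    by (intro sets.sets_Collect_countable_All borel_measurable_eq) auto
  moreover have "{\<xi> \<in> space borel. \<forall>i. real (\<xi> i) = real (\<eta> i)} = {\<eta>}" by (auto simp: fun_eq_iff)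
  ultimately have "{\<eta>} \<in> sets (borel :: config measure)" by (simp only:)
  then have "(indicator {\<eta>} :: config \<Rightarrow> real) \<in> borel_measurable borel"
    by (rule borel_measurable_indicator)
  also have "(indicator {\<eta>} :: config \<Rightarrow> real) = (\<lambda>\<xi>. of_bool (\<xi> = \<eta>))" by (auto simp: indicator_def)
  finally show ?thesis .
qed

lemma trunc_measurable: "(\<lambda>(s, w). trunc s w) \<in> borel_measurable (lborel \<Otimes>\<^sub>M N)"
proof -
  have eq: "(\<lambda>(s, w). trunc s w) = (\<lambda>z. \<Sum>\<eta>\<in>lev J. (indicator {0..t} (fst z) *\<^sub>R F (fst z) \<eta>) *
      of_bool ((case z of (s, w) \<Rightarrow> w (max 0 s)) = \<eta>))"
    by (auto simp: trunc_def sum_distrib_left mult.assoc fun_eq_iff)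
  have "(\<lambda>s. indicator {0..t} s *\<^sub>R F s \<eta>) \<in> borel_measurable lborel" if "\<eta> \<in> lev J" for \<eta>
    using borel_measurable_continuous_on_indicator[OF _ contF[OF that]] by simp
  moreover have "(\<lambda>(s, w). w (max 0 s)) \<in> (lborel :: real measure) \<Otimes>\<^sub>M N \<rightarrow>\<^sub>M (borel :: config measure)"
    using measurable_pair_path_eval by (simp add: measurable_cong_sets[OF sets_pair_measure_cong[OF refl sets_N] refl])
  ultimately show ?thesis unfolding eq
    by (intro borel_measurable_sum borel_measurable_times measurable_compose[OF measurable_fst]
      measurable_compose[OF _ measurable_singleton_config])
qed

lemma trunc_bounded: "\<exists>b\<ge>0. \<forall>s w. \<bar>trunc s w\<bar> \<le> b * indicator {0..t} s"
proof -
  have "\<exists>c. \<forall>s\<in>{0..t}. \<bar>F s \<eta>\<bar> \<le> c" if "\<eta> \<in> lev J" for \<eta>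
  proof -
    have "bounded ((\<lambda>s. F s \<eta>) ` {0..t})"
      by (intro compact_imp_bounded compact_continuous_image contF that compact_Icc)
    then show ?thesis unfolding bounded_iff by auto
  qed
  then obtain c where c: "\<And>\<eta> s. \<eta> \<in> lev J \<Longrightarrow> s \<in> {0..t} \<Longrightarrow> \<bar>F s \<eta>\<bar> \<le> c \<eta>" by metis
  have "\<bar>trunc s w\<bar> \<le> (\<Sum>\<eta>\<in>lev J. \<bar>c \<eta>\<bar>) * indicator {0..t} s" for s w
  proof (cases "s \<in> {0..t}")
    case True
    have "\<bar>trunc s w\<bar> \<le> (\<Sum>\<eta>\<in>lev J. \<bar>F s \<eta> * of_bool (w (max 0 s) = \<eta>)\<bar>)"
      unfolding trunc_def using True by (simp add: sum_abs)
    also have "\<dots> \<le> (\<Sum>\<eta>\<in>lev J. \<bar>c \<eta>\<bar>)"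
      using c[OF _ True] by (intro sum_mono) (force simp: abs_mult)
    finally show ?thesis using True by simp
  qed (simp add: trunc_def)
  moreover have "0 \<le> (\<Sum>\<eta>\<in>lev J. \<bar>c \<eta>\<bar>)" by (intro sum_nonneg) simp
  ultimately show ?thesis by blast
qed

lemma fubini_N:
  fixes G :: "real \<Rightarrow> (real \<Rightarrow> config) \<Rightarrow> real"
  assumes "(\<lambda>(s, w). G s w) \<in> borel_measurable (lborel \<Otimes>\<^sub>M N)"
    and "\<And>s w. \<bar>G s w\<bar> \<le> b * indicator {0..t} s"
  shows "(\<integral>w. (\<integral>s. G s w \<partial>lborel) \<partial>N) = (\<integral>s. (\<integral>w. G s w \<partial>N) \<partial>lborel)"
    and "integrable lborel (\<lambda>s. \<integral>w. G s w \<partial>N)"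
proof -
  define G' where "G' s w = G s w * indicator (space N) w" for s w
  have m: "(\<lambda>(s, w). G' s w) \<in> borel_measurable (lborel \<Otimes>\<^sub>M N)"
  proof -
    have "(\<lambda>z. (case z of (s, w) \<Rightarrow> G s w) * indicator (space N) (snd z)) \<in> borel_measurable (lborel \<Otimes>\<^sub>M N)"
      by (rule borel_measurable_times[OF assms(1) measurable_compose[OF measurable_snd borel_measurable_indicator]]) simp
    then show ?thesis by (simp add: G'_def split_def)
  qed
  have b: "\<bar>G' s w\<bar> \<le> b * (indicator {0..t} s * indicator (space N) w)" for s w
    using assms(2)[of s w] by (auto simp: G'_def indicator_def)
  note fb = fubini_bounded[OF lborel.sigma_finite_measure_axioms sigma_finite_measure_axioms, of "{0..t}" "space N", OF _ _ _ _ m b]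
  have i: "(\<integral>w. G' s w \<partial>N) = (\<integral>w. G s w \<partial>N)" for s
    by (rule Bochner_Integration.integral_cong) (auto simp: G'_def)
  have i': "(\<integral>w. (\<integral>s. G' s w \<partial>lborel) \<partial>N) = (\<integral>w. (\<integral>s. G s w \<partial>lborel) \<partial>N)"
    by (rule Bochner_Integration.integral_cong) (auto simp: G'_def)
  show "(\<integral>w. (\<integral>s. G s w \<partial>lborel) \<partial>N) = (\<integral>s. (\<integral>w. G s w \<partial>N) \<partial>lborel)"
    using fb(1) by (simp add: i i' emeasure_lborel_Icc_eq emeasure_space_1)
  show "integrable lborel (\<lambda>s. \<integral>w. G s w \<partial>N)"
    using fb(2) by (simp add: i emeasure_lborel_Icc_eq emeasure_space_1)
qed

lemma trunc_integral_measurable: "trunc_integral \<in> borel_measurable N"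
proof -
  have "(\<lambda>(w, s). trunc s w) \<in> borel_measurable (N \<Otimes>\<^sub>M lborel)"
    using measurable_pair_swap[OF trunc_measurable] by (simp add: split_def)
  from lborel.borel_measurable_lebesgue_integral[OF this] show ?thesis
    unfolding trunc_integral_def[abs_def] by simp
qed

lemma trunc_section: "w \<in> space N \<Longrightarrow> (\<lambda>s. trunc s w) \<in> borel_measurable lborel"
  using measurable_compose[OF measurable_Pair2' trunc_measurable] by simp

lemma trunc_section': "(\<lambda>w. trunc s w) \<in> borel_measurable N"
  using measurable_compose[OF measurable_Pair1' trunc_measurable, of s] by simp

lemma integrable_indicator_Icc: "integrable lborel (indicat_real {0..t})"
  by (rule integrable_real_indicator) (auto simp: emeasure_lborel_Icc_eq)

lemma trunc_integral_bounded: "\<exists>b\<ge>0. \<forall>w. \<bar>trunc_integral w\<bar> \<le> b"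
proof -
  obtain b where b: "b \<ge> 0" "\<And>s w. \<bar>trunc s w\<bar> \<le> b * indicator {0..t} s" using trunc_bounded by blast
  have "\<bar>trunc_integral w\<bar> \<le> (\<integral>s. b * indicat_real {0..t} s \<partial>lborel)" for w
  proof (cases "integrable lborel (\<lambda>s. trunc s w)")
    case True
    have "\<bar>trunc_integral w\<bar> \<le> (\<integral>s. \<bar>trunc s w\<bar> \<partial>lborel)" unfolding trunc_integral_def by (rule integral_abs_bound)
    also have "\<dots> \<le> (\<integral>s. b * indicat_real {0..t} s \<partial>lborel)"
      using True integrable_indicator_Icc by (intro integral_mono b(2)) auto
    finally show ?thesis .
  next
    case False
    then show ?thesis
      using b(1) by (simp add: trunc_integral_def not_integrable_integral_eq del: integral_mult_right_zero integral_mult_right)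
  qed
  moreover have "0 \<le> (\<integral>s. b * indicat_real {0..t} s \<partial>lborel)"
    using b(1) by (intro Bochner_Integration.integral_nonneg) auto
  ultimately show ?thesis by blast
qed

lemma trunc_integral_integrable: "integrable N trunc_integral"
proof -
  obtain b where "\<And>w. \<bar>trunc_integral w\<bar> \<le> b" using trunc_integral_bounded by blast
  then show ?thesis by (intro integrable_const_bound[of _ b] trunc_integral_measurable) auto
qed

lemma trunc_integral_sq_integrable: "integrable N (\<lambda>w. (trunc_integral w)\<^sup>2)"
proof -
  obtain b where b: "b \<ge> 0" "\<And>w. \<bar>trunc_integral w\<bar> \<le> b" using trunc_integral_bounded by blast
  have "(trunc_integral w)\<^sup>2 \<le> b\<^sup>2" for w using b(2)[of w] b(1) by (metis abs_le_square_iff abs_of_nonneg)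
  then show ?thesis
    by (intro integrable_const_bound[of _ "b\<^sup>2"] borel_measurable_power trunc_integral_measurable) auto
qed

lemma trunc_integrable:
  assumes w: "w \<in> space N" shows "integrable lborel (\<lambda>s. trunc s w)"
proof -
  obtain b where b: "b \<ge> 0" "\<And>s w. \<bar>trunc s w\<bar> \<le> b * indicator {0..t} s" using trunc_bounded by blast
  show ?thesis
  proof (rule Bochner_Integration.integrable_bound)
    show "integrable lborel (\<lambda>r. b * indicat_real {0..t} r)"
      by (intro integrable_mult_right integrable_indicator_Icc)
  qed (use b trunc_section[OF w] in \<open>auto intro!: AE_I2 order_trans[OF b(2)]\<close>)
qed

definition cov :: "real \<Rightarrow> real \<Rightarrow> real" where
  "cov s r = (\<integral>w. trunc s w * trunc r w \<partial>N)"

lemma cov_sym: "cov s r = cov r s"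
  by (simp add: cov_def mult.commute)

lemma second_moment_cov: "(\<integral>w. (trunc_integral w)\<^sup>2 \<partial>N) = (\<integral>s. (\<integral>r. cov s r \<partial>lborel) \<partial>lborel)"
proof -
  obtain b where b: "b \<ge> 0" "\<And>s w. \<bar>trunc s w\<bar> \<le> b * indicator {0..t} s" using trunc_bounded by blast
  obtain b' where b': "b' \<ge> 0" "\<And>w. \<bar>trunc_integral w\<bar> \<le> b'" using trunc_integral_bounded by blast
  have le_b: "\<bar>trunc s w\<bar> \<le> b" for s w
    using b(2)[of s w] b(1) by (cases "s \<in> {0..t}") auto
  have "(\<integral>w. (trunc_integral w)\<^sup>2 \<partial>N) = (\<integral>w. (\<integral>s. trunc s w * trunc_integral w \<partial>lborel) \<partial>N)"
    by (simp add: trunc_integral_def power2_eq_square)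
  also have "\<dots> = (\<integral>s. (\<integral>w. trunc s w * trunc_integral w \<partial>N) \<partial>lborel)"
  proof (rule fubini_N(1)[where b = "b * b'"])
    have "(\<lambda>z. (case z of (s, w) \<Rightarrow> trunc s w) * trunc_integral (snd z)) \<in> borel_measurable (lborel \<Otimes>\<^sub>M N)"
      by (intro borel_measurable_times trunc_measurable measurable_compose[OF measurable_snd] trunc_integral_measurable)
    then show "(\<lambda>(s, w). trunc s w * trunc_integral w) \<in> borel_measurable (lborel \<Otimes>\<^sub>M N)" by (simp add: split_def)
    fix s w
    have "\<bar>trunc s w\<bar> * \<bar>trunc_integral w\<bar> \<le> (b * indicator {0..t} s) * b'"
      using b b' by (intro mult_mono) auto
    then show "\<bar>trunc s w * trunc_integral w\<bar> \<le> b * b' * indicator {0..t} s" by (simp add: abs_mult mult_ac)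
  qed
  also have "\<dots> = (\<integral>s. (\<integral>r. cov s r \<partial>lborel) \<partial>lborel)"
  proof (rule Bochner_Integration.integral_cong[OF refl])
    fix s
    have "(\<integral>w. trunc s w * trunc_integral w \<partial>N) = (\<integral>w. (\<integral>r. trunc s w * trunc r w \<partial>lborel) \<partial>N)"
      by (simp add: trunc_integral_def)
    also have "\<dots> = (\<integral>r. (\<integral>w. trunc s w * trunc r w \<partial>N) \<partial>lborel)"
    proof (rule fubini_N(1)[where b = "b * b"])
      have "(\<lambda>z. trunc s (snd z) * (case z of (r, w) \<Rightarrow> trunc r w)) \<in> borel_measurable (lborel \<Otimes>\<^sub>M N)"
        by (intro borel_measurable_times trunc_measurable measurable_compose[OF measurable_snd trunc_section'])
      then show "(\<lambda>(r, w). trunc s w * trunc r w) \<in> borel_measurable (lborel \<Otimes>\<^sub>M N)" by (simp add: split_def)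
      fix r w
      have "\<bar>trunc s w\<bar> * \<bar>trunc r w\<bar> \<le> b * (b * indicator {0..t} r)"
        using b le_b by (intro mult_mono) auto
      then show "\<bar>trunc s w * trunc r w\<bar> \<le> b * b * indicator {0..t} r" by (simp add: abs_mult mult_ac)
    qed
    finally show "(\<integral>w. trunc s w * trunc_integral w \<partial>N) = (\<integral>r. cov s r \<partial>lborel)" by (simp add: cov_def)
  qed
  finally show ?thesis .
qed

lemma cov_eq:
  assumes "s \<in> {0..t}" "r \<in> {0..t}" "s \<le> r"
  shows "cov s r = (\<Sum>x\<in>lev J. m x * (F s x * (\<Sum>y\<in>lev J. p (r - s) x y * F r y)))"
proof -
  have sub: "lev J \<subseteq> S" by (auto simp: level_def)
  let ?E = "\<lambda>x y. {w \<in> space N. w s = x \<and> w r = y}"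
  have E: "?E x y = {w \<in> space N. w s = x} \<inter> {w \<in> space N. w r = y}" for x y by auto
  have Em: "?E x y \<in> sets N" for x y
    unfolding E by (intro sets.Int event_measurable; use assms in simp)
  have "cov s r = (\<integral>w. (\<Sum>x\<in>lev J. \<Sum>y\<in>lev J. F s x * F r y * indicator (?E x y) w) \<partial>N)"
    unfolding cov_def
  proof (rule Bochner_Integration.integral_cong[OF refl])
    fix w assume w: "w \<in> space N"
    have "trunc s w * trunc r w = (\<Sum>x\<in>lev J. \<Sum>y\<in>lev J. (F s x * of_bool (w s = x)) * (F r y * of_bool (w r = y)))"
      using assms by (simp add: trunc_def max_def sum_product)
    also have "\<dots> = (\<Sum>x\<in>lev J. \<Sum>y\<in>lev J. F s x * F r y * indicator (?E x y) w)"
      using w by (intro sum.cong refl) (auto simp: indicator_def)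
    finally show "trunc s w * trunc r w = (\<Sum>x\<in>lev J. \<Sum>y\<in>lev J. F s x * F r y * indicator (?E x y) w)" .
  qed
  also have "\<dots> = (\<Sum>x\<in>lev J. \<Sum>y\<in>lev J. F s x * F r y * measure N (?E x y))"
  proof -
    have 1: "integrable N (\<lambda>w. F s x * F r y * indicator (?E x y) w)" for x y
      using Em by (intro integrable_mult_right integrable_real_indicator) (auto simp: emeasure_eq_measure)
    have 2: "(\<integral>w. F s x * F r y * indicator (?E x y) w \<partial>N) = F s x * F r y * measure N (?E x y)" for x y
    proof -
      have "?E x y \<inter> space N = ?E x y" by auto
      then show ?thesis by simp
    qed
    show ?thesis
      by (simp only: Bochner_Integration.integral_sum Bochner_Integration.integrable_sum 1 2)
  qed
  also have "\<dots> = (\<Sum>x\<in>lev J. m x * (F s x * (\<Sum>y\<in>lev J. p (r - s) x y * F r y)))"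
    unfolding sum_distrib_left using assms sub
    by (intro sum.cong refl) (simp add: two_point_law subset_iff)
  finally show ?thesis .
qed

lemma first_moment:
  "(\<integral>w. trunc_integral w \<partial>N) = (\<integral>s. indicator {0..t} s *\<^sub>R (\<Sum>x\<in>lev J. m x * F s x) \<partial>lborel)"
proof -
  obtain b where b: "b \<ge> 0" "\<And>s w. \<bar>trunc s w\<bar> \<le> b * indicator {0..t} s" using trunc_bounded by blast
  have "(\<integral>w. trunc_integral w \<partial>N) = (\<integral>s. (\<integral>w. trunc s w \<partial>N) \<partial>lborel)"
    unfolding trunc_integral_def by (rule fubini_N(1)[OF trunc_measurable b(2)])
  also have "\<dots> = (\<integral>s. indicator {0..t} s *\<^sub>R (\<Sum>x\<in>lev J. m x * F s x) \<partial>lborel)"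
  proof (rule Bochner_Integration.integral_cong[OF refl])
    fix s
    show "(\<integral>w. trunc s w \<partial>N) = indicator {0..t} s *\<^sub>R (\<Sum>x\<in>lev J. m x * F s x)"
    proof (cases "s \<in> {0..t}")
      case True
      let ?E = "\<lambda>x. {w \<in> space N. w s = x}"
      have Em: "?E x \<in> sets N" for x using True by (intro event_measurable) simp
      have 1: "integrable N (\<lambda>w. F s x * indicator (?E x) w)" for x
        using Em by (intro integrable_mult_right integrable_real_indicator) (auto simp: emeasure_eq_measure)
      have 2: "(\<integral>w. F s x * indicator (?E x) w \<partial>N) = F s x * measure N (?E x)" for x
      proof -
        have "?E x \<inter> space N = ?E x" by auto
        then show ?thesis by simp
      qed
      have "(\<integral>w. trunc s w \<partial>N) = (\<integral>w. (\<Sum>x\<in>lev J. F s x * indicator (?E x) w) \<partial>N)"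
        by (rule Bochner_Integration.integral_cong) (use True in \<open>auto simp: trunc_def max_def indicator_def intro!: sum.cong\<close>)
      also have "\<dots> = (\<Sum>x\<in>lev J. F s x * measure N (?E x))"
        by (simp only: Bochner_Integration.integral_sum Bochner_Integration.integrable_sum 1 2)
      also have "\<dots> = (\<Sum>x\<in>lev J. m x * F s x)"
        using True by (intro sum.cong refl) (simp add: one_point_law level_def)
      finally show ?thesis using True by simp
    qed (simp add: trunc_def)
  qed
  finally show ?thesis .
qed

lemma cov_zero: "s \<notin> {0..t} \<or> r \<notin> {0..t} \<Longrightarrow> cov s r = 0"
  by (auto simp: cov_def trunc_def)

lemma cov_bounded: "\<exists>b\<ge>0. \<forall>s r. \<bar>cov s r\<bar> \<le> b * (indicator {0..t} s * indicator {0..t} r)"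
proof -
  obtain b where b: "b \<ge> 0" "\<And>s w. \<bar>trunc s w\<bar> \<le> b * indicator {0..t} s" using trunc_bounded by blast
  have "\<bar>cov s r\<bar> \<le> b * b * (indicator {0..t} s * indicator {0..t} r)" for s r
  proof -
    have le: "\<bar>trunc s w * trunc r w\<bar> \<le> b * b * (indicator {0..t} s * indicator {0..t} r)" for w
    proof -
      have "\<bar>trunc s w\<bar> * \<bar>trunc r w\<bar> \<le> (b * indicator {0..t} s) * (b * indicator {0..t} r)"
        using b by (intro mult_mono) auto
      then show ?thesis by (simp add: abs_mult mult_ac)
    qed
    have int: "integrable N (\<lambda>w. trunc s w * trunc r w)"
      by (rule integrable_const_bound[of _ "b * b * (indicator {0..t} s * indicator {0..t} r)"])
        (use le trunc_section' in auto)
    have "\<bar>cov s r\<bar> \<le> (\<integral>w. \<bar>trunc s w * trunc r w\<bar> \<partial>N)" unfolding cov_def by (rule integral_abs_bound)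
    also have "\<dots> \<le> (\<integral>w. b * b * (indicator {0..t} s * indicator {0..t} r) \<partial>N)"
      using int by (intro integral_mono le) auto
    finally show ?thesis by (simp add: prob_space)
  qed
  then show ?thesis using b(1) by (intro exI[of _ "b * b"]) auto
qed

lemma cov_measurable: "(\<lambda>(s, r). cov s r) \<in> borel_measurable (lborel \<Otimes>\<^sub>M lborel)"
proof -
  have "(\<lambda>z. (case (fst (fst z), snd z) of (s, w) \<Rightarrow> trunc s w) * (case (snd (fst z), snd z) of (s, w) \<Rightarrow> trunc s w))
      \<in> borel_measurable ((lborel \<Otimes>\<^sub>M lborel) \<Otimes>\<^sub>M N)"
    by (intro borel_measurable_times measurable_compose[OF _ trunc_measurable] measurable_Pair
      measurable_compose[OF measurable_fst measurable_fst] measurable_compose[OF measurable_fst measurable_snd] measurable_snd)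
  then have "(\<lambda>(z, w). trunc (fst z) w * trunc (snd z) w) \<in> borel_measurable ((lborel \<Otimes>\<^sub>M lborel) \<Otimes>\<^sub>M N)"
    by (simp add: split_def)
  from borel_measurable_lebesgue_integral[OF this] show ?thesis
    unfolding cov_def by (simp add: split_def)
qed

text \<open>
  The covariance is symmetric, so Fubini's theorem identifies the contributions of the two triangles.
\<close>

lemma second_moment_half:
  "(\<integral>w. (trunc_integral w)\<^sup>2 \<partial>N) = 2 * (\<integral>s. (\<integral>r. indicator {s..} r * cov s r \<partial>lborel) \<partial>lborel)"
proof -
  obtain b where b: "b \<ge> 0" "\<And>s r. \<bar>cov s r\<bar> \<le> b * (indicator {0..t} s * indicator {0..t} r)"
    using cov_bounded by blast
  let ?U = "\<lambda>s r. indicator {s..} r * cov s r" and ?V = "\<lambda>s r. indicator {..<s} r * cov s r"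
  have tri: "{z. fst z \<le> snd z} \<in> sets (lborel \<Otimes>\<^sub>M lborel :: (real \<times> real) measure)"
    "{z. snd z < fst z} \<in> sets (lborel \<Otimes>\<^sub>M lborel :: (real \<times> real) measure)"
  proof -
    have "{z \<in> space (lborel \<Otimes>\<^sub>M lborel). fst z \<le> snd z} \<in> sets (lborel \<Otimes>\<^sub>M lborel :: (real \<times> real) measure)"
      "{z \<in> space (lborel \<Otimes>\<^sub>M lborel). snd z < fst z} \<in> sets (lborel \<Otimes>\<^sub>M lborel :: (real \<times> real) measure)"
      by measurable
    then show "{z. fst z \<le> snd z} \<in> sets (lborel \<Otimes>\<^sub>M lborel :: (real \<times> real) measure)"
      "{z. snd z < fst z} \<in> sets (lborel \<Otimes>\<^sub>M lborel :: (real \<times> real) measure)"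
      by (simp_all add: space_pair_measure)
  qed
  have U: "(\<lambda>(s, r). ?U s r) \<in> borel_measurable (lborel \<Otimes>\<^sub>M lborel)"
  proof -
    have "(\<lambda>z. indicator {z. fst z \<le> snd z} z * (case z of (s, r) \<Rightarrow> cov s r)) \<in> borel_measurable (lborel \<Otimes>\<^sub>M lborel :: (real \<times> real) measure)"
      by (intro borel_measurable_times cov_measurable borel_measurable_indicator tri)
    then show ?thesis by (rule measurable_cong[THEN iffD1, rotated]) (auto simp: indicator_def)
  qed
  have V: "(\<lambda>(s, r). ?V s r) \<in> borel_measurable (lborel \<Otimes>\<^sub>M lborel)"
  proof -
    have "(\<lambda>z. indicator {z. snd z < fst z} z * (case z of (s, r) \<Rightarrow> cov s r)) \<in> borel_measurable (lborel \<Otimes>\<^sub>M lborel :: (real \<times> real) measure)"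
      by (intro borel_measurable_times cov_measurable borel_measurable_indicator tri)
    then show ?thesis by (rule measurable_cong[THEN iffD1, rotated]) (auto simp: indicator_def)
  qed
  have bU: "\<bar>?U s r\<bar> \<le> b * (indicator {0..t} s * indicator {0..t} r)" for s r
    using b(2)[of s r] b(1) by (auto simp: indicator_def split: if_splits)
  have bV: "\<bar>?V s r\<bar> \<le> b * (indicator {0..t} s * indicator {0..t} r)" for s r
    using b(2)[of s r] b(1) by (auto simp: indicator_def split: if_splits)
  note fb = fubini_bounded[OF lborel.sigma_finite_measure_axioms lborel.sigma_finite_measure_axioms, of "{0..t}" "{0..t}"]
  have em: "{0..t} \<in> sets lborel" "emeasure lborel {0..t} < \<infinity>" by (auto simp: emeasure_lborel_Icc_eq)
  have int1: "integrable lborel (\<lambda>r. G s r)" if G: "(\<lambda>(s, r). G s r) \<in> borel_measurable (lborel \<Otimes>\<^sub>M lborel)"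
     and bG: "\<And>s r. \<bar>G s r\<bar> \<le> b * (indicator {0..t} s * indicator {0..t} r)" for G s
  proof (rule Bochner_Integration.integrable_bound)
    show "integrable lborel (\<lambda>r. b * indicat_real {0..t} r)"
      by (intro integrable_mult_right integrable_indicator_Icc)
    show "(\<lambda>r. G s r) \<in> borel_measurable lborel"
      using measurable_compose[OF measurable_Pair1' G, of s] by simp
    have "\<bar>G s r\<bar> \<le> b * indicator {0..t} r" for r
      using bG[of s r] b(1) by (cases "s \<in> {0..t}"; cases "r \<in> {0..t}") simp_all
    then show "AE r in lborel. norm (G s r) \<le> norm (b * indicat_real {0..t} r)"
      using b(1) by (intro AE_I2) (auto simp: abs_mult)
  qed
  have "(\<integral>w. (trunc_integral w)\<^sup>2 \<partial>N) = (\<integral>s. (\<integral>r. ?U s r \<partial>lborel) + (\<integral>r. ?V s r \<partial>lborel) \<partial>lborel)"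
    unfolding second_moment_cov
  proof (rule Bochner_Integration.integral_cong[OF refl])
    fix s
    have "(\<integral>r. cov s r \<partial>lborel) = (\<integral>r. ?U s r + ?V s r \<partial>lborel)"
      by (rule Bochner_Integration.integral_cong) (auto simp: indicator_def)
    then show "(\<integral>r. cov s r \<partial>lborel) = (\<integral>r. ?U s r \<partial>lborel) + (\<integral>r. ?V s r \<partial>lborel)"
      using int1[OF U bU, of s] int1[OF V bV, of s] by simp
  qed
  also have "\<dots> = (\<integral>s. (\<integral>r. ?U s r \<partial>lborel) \<partial>lborel) + (\<integral>s. (\<integral>r. ?V s r \<partial>lborel) \<partial>lborel)"
    by (rule Bochner_Integration.integral_add[OF fb(2)[OF em em U bU] fb(2)[OF em em V bV]])
  also have "(\<integral>s. (\<integral>r. ?V s r \<partial>lborel) \<partial>lborel) = (\<integral>r. (\<integral>s. ?V s r \<partial>lborel) \<partial>lborel)"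
    by (rule fb(1)[OF em em V bV, symmetric])
  also have "\<dots> = (\<integral>s. (\<integral>r. ?U s r \<partial>lborel) \<partial>lborel)"
  proof (rule Bochner_Integration.integral_cong[OF refl])
    fix s :: real
    have m1: "(\<lambda>r. ?U s r) \<in> borel_measurable lborel"
      using measurable_compose[OF measurable_Pair1' U, of s] by simp
    have m2: "(\<lambda>r. ?V r s) \<in> borel_measurable lborel"
      using measurable_compose[OF measurable_Pair2' V, of s] by simp
    have "AE r in lborel. r \<notin> {s}"
      by (rule AE_not_in[OF countable_imp_null_set_lborel]) simp
    then show "(\<integral>r. ?V r s \<partial>lborel) = (\<integral>r. ?U s r \<partial>lborel)"
      by (intro integral_cong_AE m1 m2) (auto simp: indicator_def cov_sym elim!: eventually_mono)
  qed
  finally show ?thesis by simp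
qed

text \<open>
  On \<open>s \<le> r\<close> the covariance is the pairing of \<open>F\<^sub>s\<close> with \<open>P\<^bsub>r-s\<^esub> F\<^sub>r\<close>; the integral over \<open>r\<close> produces the
  potential.
\<close>

lemma second_moment_potential:
  "(\<integral>w. (trunc_integral w)\<^sup>2 \<partial>N) =
    2 * integral {0..t} (\<lambda>s. \<Sum>x\<in>lev J. m x * (F s x * finite_markov_chain.potential (lev J) p t F s x))"
proof -
  interpret fc: finite_markov_chain "lev J" m rate p by (rule finite_chain[OF J])
  let ?h = "\<lambda>s. \<Sum>x\<in>lev J. m x * (F s x * fc.potential t F s x)"
  have inner: "(\<integral>r. indicator {s..} r * cov s r \<partial>lborel) = indicator {0..t} s *\<^sub>R ?h s" for s
  proof (cases "s \<in> {0..t}")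
    case True
    let ?k = "\<lambda>r. \<Sum>x\<in>lev J. m x * (F s x * (\<Sum>y\<in>lev J. p (r - s) x y * F r y))"
    have cp: "continuous_on {s..t} (\<lambda>r. p (r - s) x y * F r y)" if "x \<in> lev J" "y \<in> lev J" for x y
    proof (intro continuous_on_mult)
      show "continuous_on {s..t} (\<lambda>r. p (r - s) x y)"
        by (rule continuous_on_compose2[OF fc.continuous_p[OF that]]) (auto intro!: continuous_intros)
      show "continuous_on {s..t} (\<lambda>r. F r y)"
        using contF[OF that(2)] True by (auto intro: continuous_on_subset)
    qed
    have ck: "continuous_on {s..t} ?k" by (intro continuous_on_sum continuous_on_mult continuous_on_const cp)
    have "(\<integral>r. indicator {s..} r * cov s r \<partial>lborel) = (LBINT r:{s..t}. ?k r)"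
      unfolding set_lebesgue_integral_def
    proof (rule Bochner_Integration.integral_cong[OF refl])
      fix r
      show "indicator {s..} r * cov s r = indicator {s..t} r *\<^sub>R ?k r"
        using True cov_eq[of s r] cov_zero[of s r] by (auto simp: indicator_def)
    qed
    also have "\<dots> = integral {s..t} ?k"
      by (rule set_borel_integral_eq_integral(2)[OF borel_integrable_atLeastAtMost'[OF ck]])
    also have "\<dots> = ?h s"
      unfolding fc.potential_def
    proof (rule integral_unique)
      have "((\<lambda>r. p (r - s) x y * F r y) has_integral integral {s..t} (\<lambda>r. p (r - s) x y * F r y)) {s..t}"
        if "x \<in> lev J" "y \<in> lev J" for x y
        by (rule integrable_integral[OF integrable_continuous_interval[OF cp[OF that]]])
      then show "(?k has_integral (\<Sum>x\<in>lev J. m x * (F s x * (\<Sum>y\<in>lev J. integral {s..t} (\<lambda>r. p (r - s) x y * F r y))))) {s..t}"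
        by (intro has_integral_sum has_integral_mult_right finite_levels)
    qed
    finally show ?thesis using True by simp
  next
    case False
    then have "indicator {s..} r * cov s r = 0" for r using cov_zero by simp
    then show ?thesis using False by (simp only: Bochner_Integration.integral_zero) simp
  qed
  have "continuous_on {0..t} (\<lambda>s. fc.potential t F s x)" if "x \<in> lev J" for x
    by (rule DERIV_continuous_on) (rule fc.potential_derivative[OF contF _ that])
  then have ch: "continuous_on {0..t} ?h"
    by (intro continuous_on_sum continuous_on_mult continuous_on_const contF)
  have "(\<integral>w. (trunc_integral w)\<^sup>2 \<partial>N) = 2 * (LBINT s:{0..t}. ?h s)"
    unfolding second_moment_half inner set_lebesgue_integral_def ..
  also have "(LBINT s:{0..t}. ?h s) = integral {0..t} ?h"
    by (rule set_borel_integral_eq_integral(2)[OF borel_integrable_atLeastAtMost'[OF ch]])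
  finally show ?thesis .
qed

theorem second_moment_dirichlet_bound:
  assumes a: "continuous_on {0..t} a" "\<And>s. s \<in> {0..t} \<Longrightarrow> 0 \<le> a s"
    and bound: "\<And>s g. s \<in> {0..t} \<Longrightarrow> (\<Sum>x\<in>lev J. m x * (F s x * g x))\<^sup>2 \<le>
      a s * ((\<Sum>x\<in>lev J. \<Sum>z\<in>lev J. m x * rate x z * (g z - g x)\<^sup>2) / 2)"
  shows "(\<integral>w. (trunc_integral w)\<^sup>2 \<partial>N) \<le> 2 * integral {0..t} a"
proof -
  interpret fc: finite_markov_chain "lev J" m rate p by (rule finite_chain[OF J])
  have "integral {0..t} (\<lambda>s. \<Sum>x\<in>lev J. m x * (F s x * fc.potential t F s x)) \<le> integral {0..t} a"
  proof (rule fc.kipnis_varadhan[OF t_nonneg contF a])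
    show "(\<Sum>x\<in>lev J. m x * (F s x * g x))\<^sup>2 \<le> a s * fc.dirichlet g" if "s \<in> {0..t}" for s g
      unfolding fc.dirichlet_def by (rule bound[OF that])
    show "0 \<le> fc.dirichlet g" for g
      unfolding fc.dirichlet_def
      by (intro divide_nonneg_pos sum_nonneg mult_nonneg_nonneg mu_nonneg rate_nonneg) auto
  qed (auto simp: mu_nonneg)
  then show ?thesis unfolding second_moment_potential by simp
qed

text \<open>
  Cauchy--Schwarz in time and stationarity.
\<close>

theorem second_moment_static_bound:
  assumes a: "continuous_on {0..t} a"
    and bound: "\<And>s. s \<in> {0..t} \<Longrightarrow> (\<Sum>x\<in>lev J. m x * (F s x)\<^sup>2) \<le> a s"
  shows "(\<integral>w. (trunc_integral w)\<^sup>2 \<partial>N) \<le> t * integral {0..t} a"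
proof -
  obtain b where b: "b \<ge> 0" "\<And>s w. \<bar>trunc s w\<bar> \<le> b * indicator {0..t} s" using trunc_bounded by blast
  have covd: "cov s s \<le> a s" if "s \<in> {0..t}" for s
  proof -
    have p00: "p 0 x y = of_bool (x = y)" if "x \<in> lev J" "y \<in> lev J" for x y
      using finite_chain[OF J] that unfolding finite_markov_chain_def by blast
    have "cov s s = (\<Sum>x\<in>lev J. m x * (F s x * (\<Sum>y\<in>lev J. p 0 x y * F s y)))"
      using cov_eq[of s s] that by simp
    also have "\<dots> = (\<Sum>x\<in>lev J. m x * (F s x * (\<Sum>y\<in>lev J. if x = y then F s y else 0)))"
      by (intro sum.cong refl arg_cong2[of _ _ _ _ "(*)"]) (auto simp: p00)
    also have "\<dots> = (\<Sum>x\<in>lev J. m x * (F s x)\<^sup>2)"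
      using finite_levels by (intro sum.cong refl) (simp add: power2_eq_square)
    also have "\<dots> \<le> a s" by (rule bound[OF that])
    finally show ?thesis .
  qed
  have ffsq: "\<bar>trunc s w * trunc s w\<bar> \<le> b * b * indicator {0..t} s" for s w
  proof -
    have "\<bar>trunc s w\<bar> * \<bar>trunc s w\<bar> \<le> (b * indicator {0..t} s) * (b * indicator {0..t} s)"
      using b by (intro mult_mono) auto
    then show ?thesis by (cases "s \<in> {0..t}") (simp_all add: abs_mult)
  qed
  have ffm: "(\<lambda>(s, w). trunc s w * trunc s w) \<in> borel_measurable (lborel \<Otimes>\<^sub>M N)"
    using borel_measurable_times[OF trunc_measurable trunc_measurable] by (simp add: split_def)
  have int2: "integrable lborel (\<lambda>s. trunc s w * trunc s w)" "integrable lborel (\<lambda>s. trunc s w)" if w: "w \<in> space N" for w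
  proof -
    show "integrable lborel (\<lambda>s. trunc s w * trunc s w)"
    proof (rule Bochner_Integration.integrable_bound)
      show "integrable lborel (\<lambda>r. b * b * indicat_real {0..t} r)"
        by (intro integrable_mult_right integrable_indicator_Icc)
    qed (use ffsq b trunc_section[OF w] in \<open>auto intro!: AE_I2 order_trans[OF ffsq]\<close>)
    show "integrable lborel (\<lambda>s. trunc s w)" by (rule trunc_integrable[OF w])
  qed
  have path: "(trunc_integral w)\<^sup>2 \<le> t * (\<integral>s. trunc s w * trunc s w \<partial>lborel)" if w: "w \<in> space N" for w
  proof (cases "t = 0")
    case True
    have "AE s in lborel. trunc s w = 0"
    proof -
      have "AE r in lborel. r \<notin> {0 :: real}"
        by (rule AE_not_in[OF countable_imp_null_set_lborel]) simp
      moreover have "trunc r w = 0" if "r \<notin> {0}" for r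
      proof -
        have "r \<notin> {0..t}" using that True by simp
        then show ?thesis unfolding trunc_def by simp
      qed
      ultimately show ?thesis by (auto elim: eventually_mono)
    qed
    then have "trunc_integral w = 0"
      unfolding trunc_integral_def by (rule integral_eq_zero_AE)
    then show ?thesis using True by simp
  next
    case False
    then have t: "0 < t" using t_nonneg by simp
    \<comment> \<open>the mean of the truncated observable over \<open>[0, t]\<close>; expanding the square gives its variance in time\<close>
    define c where "c = trunc_integral w / t"
    have "0 \<le> (\<integral>s. (trunc s w - c * indicator {0..t} s)\<^sup>2 \<partial>lborel)"
      by (intro Bochner_Integration.integral_nonneg) simp
    also have "(\<lambda>s. (trunc s w - c * indicator {0..t} s)\<^sup>2) =
        (\<lambda>s. trunc s w * trunc s w - (2 * c) * trunc s w + c\<^sup>2 * indicat_real {0..t} s)"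
      by (auto simp: fun_eq_iff indicator_def trunc_def power2_eq_square algebra_simps)
    also have "(\<integral>s. trunc s w * trunc s w - (2 * c) * trunc s w + c\<^sup>2 * indicat_real {0..t} s \<partial>lborel) =
        (\<integral>s. trunc s w * trunc s w \<partial>lborel) - 2 * c * trunc_integral w + c\<^sup>2 * t"
      using int2[OF w] integrable_indicator_Icc t_nonneg by (simp add: trunc_integral_def)
    finally have "0 \<le> (\<integral>s. trunc s w * trunc s w \<partial>lborel) - (trunc_integral w)\<^sup>2 / t"
      using t by (simp add: c_def power2_eq_square)
    then show ?thesis using t by (simp add: field_simps)
  qed
  have fb: "(\<integral>w. (\<integral>s. trunc s w * trunc s w \<partial>lborel) \<partial>N) = (\<integral>s. cov s s \<partial>lborel)"
    "integrable lborel (\<lambda>s. cov s s)"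
    using fubini_N[OF ffm ffsq] by (simp_all add: cov_def)
  have "(\<integral>w. (trunc_integral w)\<^sup>2 \<partial>N) \<le> (\<integral>w. t * (\<integral>s. trunc s w * trunc s w \<partial>lborel) \<partial>N)"
  proof (rule integral_mono_AE)
    show "integrable N (\<lambda>w. (trunc_integral w)\<^sup>2)" by (rule trunc_integral_sq_integrable)
    have meas: "(\<lambda>w. \<integral>s. trunc s w * trunc s w \<partial>lborel) \<in> borel_measurable N"
    proof -
      have "(\<lambda>(w, s). trunc s w * trunc s w) \<in> borel_measurable (N \<Otimes>\<^sub>M lborel)"
        using measurable_pair_swap[OF ffm] by (simp add: split_def)
      from lborel.borel_measurable_lebesgue_integral[OF this] show ?thesis by simp
    qed
    have "\<bar>\<integral>s. trunc s w * trunc s w \<partial>lborel\<bar> \<le> b * b * t" if "w \<in> space N" for w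
    proof -
      have "\<bar>\<integral>s. trunc s w * trunc s w \<partial>lborel\<bar> \<le> (\<integral>s. \<bar>trunc s w * trunc s w\<bar> \<partial>lborel)" by (rule integral_abs_bound)
      also have "\<dots> \<le> (\<integral>s. b * b * indicat_real {0..t} s \<partial>lborel)"
        using int2[OF that] integrable_indicator_Icc by (intro integral_mono ffsq) auto
      finally show ?thesis using t_nonneg by simp
    qed
    then show "integrable N (\<lambda>w. t * (\<integral>s. trunc s w * trunc s w \<partial>lborel))"
      by (intro integrable_mult_right integrable_const_bound[of _ "b * b * t"] meas) auto
  qed (use path in auto)
  also have "\<dots> = t * (\<integral>s. cov s s \<partial>lborel)" by (simp add: fb)
  also have "(\<integral>s. cov s s \<partial>lborel) \<le> (\<integral>s. indicator {0..t} s *\<^sub>R a s \<partial>lborel)"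
  proof (rule integral_mono[OF fb(2)])
    show "integrable lborel (\<lambda>s. indicator {0..t} s *\<^sub>R a s)"
      using borel_integrable_atLeastAtMost'[OF a] unfolding set_integrable_def .
    show "cov s s \<le> indicator {0..t} s *\<^sub>R a s" for s
      using covd[of s] cov_zero[of s s] by (cases "s \<in> {0..t}") auto
  qed
  also have "(\<integral>s. indicator {0..t} s *\<^sub>R a s \<partial>lborel) = integral {0..t} a"
    using set_borel_integral_eq_integral(2)[OF borel_integrable_atLeastAtMost'[OF a]]
    unfolding set_lebesgue_integral_def .
  finally show ?thesis using t_nonneg by (simp add: mult_left_mono)
qed

end

section \<open>Moment bounds on the torus\<close>

context torus_chain
begin

text \<open>
  A path that stays on the torus has bounded particle number on \<open>[0, t]\<close>, so a high truncation does not
  affect it.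
\<close>

lemma trunc_integral_eventually:
  assumes w: "w \<in> space N" "\<forall>s\<ge>0. w s \<in> S"
    and F: "\<And>M. truncated_observable \<alpha> \<rho> \<beta> L K p N {..M} t F"
  shows "\<forall>\<^sub>F M in sequentially. truncated_observable.trunc_integral K {..M} t F w = (LBINT s:{0..t}. F s (w s))"
proof -
  have "w \<in> cadlag_paths" using w(1) by (simp only: space_N)
  from cadlag_local_finite_jumps[OF this finite_torus]
  obtain b D where b: "\<And>s i. s \<in> {0..t} \<Longrightarrow> i \<in> T \<Longrightarrow> w s i \<le> b" by blast
  have tot: "total (w s) \<le> card T * b" if "s \<in> {0..t}" for s
    using sum_bounded_above[of T "w s" b] b[OF that] by simp
  show ?thesis
    unfolding eventually_sequentially
  proof (intro exI[of _ "card T * b"] allI impI)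
    fix M assume M: "card T * b \<le> M"
    show "truncated_observable.trunc_integral K {..M} t F w = (LBINT s:{0..t}. F s (w s))"
      unfolding truncated_observable.trunc_integral_def[OF F] truncated_observable.trunc_def[OF F] set_lebesgue_integral_def
    proof (rule Bochner_Integration.integral_cong[OF refl])
      fix s
      show "indicator {0..t} s * (\<Sum>\<eta>\<in>lev {..M}. F s \<eta> * of_bool (w (max 0 s) = \<eta>)) = indicator {0..t} s *\<^sub>R F s (w s)"
      proof (cases "s \<in> {0..t}")
        case True
        then have "w s \<in> lev {..M}" using w(2) tot[OF True] M by (auto simp: level_def)
        moreover have "finite (lev {..M})" by (rule finite_level) simp
        moreover have "(\<Sum>\<eta>\<in>lev {..M}. F s \<eta> * of_bool (w (max 0 s) = \<eta>)) =
            (\<Sum>\<eta>\<in>lev {..M}. if w s = \<eta> then F s \<eta> else 0)"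
          using True by (intro sum.cong) (auto simp: max_def)
        ultimately show ?thesis using True by simp
      qed simp
    qed
  qed
qed

lemma untruncate_bound:
  fixes \<phi> :: "real \<Rightarrow> real"
  assumes t: "0 \<le> t" and F: "\<And>M. truncated_observable \<alpha> \<rho> \<beta> L K p N {..M} t F"
    and \<phi>: "continuous_on UNIV \<phi>"
    and bound: "\<And>M. (\<integral>\<^sup>+w. ennreal (\<phi> (truncated_observable.trunc_integral K {..M} t F w)) \<partial>N) \<le> ennreal c"
  shows "(\<integral>\<^sup>+w. ennreal (\<phi> (LBINT s:{0..t}. F s (w s))) \<partial>N) \<le> ennreal c"
proof -
  let ?I = "\<lambda>M w. truncated_observable.trunc_integral K {..M} t F w"
  have "AE w in N. ennreal (\<phi> (LBINT s:{0..t}. F s (w s))) = liminf (\<lambda>M. ennreal (\<phi> (?I M w)))"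
    using AE_all_in_S AE_space
  proof eventually_elim
    case (elim w)
    have "\<forall>\<^sub>F M in sequentially. ennreal (\<phi> (?I M w)) = ennreal (\<phi> (LBINT s:{0..t}. F s (w s)))"
      using trunc_integral_eventually[OF elim(2) elim(1) F] by (auto elim: eventually_mono)
    then have "(\<lambda>M. ennreal (\<phi> (?I M w))) \<longlonglongrightarrow> ennreal (\<phi> (LBINT s:{0..t}. F s (w s)))"
      by (rule tendsto_eventually)
    then show ?case by (simp add: lim_imp_Liminf)
  qed
  then have "(\<integral>\<^sup>+w. ennreal (\<phi> (LBINT s:{0..t}. F s (w s))) \<partial>N) = (\<integral>\<^sup>+w. liminf (\<lambda>M. ennreal (\<phi> (?I M w))) \<partial>N)"
    by (rule nn_integral_cong_AE)
  also have "\<dots> \<le> liminf (\<lambda>M. \<integral>\<^sup>+w. ennreal (\<phi> (?I M w)) \<partial>N)"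
  proof (rule nn_integral_liminf)
    have "\<phi> \<in> borel_measurable borel" using \<phi> by (rule borel_measurable_continuous_onI)
    then show "(\<lambda>w. ennreal (\<phi> (?I M w))) \<in> borel_measurable N" for M
      using truncated_observable.trunc_integral_measurable[OF F[of M]] by measurable
  qed
  also have "\<dots> \<le> ennreal c"
    using bound by (intro Liminf_le) (auto intro!: always_eventually)
  finally show ?thesis .
qed

end

context inclusion_law
begin

lemma moment_constants_nonneg: "0 \<le> chi \<alpha> \<rho>" "0 \<le> kappa3" "0 \<le> mu4" "0 \<le> bond_moment" "0 \<le> flux_const l"
proof -
  show c: "0 \<le> chi \<alpha> \<rho>" using alpha_pos rho_pos by (simp add: chi_eq)
  show k: "0 \<le> kappa3" using c alpha_pos rho_pos by (simp add: kappa3_def)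
  show "0 \<le> mu4" using c k alpha_pos rho_pos by (simp add: mu4_def)
  show m: "0 \<le> bond_moment" using c k alpha_pos rho_pos by (simp add: bond_moment_def)
  show "0 \<le> flux_const l" using c m alpha_pos rho_pos by (simp add: flux_const_def)
qed

definition variance_const :: "nat \<Rightarrow> real \<Rightarrow> nat \<Rightarrow> real" where
  "variance_const L t l = 16 / (\<alpha>\<^sup>2 * (real L)\<^sup>2) * flux_const l + 4 * t * ((chi \<alpha> \<rho>)\<^sup>2 + mu4) / (real l)\<^sup>2"

lemma all_moments_observable:
  assumes "finite S" "{x..<x + int l} \<subseteq> S" "2 \<le> l"
  shows "all_moments (config_pmf S) (observable l x)"
proof -
  have "observable l x = (\<lambda>\<eta>. X x \<eta> * X (x + 1) \<eta> - ((avg l x \<eta>)\<^sup>2 - chi \<alpha> \<rho> / real l))"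
    by (rule ext) (rule observable_eq[OF assms(3)])
  moreover have "x \<in> S" "x + 1 \<in> S" using assms by auto
  ultimately show ?thesis
    by (simp only:) (intro all_moments_intros all_moments_coord all_moments_avg assms(1,2))
qed

text \<open>
  A crude bound whose expectation does not depend on \<open>x\<close>; it serves to make sums over \<open>x\<close> converge for a
  fixed block length.
\<close>

lemma abs_observable_le:
  assumes l: "2 \<le> l"
  shows "\<bar>observable l x \<eta>\<bar> \<le> 2 * (\<Sum>i\<in>{x..<x + int l}. (X i \<eta>)\<^sup>2) + chi \<alpha> \<rho>"
proof -
  let ?Q = "\<Sum>i\<in>{x..<x + int l}. (X i \<eta>)\<^sup>2"
  have "\<bar>X x \<eta> * X (x + 1) \<eta>\<bar> \<le> (X x \<eta>)\<^sup>2 + (X (x + 1) \<eta>)\<^sup>2"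
  proof -
    have "0 \<le> (\<bar>a\<bar> - \<bar>b\<bar>)\<^sup>2" for a b :: real by simp
    then have "2 * \<bar>a * b\<bar> \<le> a\<^sup>2 + b\<^sup>2" for a b :: real
      by (simp add: power2_diff abs_mult mult.assoc)
    moreover have "0 \<le> \<bar>X x \<eta> * X (x + 1) \<eta>\<bar>" by simp
    ultimately show ?thesis by (smt (verit))
  qed
  also have "\<dots> = (\<Sum>i\<in>{x, x + 1}. (X i \<eta>)\<^sup>2)" by simp
  also have "\<dots> \<le> ?Q" using l by (intro sum_mono2) auto
  finally have 1: "\<bar>X x \<eta> * X (x + 1) \<eta>\<bar> \<le> ?Q" .
  have "(avg l x \<eta>)\<^sup>2 \<le> (\<Sum>i\<in>{x..<x + int l}. 1\<^sup>2) * ?Q / (real l)\<^sup>2"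
    unfolding avg_def power_divide
    using Cauchy_Schwarz_ineq_sum[of "\<lambda>_. 1" "\<lambda>i. X i \<eta>" "{x..<x + int l}"]
    by (intro divide_right_mono) simp_all
  also have "\<dots> = ?Q / real l" using l by (simp add: power2_eq_square)
  also have "\<dots> \<le> ?Q"
    using l by (intro divide_le_eq[THEN iffD2]) (auto intro!: mult_left_le sum_nonneg simp: mult_le_cancel_left1 not_less)
  finally have 2: "(avg l x \<eta>)\<^sup>2 \<le> ?Q" .
  have 3: "chi \<alpha> \<rho> / real l \<le> chi \<alpha> \<rho>"
    using moment_constants_nonneg(1) l by (simp add: divide_le_eq mult_le_cancel_left1)
  have "0 \<le> chi \<alpha> \<rho> / real l" using moment_constants_nonneg(1) by simp
  moreover have "0 \<le> (avg l x \<eta>)\<^sup>2" by simp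
  ultimately show ?thesis unfolding observable_eq[OF l] using 1 2 3 by linarith
qed

definition first_moment_const :: "nat \<Rightarrow> real" where "first_moment_const l = (2 * real l + 1) * chi \<alpha> \<rho>"

lemma expectation_abs_observable:
  assumes "finite S" "{x..<x + int l} \<subseteq> S" "2 \<le> l"
  shows "EE S (\<lambda>\<eta>. \<bar>observable l x \<eta>\<bar>) \<le> first_moment_const l"
proof -
  have int: "integrable (measure_pmf (config_pmf S)) (\<lambda>\<eta>. (X i \<eta>)\<^sup>2)" if "i \<in> {x..<x + int l}" for i
    using that assms by (intro all_moments_integrable all_moments_intros all_moments_coord) auto
  have "EE S (\<lambda>\<eta>. \<bar>observable l x \<eta>\<bar>) \<le> EE S (\<lambda>\<eta>. 2 * (\<Sum>i\<in>{x..<x + int l}. (X i \<eta>)\<^sup>2) + chi \<alpha> \<rho>)"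
  proof (rule integral_mono)
    show "integrable (measure_pmf (config_pmf S)) (\<lambda>\<eta>. \<bar>observable l x \<eta>\<bar>)"
      by (intro integrable_abs all_moments_integrable all_moments_observable assms)
    show "integrable (measure_pmf (config_pmf S)) (\<lambda>\<eta>. 2 * (\<Sum>i\<in>{x..<x + int l}. (X i \<eta>)\<^sup>2) + chi \<alpha> \<rho>)"
      by (intro Bochner_Integration.integrable_add integrable_mult_right Bochner_Integration.integrable_sum int) auto
  qed (rule abs_observable_le[OF assms(3)])
  also have "\<dots> = 2 * (\<Sum>i\<in>{x..<x + int l}. EE S (\<lambda>\<eta>. (X i \<eta>)\<^sup>2)) + chi \<alpha> \<rho>"
    using int Bochner_Integration.integrable_sum[of "{x..<x + int l}" "measure_pmf (config_pmf S)" "\<lambda>i \<eta>. (X i \<eta>)\<^sup>2"]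
    by (simp add: Bochner_Integration.integral_sum)
  also have "(\<Sum>i\<in>{x..<x + int l}. EE S (\<lambda>\<eta>. (X i \<eta>)\<^sup>2)) = (\<Sum>i\<in>{x..<x + int l}. chi \<alpha> \<rho>)"
  proof (rule sum.cong[OF refl])
    fix i assume "i \<in> {x..<x + int l}"
    then show "EE S (\<lambda>\<eta>. (X i \<eta>)\<^sup>2) = chi \<alpha> \<rho>"
      using expectation_coord[of S i "\<lambda>n. xi n ^ 2"] assms by (auto simp: expectation_xi2)
  qed
  finally show ?thesis by (simp add: first_moment_const_def algebra_simps)
qed

end

context torus_chain
begin

lemma gradient_second_moment:
  assumes t: "0 \<le> t" and l: "2 \<le> l" and K: "n + l \<le> K"
    and v: "\<And>x. x \<in> sites n \<Longrightarrow> continuous_on {0..t} (\<lambda>s. v s x)"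
  shows "truncated_observable \<alpha> \<rho> \<beta> L K p N {..M} t (\<lambda>s. gradient_part n l (v s))" (is ?th1)
    and "(\<integral>w. (truncated_observable.trunc_integral K {..M} t (\<lambda>s. gradient_part n l (v s)) w)\<^sup>2 \<partial>N) \<le>
      8 / (\<alpha>\<^sup>2 * (real L)\<^sup>2) * flux_const l * integral {0..t} (\<lambda>s. \<Sum>x\<in>sites n. (v s x)\<^sup>2)" (is ?th2)
proof -
  show 1: ?th1
  proof unfold_locales
    show "continuous_on {0..t} (\<lambda>s. gradient_part n l (v s) \<eta>)" for \<eta>
      unfolding gradient_part_def flux_def by (intro continuous_intros v) auto
  qed (use t in auto)
  interpret truncated_observable \<alpha> \<rho> \<beta> L K p N "{..M}" t "\<lambda>s. gradient_part n l (v s)" by (rule 1)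
  let ?k = "4 / (\<alpha>\<^sup>2 * (real L)\<^sup>2) * flux_const l"
  let ?V = "\<lambda>s. \<Sum>x\<in>sites n. (v s x)\<^sup>2"
  have sub: "{- int n..int n + int l} \<subseteq> T" using K by (auto simp: torus_def)
  have bT: "z \<in> T \<and> z + 1 \<in> T" if "z \<in> bonds n l" for z
    using that sub by (auto simp: bonds_def)
  have V: "continuous_on {0..t} ?V" by (intro continuous_intros v)
  have V0: "0 \<le> ?V s" for s by (intro sum_nonneg) simp
  have k0: "0 \<le> ?k" using moment_constants_nonneg(5) by (intro mult_nonneg_nonneg) auto
  have "(\<integral>w. (trunc_integral w)\<^sup>2 \<partial>N) \<le> 2 * integral {0..t} (\<lambda>s. ?k * ?V s)"
  proof (rule second_moment_dirichlet_bound)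
    show "continuous_on {0..t} (\<lambda>s. ?k * ?V s)" by (intro continuous_on_mult continuous_on_const V)
    show "0 \<le> ?k * ?V s" for s by (intro mult_nonneg_nonneg k0 V0)
    fix s g
    have "(\<Sum>z\<in>bonds n l. \<Sum>\<eta>\<in>lev {..M}. m \<eta> * (W z \<eta> * (flux n l (v s) z \<eta>)\<^sup>2)) \<le>
        (\<Sum>z\<in>bonds n l. EE T (\<lambda>\<eta>. W z \<eta> * (flux n l (v s) z \<eta>)\<^sup>2))"
    proof (rule sum_mono)
      fix z assume z: "z \<in> bonds n l"
      have "all_moments (config_pmf T) (flux n l (v s) z)"
        unfolding flux_def[abs_def]
        using sub z by (intro all_moments_intros all_moments_avg all_moments_coord finite_torus)
          (auto simp: sites_def)
      then have "integrable (measure_pmf (config_pmf T)) (\<lambda>\<eta>. W z \<eta> * (flux n l (v s) z \<eta>)\<^sup>2)"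
        using bT[OF z] by (intro all_moments_integrable all_moments_mult all_moments_power all_moments_W) auto
      then show "(\<Sum>\<eta>\<in>lev {..M}. m \<eta> * (W z \<eta> * (flux n l (v s) z \<eta>)\<^sup>2)) \<le> EE T (\<lambda>\<eta>. W z \<eta> * (flux n l (v s) z \<eta>)\<^sup>2)"
        unfolding \<mu>_def by (intro sum_pmf_le_expectation finite_levels mult_nonneg_nonneg W_nonneg) auto
    qed
    also have "\<dots> \<le> flux_const l * ?V s" by (rule flux_bound[OF l finite_torus sub])
    finally have bnd: "(\<Sum>z\<in>bonds n l. \<Sum>\<eta>\<in>lev {..M}. m \<eta> * (W z \<eta> * (flux n l (v s) z \<eta>)\<^sup>2)) \<le> flux_const l * ?V s" .
    have "finite (bonds n l)" by (simp add: bonds_def)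
    from bond_sum_bound[OF J this bT flux_move bnd, of g]
    show "(\<Sum>x\<in>lev {..M}. m x * (gradient_part n l (v s) x * g x))\<^sup>2 \<le>
      ?k * ?V s * ((\<Sum>x\<in>lev {..M}. \<Sum>z\<in>lev {..M}. m x * rate x z * (g z - g x)\<^sup>2) / 2)"
      unfolding gradient_part_def by (simp only: mult.assoc)
  qed
  also have "\<dots> = 8 / (\<alpha>\<^sup>2 * (real L)\<^sup>2) * flux_const l * integral {0..t} ?V" by simp
  finally show ?th2 .
qed

lemma remainder_second_moment:
  assumes t: "0 \<le> t" and l: "2 \<le> l" and K: "n + l \<le> K"
    and v: "\<And>x. x \<in> sites n \<Longrightarrow> continuous_on {0..t} (\<lambda>s. v s x)"
  shows "truncated_observable \<alpha> \<rho> \<beta> L K p N {..M} t (\<lambda>s. remainder n l (v s))" (is ?th1)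
    and "(\<integral>w. (truncated_observable.trunc_integral K {..M} t (\<lambda>s. remainder n l (v s)) w)\<^sup>2 \<partial>N) \<le>
      2 * t * ((chi \<alpha> \<rho>)\<^sup>2 + mu4) / (real l)\<^sup>2 * integral {0..t} (\<lambda>s. \<Sum>x\<in>sites n. (v s x)\<^sup>2)" (is ?th2)
proof -
  show 1: ?th1
  proof unfold_locales
    show "continuous_on {0..t} (\<lambda>s. remainder n l (v s) \<eta>)" for \<eta>
      unfolding remainder_def by (intro continuous_on_sum continuous_on_mult continuous_on_const v)
  qed (use t in auto)
  interpret truncated_observable \<alpha> \<rho> \<beta> L K p N "{..M}" t "\<lambda>s. remainder n l (v s)" by (rule 1)
  let ?k = "2 * ((chi \<alpha> \<rho>)\<^sup>2 + mu4) / (real l)\<^sup>2"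
  let ?V = "\<lambda>s. \<Sum>x\<in>sites n. (v s x)\<^sup>2"
  have sub: "{- int n..int n + int l} \<subseteq> T" using K by (auto simp: torus_def)
  have V: "continuous_on {0..t} ?V" by (intro continuous_intros v)
  have "(\<integral>w. (trunc_integral w)\<^sup>2 \<partial>N) \<le> t * integral {0..t} (\<lambda>s. ?k * ?V s)"
  proof (rule second_moment_static_bound)
    show "continuous_on {0..t} (\<lambda>s. ?k * ?V s)" by (intro continuous_on_mult continuous_on_const V)
    fix s
    have "(\<Sum>x\<in>lev {..M}. m x * (remainder n l (v s) x)\<^sup>2) \<le> EE T (\<lambda>\<eta>. (remainder n l (v s) \<eta>)\<^sup>2)"
      unfolding \<mu>_def
      by (intro sum_pmf_le_expectation finite_levels all_moments_integrable all_moments_power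
         remainder_bound(2)[OF l finite_torus sub]) auto
    also have "\<dots> \<le> ?k * ?V s" by (rule remainder_bound(1)[OF l finite_torus sub])
    finally show "(\<Sum>x\<in>lev {..M}. m x * (remainder n l (v s) x)\<^sup>2) \<le> ?k * ?V s" .
  qed
  also have "\<dots> = 2 * t * ((chi \<alpha> \<rho>)\<^sup>2 + mu4) / (real l)\<^sup>2 * integral {0..t} ?V" by simp
  finally show ?th2 .
qed

text \<open>
  The gradient part gains from the dynamics, the remainder from its small variance.
\<close>

theorem torus_second_moment:
  assumes t: "0 \<le> t" and l: "2 \<le> l" and K: "n + l \<le> K"
    and v: "\<And>x. x \<in> sites n \<Longrightarrow> continuous_on {0..t} (\<lambda>s. v s x)"
  shows "(\<integral>\<^sup>+w. ennreal ((LBINT s:{0..t}. \<Sum>x\<in>sites n. v s x * observable l x (w s))\<^sup>2) \<partial>N) \<le>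
    ennreal (variance_const L t l * integral {0..t} (\<lambda>s. \<Sum>x\<in>sites n. (v s x)\<^sup>2))"
proof -
  let ?V = "integral {0..t} (\<lambda>s. \<Sum>x\<in>sites n. (v s x)\<^sup>2)"
  have *: "truncated_observable \<alpha> \<rho> \<beta> L K p N {..M} t (\<lambda>s \<eta>. \<Sum>x\<in>sites n. v s x * observable l x \<eta>)" for M
    by unfold_locales (use t in \<open>auto intro!: continuous_intros v\<close>)
  show ?thesis
  proof (rule untruncate_bound[OF t, of "\<lambda>s \<eta>. \<Sum>x\<in>sites n. v s x * observable l x \<eta>" "\<lambda>x. x\<^sup>2", OF *])
    show "continuous_on UNIV (\<lambda>x :: real. x\<^sup>2)" by (intro continuous_intros)
    fix M
    interpret o: truncated_observable \<alpha> \<rho> \<beta> L K p N "{..M}" t "\<lambda>s \<eta>. \<Sum>x\<in>sites n. v s x * observable l x \<eta>"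
      by (rule *)
    interpret g: truncated_observable \<alpha> \<rho> \<beta> L K p N "{..M}" t "\<lambda>s. gradient_part n l (v s)"
      by (rule gradient_second_moment(1)[OF t l K v])
    interpret r: truncated_observable \<alpha> \<rho> \<beta> L K p N "{..M}" t "\<lambda>s. remainder n l (v s)"
      by (rule remainder_second_moment(1)[OF t l K v])
    have int: "integrable lborel (\<lambda>s. g.trunc s w)" "integrable lborel (\<lambda>s. r.trunc s w)" if "w \<in> space N" for w
      using g.trunc_integrable[OF that] r.trunc_integrable[OF that] .
    have sum: "o.trunc_integral w = g.trunc_integral w + r.trunc_integral w" if "w \<in> space N" for w
    proof -
      have "o.trunc s w = g.trunc s w + r.trunc s w" for s
        unfolding o.trunc_def g.trunc_def r.trunc_def
        by (simp only: sum_observable_decomposition[OF l] ring_distribs sum.distrib)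
      then show ?thesis
        unfolding o.trunc_integral_def g.trunc_integral_def r.trunc_integral_def using int[OF that] by simp
    qed
    note sq = g.trunc_integral_sq_integrable r.trunc_integral_sq_integrable o.trunc_integral_sq_integrable
    have "(\<integral>w. (o.trunc_integral w)\<^sup>2 \<partial>N) \<le> (\<integral>w. 2 * (g.trunc_integral w)\<^sup>2 + 2 * (r.trunc_integral w)\<^sup>2 \<partial>N)"
      using sq by (intro integral_mono) (auto simp: sum square_add_le)
    also have "\<dots> = 2 * (\<integral>w. (g.trunc_integral w)\<^sup>2 \<partial>N) + 2 * (\<integral>w. (r.trunc_integral w)\<^sup>2 \<partial>N)"
      using sq by simp
    also have "\<dots> \<le> 2 * (8 / (\<alpha>\<^sup>2 * (real L)\<^sup>2) * flux_const l * ?V) + 2 * (2 * t * ((chi \<alpha> \<rho>)\<^sup>2 + mu4) / (real l)\<^sup>2 * ?V)"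
      by (intro add_mono mult_left_mono gradient_second_moment(2) remainder_second_moment(2) t l K v) auto
    also have "\<dots> = variance_const L t l * ?V" by (simp add: variance_const_def algebra_simps)
    finally have le: "(\<integral>w. (o.trunc_integral w)\<^sup>2 \<partial>N) \<le> variance_const L t l * ?V" .
    show "(\<integral>\<^sup>+w. ennreal ((o.trunc_integral w)\<^sup>2) \<partial>N) \<le> ennreal (variance_const L t l * ?V)"
      using le by (subst nn_integral_eq_integral[OF sq(3)]) (auto intro: ennreal_leI)
  qed
qed

theorem torus_first_moment:
  assumes t: "0 \<le> t" and l: "2 \<le> l" and K: "n + l \<le> K"
    and v: "\<And>x. x \<in> sites n \<Longrightarrow> continuous_on {0..t} (\<lambda>s. v s x)"
  shows "(\<integral>\<^sup>+w. ennreal \<bar>LBINT s:{0..t}. \<Sum>x\<in>sites n. \<bar>v s x\<bar> * \<bar>observable l x (w s)\<bar>\<bar> \<partial>N) \<le>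
    ennreal (first_moment_const l * integral {0..t} (\<lambda>s. \<Sum>x\<in>sites n. \<bar>v s x\<bar>))"
proof -
  let ?F = "\<lambda>s \<eta>. \<Sum>x\<in>sites n. \<bar>v s x\<bar> * \<bar>observable l x \<eta>\<bar>"
  let ?V = "\<lambda>s. \<Sum>x\<in>sites n. \<bar>v s x\<bar>"
  have *: "truncated_observable \<alpha> \<rho> \<beta> L K p N {..M} t ?F" for M
    by unfold_locales (use t in \<open>auto intro!: continuous_intros v\<close>)
  have sub: "{x..<x + int l} \<subseteq> T" if "x \<in> sites n" for x
    using that K by (auto simp: torus_def sites_def)
  have V: "continuous_on {0..t} ?V" by (intro continuous_intros v)
  show ?thesis
  proof (rule untruncate_bound[OF t, of ?F "\<lambda>x. \<bar>x\<bar>", OF *])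
    show "continuous_on UNIV (\<lambda>x :: real. \<bar>x\<bar>)" by (intro continuous_intros)
    fix M
    interpret o: truncated_observable \<alpha> \<rho> \<beta> L K p N "{..M}" t ?F by (rule *)
    have pos: "0 \<le> o.trunc_integral w" for w
      unfolding o.trunc_integral_def o.trunc_def
      by (intro Bochner_Integration.integral_nonneg mult_nonneg_nonneg sum_nonneg) auto
    have int: "integrable N o.trunc_integral" by (rule o.trunc_integral_integrable)
    have "(\<integral>w. o.trunc_integral w \<partial>N) = (\<integral>s. indicator {0..t} s *\<^sub>R (\<Sum>\<eta>\<in>lev {..M}. m \<eta> * ?F s \<eta>) \<partial>lborel)"
      by (rule o.first_moment)
    also have "\<dots> \<le> (\<integral>s. indicator {0..t} s *\<^sub>R (first_moment_const l * ?V s) \<partial>lborel)"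
    proof (rule integral_mono)
      have "continuous_on {0..t} (\<lambda>s. \<Sum>\<eta>\<in>lev {..M}. m \<eta> * ?F s \<eta>)" by (intro continuous_intros v)
      then show "integrable lborel (\<lambda>s. indicator {0..t} s *\<^sub>R (\<Sum>\<eta>\<in>lev {..M}. m \<eta> * ?F s \<eta>))"
        using borel_integrable_atLeastAtMost' unfolding set_integrable_def by blast
      have "continuous_on {0..t} (\<lambda>s. first_moment_const l * ?V s)" by (intro continuous_on_mult continuous_on_const V)
      then show "integrable lborel (\<lambda>s. indicator {0..t} s *\<^sub>R (first_moment_const l * ?V s))"
        using borel_integrable_atLeastAtMost' unfolding set_integrable_def by blast
      fix s
      have "(\<Sum>\<eta>\<in>lev {..M}. m \<eta> * ?F s \<eta>) = (\<Sum>x\<in>sites n. \<bar>v s x\<bar> * (\<Sum>\<eta>\<in>lev {..M}. m \<eta> * \<bar>observable l x \<eta>\<bar>))"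
        unfolding sum_distrib_left by (subst sum.swap) (simp only: mult.left_commute)
      also have "\<dots> \<le> (\<Sum>x\<in>sites n. \<bar>v s x\<bar> * first_moment_const l)"
      proof (intro sum_mono mult_left_mono)
        fix x assume x: "x \<in> sites n"
        have "(\<Sum>\<eta>\<in>lev {..M}. m \<eta> * \<bar>observable l x \<eta>\<bar>) \<le> EE T (\<lambda>\<eta>. \<bar>observable l x \<eta>\<bar>)"
          unfolding \<mu>_def using all_moments_integrable[OF all_moments_observable[OF finite_torus sub[OF x] l]]
          by (intro sum_pmf_le_expectation o.finite_levels) auto
        also have "\<dots> \<le> first_moment_const l" by (rule expectation_abs_observable[OF finite_torus sub[OF x] l])
        finally show "(\<Sum>\<eta>\<in>lev {..M}. m \<eta> * \<bar>observable l x \<eta>\<bar>) \<le> first_moment_const l" .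
      qed simp
      also have "\<dots> = first_moment_const l * ?V s" by (simp add: sum_distrib_left mult.commute)
      finally show "indicator {0..t} s *\<^sub>R (\<Sum>\<eta>\<in>lev {..M}. m \<eta> * ?F s \<eta>) \<le> indicator {0..t} s *\<^sub>R (first_moment_const l * ?V s)"
        by (intro scaleR_left_mono) auto
    qed
    also have "\<dots> = integral {0..t} (\<lambda>s. first_moment_const l * ?V s)"
    proof -
      have "continuous_on {0..t} (\<lambda>s. first_moment_const l * ?V s)" by (intro continuous_on_mult continuous_on_const V)
      from set_borel_integral_eq_integral(2)[OF borel_integrable_atLeastAtMost'[OF this]] show ?thesis
        unfolding set_lebesgue_integral_def .
    qed
    also have "\<dots> = first_moment_const l * integral {0..t} ?V" by simp
    finally have le: "(\<integral>w. o.trunc_integral w \<partial>N) \<le> first_moment_const l * integral {0..t} ?V" .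
    show "(\<integral>\<^sup>+w. ennreal \<bar>o.trunc_integral w\<bar> \<partial>N) \<le> ennreal (first_moment_const l * integral {0..t} ?V)"
      using le pos by (simp add: nn_integral_eq_integral[OF int] ennreal_leI)
  qed
qed

end

section \<open>The infinite-volume limit\<close>

definition periodic_path :: "nat \<Rightarrow> (real \<Rightarrow> config) \<Rightarrow> real \<Rightarrow> config" where
  "periodic_path K w = (\<lambda>t\<in>{0..}. periodize K (w t))"

lemma continuous_periodize: "continuous_on UNIV (periodize K)"
  unfolding periodize_def[abs_def]
  by (intro continuous_on_coordinatewise_then_product continuous_on_product_coordinates)

lemma tendsto_periodize: "(w \<longlongrightarrow> l) F \<Longrightarrow> ((\<lambda>r. periodize K (w r)) \<longlongrightarrow> periodize K l) F"
  by (rule continuous_on_tendsto_compose[OF continuous_periodize]) auto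

lemma periodic_path_cadlag:
  assumes w: "w \<in> cadlag_paths" shows "periodic_path K w \<in> cadlag_paths"
proof -
  have "(periodic_path K w \<longlongrightarrow> periodic_path K w t) (at_right t)" if t: "0 \<le> t" for t
  proof -
    have "((\<lambda>r. periodize K (w r)) \<longlongrightarrow> periodize K (w t)) (at_right t)"
      by (rule tendsto_periodize[OF cadlag_right[OF w t]])
    moreover have "\<forall>\<^sub>F r in at_right t. periodize K (w r) = periodic_path K w r"
      unfolding eventually_at_right_field periodic_path_def using t by (intro exI[of _ "t + 1"]) auto
    ultimately have "(periodic_path K w \<longlongrightarrow> periodize K (w t)) (at_right t)"
      by (rule Lim_transform_eventually)
    then show ?thesis using t by (simp add: periodic_path_def)
  qed
  moreover have "\<exists>l. (periodic_path K w \<longlongrightarrow> l) (at_left t)" if t: "0 < t" for t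
  proof -
    obtain l where "(w \<longlongrightarrow> l) (at_left t)" using w t unfolding cadlag_paths_def by blast
    then have "((\<lambda>r. periodize K (w r)) \<longlongrightarrow> periodize K l) (at_left t)" by (rule tendsto_periodize)
    moreover have "\<forall>\<^sub>F r in at_left t. periodize K (w r) = periodic_path K w r"
      unfolding eventually_at_left_field periodic_path_def using t by (intro exI[of _ 0]) auto
    ultimately have "(periodic_path K w \<longlongrightarrow> periodize K l) (at_left t)"
      by (rule Lim_transform_eventually)
    then show ?thesis by blast
  qed
  ultimately show ?thesis unfolding cadlag_paths_def by (auto simp: periodic_path_def)
qed

lemma measurable_periodic_path: "periodic_path K \<in> path_space \<rightarrow>\<^sub>M path_space"
proof -
  have "periodic_path K \<in> path_space \<rightarrow>\<^sub>M restrict_space (Pi\<^sub>M {0..} (\<lambda>_. borel)) cadlag_paths"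
  proof (rule measurable_restrict_space2)
    show "periodic_path K \<in> space path_space \<rightarrow> cadlag_paths" by (auto intro: periodic_path_cadlag)
    have "periodize K \<in> borel_measurable borel"
      by (rule borel_measurable_continuous_onI[OF continuous_periodize])
    then show "periodic_path K \<in> path_space \<rightarrow>\<^sub>M Pi\<^sub>M {0..} (\<lambda>_. borel)"
      unfolding periodic_path_def[abs_def]
      by (intro measurable_restrict measurable_compose[OF measurable_path_eval]) auto
  qed
  then show ?thesis by (simp only: path_space_def)
qed

text \<open>
  On a torus that contains \<open>Z\<close> the periodic extension does not change the observable.
\<close>

lemma (in local_observable) limit_law_bound:
  fixes \<phi> :: "real \<Rightarrow> real"
  assumes lim: "limit_law \<alpha> \<beta> \<rho> L P"
    and par: "0 < \<alpha>" "0 < \<rho>" "0 < \<beta>" "\<beta>\<^sup>2 \<le> real L"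
    and \<phi>: "continuous_on UNIV \<phi>" "\<And>x. 0 \<le> \<phi> x" and c: "0 \<le> c"
    and Z: "\<And>K. K0 \<le> K \<Longrightarrow> Z \<subseteq> torus K"
    and bound: "\<And>K p N. torus_chain \<alpha> \<rho> \<beta> L K p N \<Longrightarrow> K0 \<le> K \<Longrightarrow>
      (\<integral>\<^sup>+w. ennreal (\<phi> (I w)) \<partial>N) \<le> ennreal c"
  shows "(\<integral>\<^sup>+w. ennreal (\<phi> (I w)) \<partial>P) \<le> ennreal c"
proof -
  have P: "prob_space P" "sets P = sets path_space" using lim by (simp_all add: limit_law_def)
  obtain N where N: "\<And>K. 1 \<le> K \<Longrightarrow> markov_chain_law (torus_configs K) (torus_rate \<alpha> \<beta> L K) (torus_measure \<alpha> \<rho> K) (N K)"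
    and weak: "skorokhod_weakly_converges (\<lambda>K. periodize_law K (N K)) P"
    using lim unfolding limit_law_def by blast
  have chain: "\<exists>p. torus_chain \<alpha> \<rho> \<beta> L K p (N K)" if K: "1 \<le> K" for K
  proof -
    from N[OF K] obtain p where p: "prob_space (N K)" "sets (N K) = sets path_space"
      "markov_transition_function (torus_configs K) (torus_rate \<alpha> \<beta> L K) p"
      "\<And>n (t :: nat \<Rightarrow> real) x. t 0 = 0 \<and> (\<forall>i<n. t i \<le> t (Suc i)) \<and> (\<forall>i\<le>n. x i \<in> torus_configs K) \<Longrightarrow>
           measure (N K) {w \<in> space (N K). \<forall>i\<le>n. w (t i) = x i} =
             measure (torus_measure \<alpha> \<rho> K) {x 0} * (\<Prod>i<n. p (t (Suc i) - t i) (x i) (x (Suc i)))"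
      unfolding markov_chain_law_def by (elim conjE exE) (rule that, assumption+, blast)
    have "torus_chain \<alpha> \<rho> \<beta> L K p (N K)"
    proof (intro torus_chain.intro torus_process.intro inclusion_law.intro torus_process_axioms.intro
        torus_chain_axioms.intro)
      show "measure (N K) {w \<in> space (N K). \<forall>i\<le>n. w (t i) = x i} =
             measure (torus_measure \<alpha> \<rho> K) {x 0} * (\<Prod>i<n. p (t (Suc i) - t i) (x i) (x (Suc i)))"
        if "t 0 = 0" "\<And>i. i < n \<Longrightarrow> t i \<le> t (Suc i)" "\<And>i. i \<le> n \<Longrightarrow> x i \<in> torus_configs K"
        for n x and t :: "nat \<Rightarrow> real"
        by (rule p(4)) (use that in blast)
    qed (use par K p in auto)
    from exI[where P = "\<lambda>p. torus_chain \<alpha> \<rho> \<beta> L K p (N K)", OF this] show ?thesis .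
  qed
  have meas: "periodic_path K \<in> N K \<rightarrow>\<^sub>M path_space" if "1 \<le> K" for K
  proof -
    have "sets (N K) = sets path_space" using N[OF that] by (simp add: markov_chain_law_def)
    then show ?thesis using measurable_periodic_path measurable_cong_sets by blast
  qed
  have law: "periodize_law K (N K) = distr (N K) path_space (periodic_path K)" for K
    unfolding periodize_law_def periodic_path_def[abs_def] ..
  show ?thesis
  proof (rule weak_limit_bound[OF weak P _ _ \<phi> _ c, where ?K0.0 = "max K0 1"])
    fix K assume "max K0 1 \<le> K"
    then have K: "K0 \<le> K" "1 \<le> K" by auto
    show "prob_space (periodize_law K (N K))"
      unfolding law using N[OF K(2)] meas[OF K(2)]
      by (intro prob_space.prob_space_distr) (auto simp: markov_chain_law_def)
    show "sets (periodize_law K (N K)) = sets path_space" unfolding law by simp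
    obtain p where p: "torus_chain \<alpha> \<rho> \<beta> L K p (N K)" using chain[OF K(2)] by (rule exE)
    have "\<phi> \<in> borel_measurable borel" using \<phi>(1) by (rule borel_measurable_continuous_onI)
    then have "(\<lambda>w. ennreal (\<phi> (I w))) \<in> borel_measurable path_space"
      using measurable_I by measurable
    then have "(\<integral>\<^sup>+w. ennreal (\<phi> (I w)) \<partial>periodize_law K (N K)) =
        (\<integral>\<^sup>+w. ennreal (\<phi> (I (periodic_path K w))) \<partial>N K)"
      unfolding law using meas[OF K(2)] by (intro nn_integral_distr) auto
    also have "I (periodic_path K w) = I w" for w
      unfolding I_def set_lebesgue_integral_def
    proof (rule Bochner_Integration.integral_cong[OF refl])
      fix s
      have "H s (periodize K (w s)) = H s (w s)"
        using Z[OF K(1)] by (intro H_local) (auto simp: periodize_def torus_rep_id)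
      then show "indicator {0..t} s *\<^sub>R H s (periodic_path K w s) = indicator {0..t} s *\<^sub>R H s (w s)"
        by (cases "s \<in> {0..t}") (auto simp: periodic_path_def)
    qed
    then have "(\<integral>\<^sup>+w. ennreal (\<phi> (I (periodic_path K w))) \<partial>N K) = (\<integral>\<^sup>+w. ennreal (\<phi> (I w)) \<partial>N K)"
      by simp
    also have "\<dots> \<le> ennreal c" by (rule bound[OF p K(1)])
    finally show "(\<integral>\<^sup>+w. ennreal (\<phi> (I w)) \<partial>periodize_law K (N K)) \<le> ennreal c" .
  qed
qed

lemma ell1_add: "u \<in> ell1 \<Longrightarrow> u' \<in> ell1 \<Longrightarrow> (\<lambda>x. u x + u' x) \<in> ell1"
  unfolding ell1_def mem_Collect_eq
  by (rule summable_on_comparison_test[of "\<lambda>x. \<bar>u x\<bar> + \<bar>u' x\<bar>"]) (auto intro: summable_on_add)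

lemma ell1_scale: "u \<in> ell1 \<Longrightarrow> (\<lambda>x. c * u x) \<in> ell1"
  unfolding ell1_def mem_Collect_eq abs_mult by (rule summable_on_cmult_right)

lemma ell1_diff: "u \<in> ell1 \<Longrightarrow> u' \<in> ell1 \<Longrightarrow> (\<lambda>x. u x - u' x) \<in> ell1"
  using ell1_add[of u "\<lambda>x. -1 * u' x"] ell1_scale[of u' "-1"] by simp

lemma ell1_norm_add_le:
  assumes "u \<in> ell1" "u' \<in> ell1"
  shows "ell1_norm (\<lambda>x. u x + u' x) \<le> ell1_norm u + ell1_norm u'"
proof -
  have "ell1_norm (\<lambda>x. u x + u' x) \<le> (\<Sum>\<^sub>\<infinity>x. \<bar>u x\<bar> + \<bar>u' x\<bar>)"
    unfolding ell1_norm_def using ell1_add[OF assms] assms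
    by (intro infsum_mono summable_on_add) (auto simp: ell1_def)
  also have "\<dots> = ell1_norm u + ell1_norm u'"
    unfolding ell1_norm_def using assms by (intro infsum_add) (auto simp: ell1_def)
  finally show ?thesis .
qed

lemma ell1_norm_scale: "ell1_norm (\<lambda>x. c * u x) = \<bar>c\<bar> * ell1_norm u"
  unfolding ell1_norm_def abs_mult by (rule infsum_cmult_right')

lemma ell1_norm_nonneg: "0 \<le> ell1_norm u"
  unfolding ell1_norm_def by (rule infsum_nonneg) simp

lemma sum_abs_le_ell1_norm: "u \<in> ell1 \<Longrightarrow> finite A \<Longrightarrow> (\<Sum>x\<in>A. \<bar>u x\<bar>) \<le> ell1_norm u"
  unfolding ell1_norm_def ell1_def by (intro finite_sum_le_infsum) auto

lemma abs_le_ell1_norm: "u \<in> ell1 \<Longrightarrow> \<bar>u x\<bar> \<le> ell1_norm u"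
  using sum_abs_le_ell1_norm[of u "{x}"] by simp

text \<open>
  Differentiability in \<open>\<ell>\<^sup>1\<close> implies continuity: the increment is \<open>r - s\<close> times a difference quotient whose
  norm stays bounded.
\<close>

lemma has_ell1_derivative_tendsto:
  assumes u: "\<And>r. r \<in> S \<Longrightarrow> u r \<in> ell1" and u': "u' \<in> ell1" and s: "s \<in> S"
    and D: "has_ell1_derivative u u' s S"
  shows "((\<lambda>r. ell1_norm (\<lambda>x. u r x - u s x)) \<longlongrightarrow> 0) (at s within S)"
proof (rule Lim_null_comparison)
  let ?q = "\<lambda>r x. (u r x - u s x) / (r - s) - u' x"
  show "((\<lambda>r. \<bar>r - s\<bar> * (ell1_norm (?q r) + ell1_norm u')) \<longlongrightarrow> 0) (at s within S)"
  proof -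
    have "((\<lambda>r. \<bar>r - s\<bar> * (ell1_norm (?q r) + ell1_norm u')) \<longlongrightarrow> \<bar>s - s\<bar> * (0 + ell1_norm u')) (at s within S)"
      using D unfolding has_ell1_derivative_def by (intro tendsto_intros)
    then show ?thesis by simp
  qed
  show "\<forall>\<^sub>F r in at s within S. norm (ell1_norm (\<lambda>x. u r x - u s x)) \<le> \<bar>r - s\<bar> * (ell1_norm (?q r) + ell1_norm u')"
    unfolding eventually_at_filter
  proof (intro always_eventually allI impI)
    fix r assume r: "r \<noteq> s" "r \<in> S"
    have q: "?q r \<in> ell1"
    proof -
      have "(\<lambda>x. (1 / (r - s)) * (u r x - u s x)) \<in> ell1"
        by (intro ell1_scale ell1_diff u r s)
      then have "(\<lambda>x. (1 / (r - s)) * (u r x - u s x) - u' x) \<in> ell1" by (rule ell1_diff[OF _ u'])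
      then show ?thesis by simp
    qed
    have "(\<lambda>x. u r x - u s x) = (\<lambda>x. (r - s) * (?q r x + u' x))" using r by simp
    then have "ell1_norm (\<lambda>x. u r x - u s x) = \<bar>r - s\<bar> * ell1_norm (\<lambda>x. ?q r x + u' x)"
      by (simp only: ell1_norm_scale)
    also have "\<dots> \<le> \<bar>r - s\<bar> * (ell1_norm (?q r) + ell1_norm u')"
      by (intro mult_left_mono ell1_norm_add_le q u') simp
    finally show "norm (ell1_norm (\<lambda>x. u r x - u s x)) \<le> \<bar>r - s\<bar> * (ell1_norm (?q r) + ell1_norm u')"
      using ell1_norm_nonneg by simp
  qed
qed

lemma smooth_ell1_facts:
  assumes "smooth_ell1 T v"
  shows smooth_ell1_in: "\<And>s. s \<in> {0..T} \<Longrightarrow> v s \<in> ell1"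
    and smooth_ell1_coord: "\<And>x. continuous_on {0..T} (\<lambda>s. v s x)"
    and smooth_ell1_norm: "continuous_on {0..T} (\<lambda>s. ell1_norm (v s))"
proof -
  obtain D where D: "\<And>s. s \<in> {0..T} \<Longrightarrow> D 0 s = v s"
    "\<And>k s. s \<in> {0..T} \<Longrightarrow> D k s \<in> ell1 \<and> has_ell1_derivative (D k) (D (Suc k) s) s {0..T}"
    using assms unfolding smooth_ell1_def by blast
  show v: "v s \<in> ell1" if "s \<in> {0..T}" for s
    using D(1)[OF that] D(2)[OF that, of 0] by simp
  have lim: "((\<lambda>r. ell1_norm (\<lambda>x. v r x - v s x)) \<longlongrightarrow> 0) (at s within {0..T})" if s: "s \<in> {0..T}" for s
  proof -
    have "((\<lambda>r. ell1_norm (\<lambda>x. D 0 r x - D 0 s x)) \<longlongrightarrow> 0) (at s within {0..T})"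
      using D(2) s by (intro has_ell1_derivative_tendsto[of _ _ "D (Suc 0) s"]) auto
    moreover have "\<forall>\<^sub>F r in at s within {0..T}. ell1_norm (\<lambda>x. D 0 r x - D 0 s x) = ell1_norm (\<lambda>x. v r x - v s x)"
      unfolding eventually_at_filter using D(1) s by (auto intro!: always_eventually)
    ultimately show ?thesis by (rule Lim_transform_eventually)
  qed
  show "continuous_on {0..T} (\<lambda>s. v s x)" for x
    unfolding continuous_on_def
  proof
    fix s assume s: "s \<in> {0..T}"
    have "((\<lambda>r. v r x - v s x) \<longlongrightarrow> 0) (at s within {0..T})"
    proof (rule Lim_null_comparison[OF _ lim[OF s]])
      show "\<forall>\<^sub>F r in at s within {0..T}. norm (v r x - v s x) \<le> ell1_norm (\<lambda>x. v r x - v s x)"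
        unfolding eventually_at_filter
        using abs_le_ell1_norm[OF ell1_diff[OF v v[OF s]]] by (auto intro!: always_eventually)
    qed
    then show "((\<lambda>s. v s x) \<longlongrightarrow> v s x) (at s within {0..T})" by (simp add: LIM_zero_iff)
  qed
  show "continuous_on {0..T} (\<lambda>s. ell1_norm (v s))"
    unfolding continuous_on_def
  proof
    fix s assume s: "s \<in> {0..T}"
    have "((\<lambda>r. ell1_norm (v r) - ell1_norm (v s)) \<longlongrightarrow> 0) (at s within {0..T})"
    proof (rule Lim_null_comparison[OF _ lim[OF s]])
      show "\<forall>\<^sub>F r in at s within {0..T}. norm (ell1_norm (v r) - ell1_norm (v s)) \<le> ell1_norm (\<lambda>x. v r x - v s x)"
        unfolding eventually_at_filter
      proof (intro always_eventually allI impI)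
        fix r assume r: "r \<in> {0..T}"
        note d = ell1_diff[OF v[OF r] v[OF s]]
        have "ell1_norm (v r) \<le> ell1_norm (\<lambda>x. v r x - v s x) + ell1_norm (v s)"
          using ell1_norm_add_le[OF d v[OF s]] by simp
        moreover have "ell1_norm (v s) \<le> ell1_norm (\<lambda>x. -1 * (v r x - v s x)) + ell1_norm (v r)"
          using ell1_norm_add_le[OF ell1_scale[OF d, of "-1"] v[OF r]] by simp
        moreover have "ell1_norm (\<lambda>x. -1 * (v r x - v s x)) = ell1_norm (\<lambda>x. v r x - v s x)"
          by (subst ell1_norm_scale) simp
        ultimately show "norm (ell1_norm (v r) - ell1_norm (v s)) \<le> ell1_norm (\<lambda>x. v r x - v s x)"
          by simp
      qed
    qed
    then show "((\<lambda>s. ell1_norm (v s)) \<longlongrightarrow> ell1_norm (v s)) (at s within {0..T})" by (simp add: LIM_zero_iff)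
  qed
qed

lemma ell1_square_summable:
  assumes "u \<in> ell1"
  shows "(\<lambda>x. (u x)\<^sup>2) summable_on UNIV" and "(ell2_norm u)\<^sup>2 = (\<Sum>\<^sub>\<infinity>x. (u x)\<^sup>2)"
    and "(ell2_norm u)\<^sup>2 \<le> (ell1_norm u)\<^sup>2"
proof -
  have s: "(\<lambda>x. ell1_norm u * \<bar>u x\<bar>) summable_on UNIV"
    using assms by (intro summable_on_cmult_right) (auto simp: ell1_def)
  have le: "(u x)\<^sup>2 \<le> ell1_norm u * \<bar>u x\<bar>" for x
    using mult_right_mono[OF abs_le_ell1_norm[OF assms, of x], of "\<bar>u x\<bar>"] by (simp add: power2_eq_square)
  show sq: "(\<lambda>x. (u x)\<^sup>2) summable_on UNIV"
    by (rule summable_on_comparison_test[OF s]) (use le in auto)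
  show e: "(ell2_norm u)\<^sup>2 = (\<Sum>\<^sub>\<infinity>x. (u x)\<^sup>2)"
    unfolding ell2_norm_def by (simp add: infsum_nonneg)
  have "(\<Sum>\<^sub>\<infinity>x. (u x)\<^sup>2) \<le> (\<Sum>\<^sub>\<infinity>x. ell1_norm u * \<bar>u x\<bar>)" by (intro infsum_mono sq s le)
  also have "\<dots> = (ell1_norm u)\<^sup>2"
    by (simp add: infsum_cmult_right' power2_eq_square ell1_norm_def)
  finally show "(ell2_norm u)\<^sup>2 \<le> (ell1_norm u)\<^sup>2" using e by simp
qed

context inclusion_law
begin

lemma sites_exhaust: "filterlim sites (finite_subsets_at_top UNIV) sequentially"
  unfolding filterlim_finite_subsets_at_top
proof (intro allI impI)
  fix A :: "int set" assume A: "finite A \<and> A \<subseteq> UNIV"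
  define k where "k = Max (insert 0 ((\<lambda>x. nat \<bar>x\<bar>) ` A))"
  have k: "nat \<bar>x\<bar> \<le> k" if "x \<in> A" for x unfolding k_def using A that by (intro Max_ge) auto
  have "A \<subseteq> sites n" if n: "k \<le> n" for n
  proof
    fix x assume "x \<in> A"
    then have "\<bar>x\<bar> \<le> int n" using k[of x] n by linarith
    then show "x \<in> sites n" by (auto simp: sites_def)
  qed
  then show "\<forall>\<^sub>F n in sequentially. finite (sites n) \<and> A \<subseteq> sites n \<and> sites n \<subseteq> UNIV"
    unfolding eventually_sequentially by (auto simp: sites_def)
qed

lemma sum_sites_tendsto:
  fixes f :: "int \<Rightarrow> real"
  assumes "f summable_on UNIV" shows "(\<lambda>n. \<Sum>x\<in>sites n. f x) \<longlonglongrightarrow> (\<Sum>\<^sub>\<infinity>x. f x)"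
  using has_sum_infsum[OF assms] filterlim_compose[OF _ sites_exhaust] unfolding has_sum_def by blast

text \<open>
  Monotone convergence makes the series of absolute values finite for almost every \<open>s\<close> and its sum an
  integrable majorant. Where the series does not converge absolutely, the infinite sum has the default value
  zero; this is why multiplying the partial sums by the indicator of the set of convergence yields a sequence
  that converges everywhere, so that the infinite sum is measurable.
\<close>

lemma integral_series_tendsto:
  fixes b :: "int \<Rightarrow> real \<Rightarrow> real"
  assumes b: "\<And>x. b x \<in> borel_measurable lborel"
    and fin: "(SUP n. \<integral>\<^sup>+s. ennreal (\<Sum>x\<in>sites n. \<bar>b x s\<bar>) \<partial>lborel) < \<infinity>"
  shows "(\<lambda>n. \<integral>s. (\<Sum>x\<in>sites n. b x s) \<partial>lborel) \<longlonglongrightarrow> (\<integral>s. (\<Sum>\<^sub>\<infinity>x. b x s) \<partial>lborel)"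
proof -
  define G where "G s = (SUP n. ennreal (\<Sum>x\<in>sites n. \<bar>b x s\<bar>))" for s
  have sites_mono: "sites n \<subseteq> sites (Suc n)" "finite (sites n)" for n by (auto simp: sites_def)
  have inc: "incseq (\<lambda>n s. ennreal (\<Sum>x\<in>sites n. \<bar>b x s\<bar>))"
    by (intro incseq_SucI le_funI ennreal_leI sum_mono2 sites_mono) auto
  have m: "(\<lambda>s. ennreal (\<Sum>x\<in>sites n. \<bar>b x s\<bar>)) \<in> borel_measurable lborel" for n
    using b by measurable
  have Gm: "G \<in> borel_measurable lborel" unfolding G_def[abs_def] by (intro borel_measurable_SUP m) auto
  have "(\<integral>\<^sup>+s. G s \<partial>lborel) = (SUP n. \<integral>\<^sup>+s. ennreal (\<Sum>x\<in>sites n. \<bar>b x s\<bar>) \<partial>lborel)"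
    unfolding G_def by (rule nn_integral_monotone_convergence_SUP[OF inc m])
  then have Gint: "(\<integral>\<^sup>+s. G s \<partial>lborel) \<noteq> \<infinity>" using fin by (metis less_irrefl)
  have le: "(\<Sum>x\<in>sites n. \<bar>b x s\<bar>) \<le> enn2real (G s)" if "G s < \<infinity>" for n s
  proof -
    have "ennreal (\<Sum>x\<in>sites n. \<bar>b x s\<bar>) \<le> G s" unfolding G_def by (rule SUP_upper) simp
    also have "\<dots> = ennreal (enn2real (G s))" using that by simp
    finally show ?thesis by (simp add: ennreal_le_iff)
  qed
  have summable: "(\<lambda>x. b x s) summable_on UNIV" if G: "G s < \<infinity>" for s
  proof -
    have "(\<lambda>x. \<bar>b x s\<bar>) summable_on UNIV"
    proof (rule nonneg_bdd_above_summable_on)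
      show "bdd_above (sum (\<lambda>x. \<bar>b x s\<bar>) ` {F. F \<subseteq> UNIV \<and> finite F})"
      proof (rule bdd_aboveI2)
        fix A :: "int set" assume "A \<in> {F. F \<subseteq> UNIV \<and> finite F}"
        then have "\<forall>\<^sub>F n in sequentially. finite (sites n) \<and> A \<subseteq> sites n \<and> sites n \<subseteq> UNIV"
          using sites_exhaust unfolding filterlim_finite_subsets_at_top by blast
        then have "\<forall>\<^sub>F n in sequentially. A \<subseteq> sites n" by (rule eventually_mono) blast
        then obtain n where "A \<subseteq> sites n" by (auto simp: eventually_sequentially)
        then have "(\<Sum>x\<in>A. \<bar>b x s\<bar>) \<le> (\<Sum>x\<in>sites n. \<bar>b x s\<bar>)"
          by (intro sum_mono2 sites_mono) auto
        also have "\<dots> \<le> enn2real (G s)" by (rule le[OF G])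
        finally show "(\<Sum>x\<in>A. \<bar>b x s\<bar>) \<le> enn2real (G s)" .
      qed
    qed simp
    then show ?thesis by (subst summable_on_iff_abs_summable_on_real) simp
  qed
  have not_summable: "\<not> (\<lambda>x. b x s) summable_on UNIV" if G: "\<not> G s < \<infinity>" for s
  proof
    assume "(\<lambda>x. b x s) summable_on UNIV"
    then have "(\<lambda>x. \<bar>b x s\<bar>) summable_on UNIV" by (subst (asm) summable_on_iff_abs_summable_on_real) simp
    then have "(\<Sum>x\<in>sites n. \<bar>b x s\<bar>) \<le> (\<Sum>\<^sub>\<infinity>x. \<bar>b x s\<bar>)" for n
      by (intro finite_sum_le_infsum sites_mono) auto
    then have "G s \<le> ennreal (\<Sum>\<^sub>\<infinity>x. \<bar>b x s\<bar>)"
      unfolding G_def by (intro SUP_least ennreal_leI)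
    also have "\<dots> < \<infinity>" by simp
    finally show False using G by simp
  qed
  have limit: "(\<lambda>n. indicator {s. G s < \<infinity>} s * (\<Sum>x\<in>sites n. b x s)) \<longlonglongrightarrow> (\<Sum>\<^sub>\<infinity>x. b x s)" for s
  proof (cases "G s < \<infinity>")
    case True
    then show ?thesis using sum_sites_tendsto[OF summable[OF True]] by simp
  next
    case False
    then show ?thesis using infsum_not_exists[OF not_summable[OF False]] by simp
  qed
  have AEG: "AE s in lborel. G s < \<infinity>"
    using nn_integral_PInf_AE[OF Gm Gint] by (simp add: top.not_eq_extremum)
  show ?thesis
  proof (rule integral_dominated_convergence[where w = "\<lambda>s. enn2real (G s)"])
    have Gset: "{s. G s < \<infinity>} \<in> sets lborel"
    proof -
      have "{s \<in> space lborel. G s < \<infinity>} \<in> sets lborel" using Gm by measurable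
      then show ?thesis by simp
    qed
    show "(\<lambda>s. \<Sum>\<^sub>\<infinity>x. b x s) \<in> borel_measurable lborel"
    proof (rule borel_measurable_LIMSEQ_real[OF limit])
      show "(\<lambda>s. indicator {s. G s < \<infinity>} s * (\<Sum>x\<in>sites n. b x s)) \<in> borel_measurable lborel" for n
        by (intro borel_measurable_times borel_measurable_sum borel_measurable_indicator Gset b)
    qed
    show "(\<lambda>s. \<Sum>x\<in>sites n. b x s) \<in> borel_measurable lborel" for n
      by (intro borel_measurable_sum b)
    show "integrable lborel (\<lambda>s. enn2real (G s))"
    proof (rule integrableI_bounded)
      show "(\<lambda>s. enn2real (G s)) \<in> borel_measurable lborel" using Gm by measurable
      have "(\<integral>\<^sup>+s. ennreal (norm (enn2real (G s))) \<partial>lborel) \<le> (\<integral>\<^sup>+s. G s \<partial>lborel)"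
        by (intro nn_integral_mono) (auto simp: ennreal_enn2real_if)
      also have "\<dots> < \<infinity>" using Gint by (simp add: top.not_eq_extremum)
      finally show "(\<integral>\<^sup>+s. ennreal (norm (enn2real (G s))) \<partial>lborel) < \<infinity>" .
    qed
    show "AE s in lborel. (\<lambda>n. \<Sum>x\<in>sites n. b x s) \<longlonglongrightarrow> (\<Sum>\<^sub>\<infinity>x. b x s)"
      using AEG by eventually_elim (use sum_sites_tendsto summable in blast)
    show "AE s in lborel. norm (\<Sum>x\<in>sites n. b x s) \<le> enn2real (G s)" for n
      using AEG
    proof eventually_elim
      case (elim s)
      have "norm (\<Sum>x\<in>sites n. b x s) \<le> (\<Sum>x\<in>sites n. \<bar>b x s\<bar>)" by (simp add: sum_abs)
      then show ?case using le[OF elim, of n] by linarith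
    qed
  qed
qed

lemma observable_local:
  assumes "\<And>i. i \<in> {x..x + int l} \<Longrightarrow> \<eta> i = \<xi> i" "2 \<le> l"
  shows "observable l x \<eta> = observable l x \<xi>"
proof -
  have e: "shift x \<eta> (int y) = shift x \<xi> (int y)" if "y < l" for y
    using that by (simp add: shift_def assms(1))
  have "block_average l (shift x \<eta>) = block_average l (shift x \<xi>)"
    unfolding block_average_def by (simp add: e)
  moreover have "shift x \<eta> 0 = shift x \<xi> 0" "shift x \<eta> 1 = shift x \<xi> 1"
    using e[of 0] e[of 1] assms(2) by auto
  ultimately show ?thesis
    unfolding observable_def shift_fun_def local_product_def block_quadratic_def by simp
qed

lemma observable_measurable: "observable l x \<in> borel_measurable borel"
  unfolding observable_def shift_fun_def[abs_def] local_product_def block_quadratic_def block_average_def shift_def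
  by measurable

lemma local_observables:
  assumes t: "0 \<le> t" and l: "2 \<le> l" and v: "\<And>x. continuous_on {0..t} (\<lambda>s. v s x)"
  shows "local_observable t (sites n) v (observable l) {- int n..int n + int l}"
    and "local_observable t (sites n) (\<lambda>s x. \<bar>v s x\<bar>) (\<lambda>x \<eta>. \<bar>observable l x \<eta>\<bar>) {- int n..int n + int l}"
proof -
  have loc: "observable l x \<eta> = observable l x \<xi>"
    if "x \<in> sites n" "\<And>i. i \<in> {- int n..int n + int l} \<Longrightarrow> \<eta> i = \<xi> i" for x \<eta> \<xi>
  proof (rule observable_local[OF _ l])
    fix i assume "i \<in> {x..x + int l}"
    then show "\<eta> i = \<xi> i" using that(1) by (intro that(2)) (auto simp: sites_def)
  qed
  show "local_observable t (sites n) v (observable l) {- int n..int n + int l}"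
    by (intro local_observable.intro t v observable_measurable loc) (auto simp: sites_def)
  show "local_observable t (sites n) (\<lambda>s x. \<bar>v s x\<bar>) (\<lambda>x \<eta>. \<bar>observable l x \<eta>\<bar>) {- int n..int n + int l}"
  proof (rule local_observable.intro)
    show "(\<lambda>\<eta>. \<bar>observable l x \<eta>\<bar>) \<in> borel_measurable borel" for x
      using observable_measurable by measurable
    show "\<bar>observable l x \<eta>\<bar> = \<bar>observable l x \<xi>\<bar>"
      if "x \<in> sites n" "\<And>i. i \<in> {- int n..int n + int l} \<Longrightarrow> \<eta> i = \<xi> i" for x \<eta> \<xi>
      using loc[OF that] by simp
    show "continuous_on {0..t} (\<lambda>s. \<bar>v s x\<bar>)" for x by (intro continuous_intros v)
  qed (simp_all add: t sites_def)
qed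

text \<open>
  Every moment is bounded by its power of \<open>1 / \<alpha>\<close> times a polynomial in \<open>A\<close> and \<open>\<rho>\<close>: with
  \<open>\<chi> \<le> D / \<alpha>\<close> the third central moment is at most \<open>k3 / \<alpha>\<^sup>2\<close>, the bond moment at most \<open>c4 / \<alpha>\<^sup>2\<close> and the
  fourth central moment at most \<open>cm / \<alpha>\<^sup>3\<close>.
\<close>

lemma constant_bound:
  assumes A: "\<alpha> \<le> A" "0 < A" and l: "2 \<le> l" and L: "0 < real L" and t: "0 \<le> t"
    and D: "D = \<rho> * (A + \<rho>)" and k3: "k3 = \<rho> * (2 * D + A * (A + \<rho>))"
    and c4: "c4 = (A + \<rho>) * (k3 + \<rho> * D * A) + \<rho> * (k3 + (A + \<rho>) * (D * A)) + 2 * D\<^sup>2"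
    and cm: "cm = \<rho> * (3 * k3 + 3 * (D * A) + 3 * ((A + \<rho>) * (D * A)) + (A + \<rho>) * A\<^sup>2)"
  shows "variance_const L t l \<le>
    (96 * D\<^sup>2 * (A + 1) + 64 * c4 + 4 * (D\<^sup>2 * A + cm)) / (\<alpha> ^ 3 * (real L)\<^sup>2) *
      (1 / \<alpha> + (real l)\<^sup>2 / (\<alpha> * real l + 1) + t * (real L)\<^sup>2 / (real l)\<^sup>2)"
proof -
  define c where "c = \<alpha> * chi \<alpha> \<rho>"
  define Y where "Y = (real l)\<^sup>2 / (\<alpha> * real l + 1)"
  note pos = alpha_pos rho_pos
  have c: "c = \<rho> * (\<alpha> + \<rho>)" using pos by (simp add: c_def chi_eq)
  have c0: "0 \<le> c" using pos by (simp add: c)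
  have cD: "c \<le> D" unfolding c D using pos A by (intro mult_left_mono) auto
  have D0: "0 \<le> D" using c0 cD by linarith
  have k3': "\<alpha>\<^sup>2 * kappa3 = \<rho> * (2 * c + \<alpha> * (\<alpha> + \<rho>))"
    using pos by (simp add: kappa3_def c_def power2_eq_square field_simps)
  have k3le: "\<alpha>\<^sup>2 * kappa3 \<le> k3"
    unfolding k3' k3 using pos A cD by (intro mult_left_mono add_mono mult_mono) auto
  have k30: "0 \<le> \<alpha>\<^sup>2 * kappa3" using moment_constants_nonneg by simp
  have k30': "0 \<le> k3" using k30 k3le by linarith
  have ca: "\<alpha> * c \<le> D * A" using pos A cD c0 D0 by (subst mult.commute) (intro mult_mono, auto)
  have ca0: "0 \<le> \<alpha> * c" using pos c0 by simp
  have ca': "\<rho> * (\<alpha> * c) \<le> \<rho> * D * A" using mult_left_mono[OF ca, of \<rho>] pos by (simp add: mult.assoc)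
  have "\<alpha>\<^sup>2 * bond_moment = (\<alpha> + \<rho>) * (\<alpha>\<^sup>2 * kappa3 + \<rho> * (\<alpha> * c)) + \<rho> * (\<alpha>\<^sup>2 * kappa3 + (\<alpha> + \<rho>) * (\<alpha> * c)) + 2 * c\<^sup>2"
    unfolding bond_moment_def c_def by algebra
  also have "\<dots> \<le> c4"
    unfolding c4
  proof (intro add_mono mult_left_mono power_mono)
    show "(\<alpha> + \<rho>) * (\<alpha>\<^sup>2 * kappa3 + \<rho> * (\<alpha> * c)) \<le> (A + \<rho>) * (k3 + \<rho> * D * A)"
    proof (rule mult_mono)
      show "\<alpha>\<^sup>2 * kappa3 + \<rho> * (\<alpha> * c) \<le> k3 + \<rho> * D * A" using k3le ca' by linarith
      show "0 \<le> \<alpha>\<^sup>2 * kappa3 + \<rho> * (\<alpha> * c)" using k30 ca0 pos by (simp add: add_nonneg_nonneg)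
    qed (use pos A in auto)
    show "(\<alpha> + \<rho>) * (\<alpha> * c) \<le> (A + \<rho>) * (D * A)"
      by (rule mult_mono[OF _ ca _ ca0]) (use pos A in auto)
  qed (use pos cD c0 k3le in auto)
  finally have bm_le: "\<alpha>\<^sup>2 * bond_moment \<le> c4" .
  have c40: "0 \<le> c4" using bm_le moment_constants_nonneg(4) by (meson mult_nonneg_nonneg order_trans zero_le_power2)
  have "\<alpha> ^ 3 * mu4 = \<rho> * (3 * (\<alpha>\<^sup>2 * kappa3) + 3 * (\<alpha> * c) + 3 * ((\<alpha> + \<rho>) * (\<alpha> * c)) + (\<alpha> + \<rho>) * \<alpha>\<^sup>2)"
    using pos by (simp add: mu4_def c_def power3_eq_cube power2_eq_square field_simps)
  also have "\<dots> \<le> cm"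
    unfolding cm
  proof (rule mult_left_mono)
    have "(\<alpha> + \<rho>) * (\<alpha> * c) \<le> (A + \<rho>) * (D * A)"
      by (rule mult_mono[OF _ ca _ ca0]) (use pos A in auto)
    moreover have "(\<alpha> + \<rho>) * \<alpha>\<^sup>2 \<le> (A + \<rho>) * A\<^sup>2"
      by (rule mult_mono[OF _ power_mono]) (use pos A in auto)
    ultimately show "3 * (\<alpha>\<^sup>2 * kappa3) + 3 * (\<alpha> * c) + 3 * ((\<alpha> + \<rho>) * (\<alpha> * c)) + (\<alpha> + \<rho>) * \<alpha>\<^sup>2 \<le>
        3 * k3 + 3 * (D * A) + 3 * ((A + \<rho>) * (D * A)) + (A + \<rho>) * A\<^sup>2"
      using k3le ca by linarith
  qed (use pos in simp)
  finally have mu4le: "\<alpha> ^ 3 * mu4 \<le> cm" .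
  have cm0: "0 \<le> cm" using mu4le moment_constants_nonneg(3) pos by (meson mult_nonneg_nonneg order_trans zero_le_power less_imp_le)
  have chile: "\<alpha> ^ 3 * (chi \<alpha> \<rho>)\<^sup>2 \<le> D\<^sup>2 * A"
  proof -
    have "\<alpha> ^ 3 * (chi \<alpha> \<rho>)\<^sup>2 = c\<^sup>2 * \<alpha>" unfolding c_def by (simp add: power3_eq_cube power2_eq_square)
    also have "\<dots> \<le> D\<^sup>2 * A" by (rule mult_mono[OF power_mono]) (use cD c0 A pos in auto)
    finally show ?thesis .
  qed
  have flux: "\<alpha> * flux_const l \<le> 6 * D\<^sup>2 * real l + 4 * c4 * (1 / \<alpha>)"
  proof -
    have "\<alpha> * flux_const l = 6 * c\<^sup>2 * real l + 4 * (\<alpha> * bond_moment)"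
      unfolding flux_const_def c[symmetric] by (simp add: c_def power2_eq_square algebra_simps)
    moreover have "6 * c\<^sup>2 * real l \<le> 6 * D\<^sup>2 * real l"
      using cD c0 by (intro mult_right_mono mult_left_mono power_mono) auto
    moreover have "\<alpha> * bond_moment \<le> c4 * (1 / \<alpha>)" using bm_le pos by (simp add: field_simps power2_eq_square)
    ultimately show ?thesis by linarith
  qed
  have Y: "real l \<le> (A + 1) * Y"
  proof -
    have "\<alpha> * real l + 1 \<le> (A + 1) * real l"
    proof -
      have "\<alpha> * real l \<le> A * real l" using A by (intro mult_right_mono) auto
      moreover have "1 \<le> real l" using l by simp
      ultimately show ?thesis unfolding distrib_right mult_1 by linarith
    qed
    then have "real l * (\<alpha> * real l + 1) \<le> real l * ((A + 1) * real l)" by (intro mult_left_mono) auto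
    moreover have "0 < \<alpha> * real l + 1" using pos by (simp add: add_nonneg_pos)
    ultimately show ?thesis unfolding Y_def by (simp add: pos_le_divide_eq power2_eq_square mult_ac)
  qed
  have Y0: "0 \<le> Y" unfolding Y_def using pos by (intro divide_nonneg_nonneg) auto
  define u where "u = t * (real L)\<^sup>2 / (real l)\<^sup>2"
  have u0: "0 \<le> u" unfolding u_def using t by simp
  define a1 where "a1 = 96 * D\<^sup>2 * (A + 1)"
  define a2 where "a2 = 64 * c4"
  define a3 where "a3 = 4 * (D\<^sup>2 * A + cm)"
  have a: "0 \<le> a1" "0 \<le> a2" "0 \<le> a3" using A c40 cm0 by (auto simp: a1_def a2_def a3_def)
  have "\<alpha> ^ 3 * (real L)\<^sup>2 * variance_const L t l = 16 * (\<alpha> * flux_const l) + 4 * (\<alpha> ^ 3 * (chi \<alpha> \<rho>)\<^sup>2 + \<alpha> ^ 3 * mu4) * u"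
    unfolding variance_const_def u_def using pos L l by (simp add: field_simps power3_eq_cube power2_eq_square)
  also have "\<dots> \<le> 16 * (6 * D\<^sup>2 * ((A + 1) * Y) + 4 * c4 * (1 / \<alpha>)) + 4 * (D\<^sup>2 * A + cm) * u"
  proof (intro add_mono mult_left_mono mult_right_mono)
    have "6 * D\<^sup>2 * real l \<le> 6 * D\<^sup>2 * ((A + 1) * Y)" using Y by (intro mult_left_mono) auto
    then show "\<alpha> * flux_const l \<le> 6 * D\<^sup>2 * ((A + 1) * Y) + 4 * c4 * (1 / \<alpha>)" using flux by linarith
  qed (use chile mu4le u0 in auto)
  also have "\<dots> = a1 * Y + a2 * (1 / \<alpha>) + a3 * u" by (simp add: a1_def a2_def a3_def algebra_simps)
  also have "\<dots> \<le> (a1 + a2 + a3) * Y + (a1 + a2 + a3) * (1 / \<alpha>) + (a1 + a2 + a3) * u"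
    using a Y0 u0 pos by (intro add_mono mult_right_mono) auto
  also have "\<dots> = (a1 + a2 + a3) * (1 / \<alpha> + Y + u)" by (simp only: distrib_left add_ac)
  finally have "\<alpha> ^ 3 * (real L)\<^sup>2 * variance_const L t l \<le> (a1 + a2 + a3) * (1 / \<alpha> + Y + u)" .
  moreover have "0 < \<alpha> ^ 3 * (real L)\<^sup>2" using pos L by simp
  moreover have "0 < k \<Longrightarrow> k * x \<le> y * z \<Longrightarrow> x \<le> y / k * z" for k x y z :: real
    by (simp add: field_simps)
  ultimately show ?thesis unfolding a1_def a2_def a3_def Y_def u_def by blast
qed

lemma limit_second_moment:
  assumes lim: "limit_law \<alpha> \<beta> \<rho> L P" "0 < \<beta>" "\<beta>\<^sup>2 \<le> real L"
    and t: "0 \<le> t" and l: "2 \<le> l" and v: "\<And>x. continuous_on {0..t} (\<lambda>s. v s x)"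
    and c: "0 \<le> variance_const L t l * integral {0..t} (\<lambda>s. \<Sum>x\<in>sites n. (v s x)\<^sup>2)"
  shows "(\<integral>\<^sup>+w. ennreal ((LBINT s:{0..t}. \<Sum>x\<in>sites n. v s x * observable l x (w s))\<^sup>2) \<partial>P) \<le>
    ennreal (variance_const L t l * integral {0..t} (\<lambda>s. \<Sum>x\<in>sites n. (v s x)\<^sup>2))"
proof -
  interpret lo: local_observable t "sites n" v "observable l" "{- int n..int n + int l}"
    by (rule local_observables(1)[OF t l v])
  have I: "lo.I w = (LBINT s:{0..t}. \<Sum>x\<in>sites n. v s x * observable l x (w s))" for w
    by (simp only: lo.I_def lo.H_def)
  show ?thesis
    unfolding I[symmetric]
  proof (rule lo.limit_law_bound[OF lim(1) alpha_pos rho_pos lim(2,3), of "\<lambda>x. x\<^sup>2" _ "n + l"])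
    show "continuous_on UNIV (\<lambda>x :: real. x\<^sup>2)" by (intro continuous_intros)
    show "{- int n..int n + int l} \<subseteq> torus K" if "n + l \<le> K" for K
      using that by (auto simp: torus_def)
    show "(\<integral>\<^sup>+w. ennreal ((lo.I w)\<^sup>2) \<partial>N) \<le> ennreal (variance_const L t l * integral {0..t} (\<lambda>s. \<Sum>x\<in>sites n. (v s x)\<^sup>2))"
      if "torus_chain \<alpha> \<rho> \<beta> L K p N" "n + l \<le> K" for K p N
      unfolding I by (rule torus_chain.torus_second_moment[OF that(1) t l that(2) v])
  qed (use c in auto)
qed

lemma limit_first_moment:
  assumes lim: "limit_law \<alpha> \<beta> \<rho> L P" "0 < \<beta>" "\<beta>\<^sup>2 \<le> real L"
    and t: "0 \<le> t" and l: "2 \<le> l" and v: "\<And>x. continuous_on {0..t} (\<lambda>s. v s x)"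
    and c: "first_moment_const l * integral {0..t} (\<lambda>s. \<Sum>x\<in>sites n. \<bar>v s x\<bar>) \<le> c" "0 \<le> c"
  shows "(\<integral>\<^sup>+w. ennreal \<bar>LBINT s:{0..t}. \<Sum>x\<in>sites n. \<bar>v s x\<bar> * \<bar>observable l x (w s)\<bar>\<bar> \<partial>P) \<le> ennreal c"
proof -
  interpret lo: local_observable t "sites n" "\<lambda>s x. \<bar>v s x\<bar>" "\<lambda>x \<eta>. \<bar>observable l x \<eta>\<bar>" "{- int n..int n + int l}"
    by (rule local_observables(2)[OF t l v])
  have I: "lo.I w = (LBINT s:{0..t}. \<Sum>x\<in>sites n. \<bar>v s x\<bar> * \<bar>observable l x (w s)\<bar>)" for w
    by (simp only: lo.I_def lo.H_def)
  show ?thesis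
    unfolding I[symmetric]
  proof (rule lo.limit_law_bound[OF lim(1) alpha_pos rho_pos lim(2,3), of "\<lambda>x. \<bar>x\<bar>" _ "n + l"])
    show "continuous_on UNIV (\<lambda>x :: real. \<bar>x\<bar>)" by (intro continuous_intros)
    show "{- int n..int n + int l} \<subseteq> torus K" if "n + l \<le> K" for K
      using that by (auto simp: torus_def)
    show "(\<integral>\<^sup>+w. ennreal \<bar>lo.I w\<bar> \<partial>N) \<le> ennreal c"
      if "torus_chain \<alpha> \<rho> \<beta> L K p N" "n + l \<le> K" for K p N
    proof -
      have "(\<integral>\<^sup>+w. ennreal \<bar>lo.I w\<bar> \<partial>N) \<le> ennreal (first_moment_const l * integral {0..t} (\<lambda>s. \<Sum>x\<in>sites n. \<bar>v s x\<bar>))"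
        unfolding I by (rule torus_chain.torus_first_moment[OF that(1) t l that(2) v])
      also have "\<dots> \<le> ennreal c" by (rule ennreal_leI[OF c(1)])
      finally show ?thesis .
    qed
  qed (use c in auto)
qed

text \<open>
  The first moments of the time integrals of \<open>\<Sum> \<bar>v\<^sub>s\<^sub>,\<^sub>x\<bar> \<bar>g\<^sub>x\<bar>\<close> over \<open>\<bar>x\<bar> \<le> n\<close> are bounded uniformly in \<open>n\<close>, since
  \<open>v\<close> is bounded in \<open>\<ell>\<^sup>1\<close>. Hence the supremum over \<open>n\<close> is almost surely finite, and dominated convergence
  applies path by path.
\<close>

lemma limit_path_integral_tendsto:
  assumes lim: "limit_law \<alpha> \<beta> \<rho> L P" "0 < \<beta>" "\<beta>\<^sup>2 \<le> real L"
    and t: "0 \<le> t" and l: "2 \<le> l" and v: "\<And>x. continuous_on {0..t} (\<lambda>s. v s x)"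
    and v1: "\<And>s. s \<in> {0..t} \<Longrightarrow> v s \<in> ell1" "continuous_on {0..t} (\<lambda>s. ell1_norm (v s))"
  shows "AE w in P. (\<lambda>n. LBINT s:{0..t}. \<Sum>x\<in>sites n. v s x * observable l x (w s)) \<longlonglongrightarrow>
    (LBINT s:{0..t}. \<Sum>\<^sub>\<infinity>x. observable l x (w s) * v s x)"
proof -
  have P: "sets P = sets path_space" using lim by (simp add: limit_law_def)
  then have spP: "space P = cadlag_paths" using sets_eq_imp_space_eq[OF P] by simp
  define b where "b w x s = indicator {0..t} s * (v s x * observable l x (w s))" for w x s
  define A where "A n w = (LBINT s:{0..t}. \<Sum>x\<in>sites n. \<bar>v s x\<bar> * \<bar>observable l x (w s)\<bar>)" for n w
  define G where "G n w = (\<integral>\<^sup>+s. ennreal (\<Sum>x\<in>sites n. \<bar>b w x s\<bar>) \<partial>lborel)" for n w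
  define c where "c = first_moment_const l * integral {0..t} (\<lambda>s. ell1_norm (v s))"
  have oc: "0 \<le> first_moment_const l" using moment_constants_nonneg(1) by (simp add: first_moment_const_def)
  have c0: "0 \<le> c" unfolding c_def
    by (intro mult_nonneg_nonneg oc Henstock_Kurzweil_Integration.integral_nonneg
      integrable_continuous_interval v1 ell1_norm_nonneg)
  have GA: "G n w = ennreal \<bar>A n w\<bar>" and Am: "(\<lambda>w. ennreal \<bar>A n w\<bar>) \<in> borel_measurable P" if "w \<in> cadlag_paths" for n w
  proof -
    interpret lo: local_observable t "sites n" "\<lambda>s x. \<bar>v s x\<bar>" "\<lambda>x \<eta>. \<bar>observable l x \<eta>\<bar>" "{- int n..int n + int l}"
      by (rule local_observables(2)[OF t l v])
    have I: "lo.I = A n" by (rule ext) (simp only: lo.I_def lo.H_def A_def)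
    show "(\<lambda>w. ennreal \<bar>A n w\<bar>) \<in> borel_measurable P"
      using lo.measurable_I unfolding I measurable_cong_sets[OF P refl, symmetric] by measurable
    have e: "(\<Sum>x\<in>sites n. \<bar>b w x s\<bar>) = indicator {0..t} s *\<^sub>R lo.H s (w s)" for s
      by (simp add: b_def lo.H_def abs_mult sum_distrib_left)
    have H0: "0 \<le> indicator {0..t} s *\<^sub>R lo.H s (w s)" for s
      unfolding e[symmetric] by (intro sum_nonneg) simp
    have int: "integrable lborel (\<lambda>s. indicator {0..t} s *\<^sub>R lo.H s (w s))"
      using lo.set_integrable_H[OF that] unfolding set_integrable_def .
    have "G n w = ennreal (lo.I w)"
      unfolding G_def e lo.I_def set_lebesgue_integral_def
      by (rule nn_integral_eq_integral[OF int]) (use H0 in auto)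
    moreover have "0 \<le> lo.I w"
      unfolding lo.I_def set_lebesgue_integral_def by (intro Bochner_Integration.integral_nonneg H0)
    ultimately show "G n w = ennreal \<bar>A n w\<bar>" unfolding I by simp
  qed
  have Gm: "G n \<in> borel_measurable P" for n
  proof (cases "cadlag_paths = ({} :: (real \<Rightarrow> config) set)")
    case True
    then show ?thesis using spP by (simp add: measurable_empty_iff measurable_def)
  next
    case False
    then obtain w0 :: "real \<Rightarrow> config" where "w0 \<in> cadlag_paths" by blast
    from Am[OF this, of n] show ?thesis
      by (rule measurable_cong[THEN iffD1, rotated]) (use GA spP in auto)
  qed
  have inc: "incseq G"
    unfolding G_def
    by (intro incseq_SucI le_funI nn_integral_mono ennreal_leI sum_mono2) (auto simp: sites_def)
  have "(\<integral>\<^sup>+w. (SUP n. G n w) \<partial>P) = (SUP n. \<integral>\<^sup>+w. G n w \<partial>P)"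
    by (rule nn_integral_monotone_convergence_SUP[OF inc Gm])
  also have "\<dots> \<le> ennreal c"
  proof (rule SUP_least)
    fix n
    have "(\<integral>\<^sup>+w. G n w \<partial>P) = (\<integral>\<^sup>+w. ennreal \<bar>A n w\<bar> \<partial>P)"
      by (rule nn_integral_cong) (simp add: GA spP)
    also have "\<dots> \<le> ennreal c"
      unfolding A_def
    proof (rule limit_first_moment[OF lim t l v _ c0])
      have "integral {0..t} (\<lambda>s. \<Sum>x\<in>sites n. \<bar>v s x\<bar>) \<le> integral {0..t} (\<lambda>s. ell1_norm (v s))"
        using v v1 sum_abs_le_ell1_norm
        by (intro integral_le integrable_continuous_interval continuous_intros) (auto simp: sites_def)
      then show "first_moment_const l * integral {0..t} (\<lambda>s. \<Sum>x\<in>sites n. \<bar>v s x\<bar>) \<le> c"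
        unfolding c_def by (rule mult_left_mono[OF _ oc])
    qed
    finally show "(\<integral>\<^sup>+w. G n w \<partial>P) \<le> ennreal c" .
  qed
  finally have "(\<integral>\<^sup>+w. (SUP n. G n w) \<partial>P) \<noteq> \<infinity>" by (auto simp: top_unique)
  then have "AE w in P. (SUP n. G n w) \<noteq> \<infinity>"
    by (intro nn_integral_PInf_AE borel_measurable_SUP Gm) auto
  then show ?thesis using AE_space
  proof eventually_elim
    case (elim w)
    have w: "w \<in> cadlag_paths" using elim(2) spP by simp
    have "(\<lambda>n. \<integral>s. (\<Sum>x\<in>sites n. b w x s) \<partial>lborel) \<longlonglongrightarrow> (\<integral>s. (\<Sum>\<^sub>\<infinity>x. b w x s) \<partial>lborel)"
    proof (rule integral_series_tendsto)
      show "b w x \<in> borel_measurable lborel" for x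
      proof -
        interpret lo: local_observable t "{x}" v "observable l" "{x..x + int l}"
          by (intro local_observable.intro t v observable_measurable) (auto intro: observable_local[OF _ l])
        have "b w x = (\<lambda>s. indicator {0..t} s *\<^sub>R lo.H s (w s))" by (simp add: b_def lo.H_def fun_eq_iff)
        then show ?thesis using lo.measurable_section[OF w] by simp
      qed
      show "(SUP n. \<integral>\<^sup>+s. ennreal (\<Sum>x\<in>sites n. \<bar>b w x s\<bar>) \<partial>lborel) < \<infinity>"
        using elim(1) unfolding G_def by (simp only: top.not_eq_extremum infinity_ennreal_def)
    qed
    moreover have "(\<Sum>x\<in>sites n. b w x s) = indicator {0..t} s *\<^sub>R (\<Sum>x\<in>sites n. v s x * observable l x (w s))" for n s
      by (simp add: b_def sum_distrib_left)
    moreover have "(\<Sum>\<^sub>\<infinity>x. b w x s) = indicator {0..t} s *\<^sub>R (\<Sum>\<^sub>\<infinity>x. observable l x (w s) * v s x)" for s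
      unfolding b_def by (simp add: infsum_cmult_right' mult.commute)
    ultimately show ?case unfolding set_lebesgue_integral_def by (simp only:)
  qed
qed

lemma ell2_integral:
  fixes t :: real
  assumes v: "\<And>x. continuous_on {0..t} (\<lambda>s. v s x)"
    and v1: "\<And>s. s \<in> {0..t} \<Longrightarrow> v s \<in> ell1" "continuous_on {0..t} (\<lambda>s. ell1_norm (v s))"
  shows "integral {0..t} (\<lambda>s. \<Sum>x\<in>sites n. (v s x)\<^sup>2) \<le> (LBINT s:{0..t}. (ell2_norm (v s))\<^sup>2)"
proof -
  let ?V = "\<lambda>n s. \<Sum>x\<in>sites n. (v s x)\<^sup>2"
  have cV: "continuous_on {0..t} (?V n)" for n by (intro continuous_intros v)
  have iV: "set_integrable lborel {0..t} (?V n)" for n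
    by (rule borel_integrable_atLeastAtMost'[OF cV])
  have cN: "continuous_on {0..t} (\<lambda>s. (ell1_norm (v s))\<^sup>2)" by (intro continuous_intros v1)
  have iN: "set_integrable lborel {0..t} (\<lambda>s. (ell1_norm (v s))\<^sup>2)"
    by (rule borel_integrable_atLeastAtMost'[OF cN])
  have lim: "(\<lambda>n. indicator {0..t} s *\<^sub>R ?V n s) \<longlonglongrightarrow> indicator {0..t} s *\<^sub>R (ell2_norm (v s))\<^sup>2" for s
  proof (cases "s \<in> {0..t}")
    case True
    have "(\<lambda>n. ?V n s) \<longlonglongrightarrow> (ell2_norm (v s))\<^sup>2"
      unfolding ell1_square_summable(2)[OF v1(1)[OF True]]
      by (rule sum_sites_tendsto[OF ell1_square_summable(1)[OF v1(1)[OF True]]])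
    then show ?thesis using True by simp
  qed simp
  have i2: "set_integrable lborel {0..t} (\<lambda>s. (ell2_norm (v s))\<^sup>2)"
    unfolding set_integrable_def
  proof (rule Bochner_Integration.integrable_bound)
    show "integrable lborel (\<lambda>s. indicator {0..t} s *\<^sub>R (ell1_norm (v s))\<^sup>2)"
      using iN unfolding set_integrable_def .
    show "(\<lambda>s. indicator {0..t} s *\<^sub>R (ell2_norm (v s))\<^sup>2) \<in> borel_measurable lborel"
      by (rule borel_measurable_LIMSEQ_real[OF lim]) (use iV in \<open>auto simp: set_integrable_def\<close>)
    show "AE s in lborel. norm (indicator {0..t} s *\<^sub>R (ell2_norm (v s))\<^sup>2) \<le> norm (indicator {0..t} s *\<^sub>R (ell1_norm (v s))\<^sup>2)"
    proof (rule AE_I2)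
      fix s
      show "norm (indicator {0..t} s *\<^sub>R (ell2_norm (v s))\<^sup>2) \<le> norm (indicator {0..t} s *\<^sub>R (ell1_norm (v s))\<^sup>2)"
        using ell1_square_summable(3)[OF v1(1), of s] by (cases "s \<in> {0..t}") auto
    qed
  qed
  have "integral {0..t} (?V n) = (LBINT s:{0..t}. ?V n s)"
    by (rule set_borel_integral_eq_integral(2)[OF iV, symmetric])
  also have "\<dots> \<le> (LBINT s:{0..t}. (ell2_norm (v s))\<^sup>2)"
  proof (rule set_integral_mono[OF iV i2])
    fix s assume s: "s \<in> {0..t}"
    show "?V n s \<le> (ell2_norm (v s))\<^sup>2"
      unfolding ell1_square_summable(2)[OF v1(1)[OF s]]
      by (intro finite_sum_le_infsum ell1_square_summable(1)[OF v1(1)[OF s]]) (auto simp: sites_def)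
  qed
  finally show ?thesis .
qed

end

theorem proposition2p1:
  fixes A \<rho> :: real
  assumes "A > 0" and "\<rho> > 0"
  shows "\<exists>C>0. \<forall>(\<alpha>::real) (\<beta>::real) (L::nat) (P::(real \<Rightarrow> int \<Rightarrow> nat) measure)
            (l::nat) (T::real) (t::real) (v::real \<Rightarrow> int \<Rightarrow> real).
          0 < \<alpha> \<and> \<alpha> \<le> A \<and> 0 < \<beta> \<and> \<beta>\<^sup>2 \<le> real L \<and> limit_law \<alpha> \<beta> \<rho> L P \<and>
          2 \<le> l \<and> 0 < T \<and> t \<in> {0..T} \<and> smooth_ell1 T v \<longrightarrow>
          (\<integral>\<^sup>+ \<eta>. ennreal
             ((LBINT s:{0..t}.
                (\<Sum>\<^sub>\<infinity>x. shift_fun x (\<lambda>\<xi>. local_product \<rho> \<xi> - block_quadratic \<alpha> \<rho> l \<xi>) (\<eta> s) * v s x))\<^sup>2)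
             \<partial>P)
          \<le> ennreal
             (C / (\<alpha> ^ 3 * (real L)\<^sup>2)
              * (1 / \<alpha> + (real l)\<^sup>2 / (\<alpha> * real l + 1) + t * (real L)\<^sup>2 / (real l)\<^sup>2)
              * (LBINT s:{0..t}. (ell2_norm (v s))\<^sup>2))"
proof -
  define D where "D = \<rho> * (A + \<rho>)"
  define k3 where "k3 = \<rho> * (2 * D + A * (A + \<rho>))"
  define c4 where "c4 = (A + \<rho>) * (k3 + \<rho> * D * A) + \<rho> * (k3 + (A + \<rho>) * (D * A)) + 2 * D\<^sup>2"
  define cm where "cm = \<rho> * (3 * k3 + 3 * (D * A) + 3 * ((A + \<rho>) * (D * A)) + (A + \<rho>) * A\<^sup>2)"
  define C where "C = 96 * D\<^sup>2 * (A + 1) + 64 * c4 + 4 * (D\<^sup>2 * A + cm)"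
  have D: "0 < D" using assms by (simp add: D_def)
  have k3: "0 < k3" using assms D by (simp add: k3_def add_pos_pos)
  have "0 < c4" "0 < cm"
    unfolding c4_def cm_def using assms D k3 by (auto intro!: add_pos_pos mult_pos_pos)
  then have C: "0 < C" unfolding C_def using assms D by (auto intro!: add_pos_pos mult_pos_pos)
  show ?thesis
  proof (rule exI[of _ C], rule conjI[OF C], intro allI impI)
    fix \<alpha> \<beta> :: real and L :: nat and P :: "(real \<Rightarrow> int \<Rightarrow> nat) measure" and l :: nat
      and T t :: real and v :: "real \<Rightarrow> int \<Rightarrow> real"
    assume "0 < \<alpha> \<and> \<alpha> \<le> A \<and> 0 < \<beta> \<and> \<beta>\<^sup>2 \<le> real L \<and> limit_law \<alpha> \<beta> \<rho> L P \<and>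
          2 \<le> l \<and> 0 < T \<and> t \<in> {0..T} \<and> smooth_ell1 T v"
    then have \<alpha>: "0 < \<alpha>" "\<alpha> \<le> A" and \<beta>: "0 < \<beta>" "\<beta>\<^sup>2 \<le> real L" and lim: "limit_law \<alpha> \<beta> \<rho> L P"
      and l: "2 \<le> l" and t: "0 \<le> t" "t \<le> T" and smooth: "smooth_ell1 T v" by auto
    interpret inclusion_law \<alpha> \<rho> using \<alpha>(1) assms(2) by unfold_locales
    have L: "0 < real L" using \<beta> by (smt (verit) zero_less_power)
    have sub: "{0..t} \<subseteq> {0..T}" using t by auto
    have v: "continuous_on {0..t} (\<lambda>s. v s x)" for x
      by (rule continuous_on_subset[OF smooth_ell1_coord[OF smooth] sub])
    have v1: "\<And>s. s \<in> {0..t} \<Longrightarrow> v s \<in> ell1" "continuous_on {0..t} (\<lambda>s. ell1_norm (v s))"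
      using smooth_ell1_in[OF smooth] sub continuous_on_subset[OF smooth_ell1_norm[OF smooth] sub] by auto
    define V where "V = (LBINT s:{0..t}. (ell2_norm (v s))\<^sup>2)"
    define R where "R = 1 / \<alpha> + (real l)\<^sup>2 / (\<alpha> * real l + 1) + t * (real L)\<^sup>2 / (real l)\<^sup>2"
    define I where "I n w = (LBINT s:{0..t}. \<Sum>x\<in>sites n. v s x * observable l x (w s))" for n and w :: "real \<Rightarrow> config"
    have P: "sets P = sets path_space" using lim by (simp add: limit_law_def)
    have tc0: "0 \<le> variance_const L t l"
      unfolding variance_const_def using moment_constants_nonneg t by (intro add_nonneg_nonneg mult_nonneg_nonneg divide_nonneg_nonneg) auto
    have Vn0: "0 \<le> integral {0..t} (\<lambda>s. \<Sum>x\<in>sites n. (v s x)\<^sup>2)" for n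
      by (intro Henstock_Kurzweil_Integration.integral_nonneg integrable_continuous_interval continuous_intros v sum_nonneg) auto
    have bound: "(\<integral>\<^sup>+w. ennreal ((I n w)\<^sup>2) \<partial>P) \<le> ennreal (C / (\<alpha> ^ 3 * (real L)\<^sup>2) * R * V)" for n
    proof -
      have "(\<integral>\<^sup>+w. ennreal ((I n w)\<^sup>2) \<partial>P) \<le> ennreal (variance_const L t l * integral {0..t} (\<lambda>s. \<Sum>x\<in>sites n. (v s x)\<^sup>2))"
        unfolding I_def by (rule limit_second_moment[OF lim \<beta> t(1) l v mult_nonneg_nonneg[OF tc0 Vn0]])
      also have "variance_const L t l * integral {0..t} (\<lambda>s. \<Sum>x\<in>sites n. (v s x)\<^sup>2) \<le> C / (\<alpha> ^ 3 * (real L)\<^sup>2) * R * V"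
      proof (rule mult_mono)
        show le: "variance_const L t l \<le> C / (\<alpha> ^ 3 * (real L)\<^sup>2) * R"
          unfolding C_def R_def
          by (rule constant_bound[OF \<alpha>(2) assms(1) l L t(1) D_def k3_def c4_def cm_def])
        show "integral {0..t} (\<lambda>s. \<Sum>x\<in>sites n. (v s x)\<^sup>2) \<le> V"
          unfolding V_def by (rule ell2_integral[OF v v1])
        show "0 \<le> C / (\<alpha> ^ 3 * (real L)\<^sup>2) * R" using tc0 le by linarith
      qed (rule Vn0)
      finally show ?thesis by (simp add: ennreal_leI)
    qed
    have Im: "I n \<in> borel_measurable P" for n
    proof -
      interpret lo: local_observable t "sites n" v "observable l" "{- int n..int n + int l}"
        by (rule local_observables(1)[OF t(1) l v])
      have "lo.I = I n" by (rule ext) (simp only: lo.I_def lo.H_def I_def)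
      then show ?thesis using lo.measurable_I by (simp only: measurable_cong_sets[OF P refl])
    qed
    have "AE w in P. (\<lambda>n. I n w) \<longlonglongrightarrow> (LBINT s:{0..t}. \<Sum>\<^sub>\<infinity>x. observable l x (w s) * v s x)"
      unfolding I_def by (rule limit_path_integral_tendsto[OF lim \<beta> t(1) l v v1])
    then have "AE w in P. ennreal ((LBINT s:{0..t}. \<Sum>\<^sub>\<infinity>x. observable l x (w s) * v s x)\<^sup>2) = liminf (\<lambda>n. ennreal ((I n w)\<^sup>2))"
    proof eventually_elim
      case (elim w)
      then have "(\<lambda>n. ennreal ((I n w)\<^sup>2)) \<longlonglongrightarrow> ennreal ((LBINT s:{0..t}. \<Sum>\<^sub>\<infinity>x. observable l x (w s) * v s x)\<^sup>2)"
        by (intro tendsto_ennrealI tendsto_power)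
      then show ?case by (rule lim_imp_Liminf[OF trivial_limit_sequentially, symmetric])
    qed
    then have "(\<integral>\<^sup>+w. ennreal ((LBINT s:{0..t}. \<Sum>\<^sub>\<infinity>x. observable l x (w s) * v s x)\<^sup>2) \<partial>P) =
        (\<integral>\<^sup>+w. liminf (\<lambda>n. ennreal ((I n w)\<^sup>2)) \<partial>P)"
      by (rule nn_integral_cong_AE)
    also have "\<dots> \<le> liminf (\<lambda>n. \<integral>\<^sup>+w. ennreal ((I n w)\<^sup>2) \<partial>P)"
      by (rule nn_integral_liminf) (use Im in measurable)
    also have "\<dots> \<le> ennreal (C / (\<alpha> ^ 3 * (real L)\<^sup>2) * R * V)"
      using bound by (intro Liminf_le) (auto intro!: always_eventually)
    finally show "(\<integral>\<^sup>+ \<eta>. ennreal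
             ((LBINT s:{0..t}.
                (\<Sum>\<^sub>\<infinity>x. shift_fun x (\<lambda>\<xi>. local_product \<rho> \<xi> - block_quadratic \<alpha> \<rho> l \<xi>) (\<eta> s) * v s x))\<^sup>2)
             \<partial>P)
          \<le> ennreal
             (C / (\<alpha> ^ 3 * (real L)\<^sup>2)
              * (1 / \<alpha> + (real l)\<^sup>2 / (\<alpha> * real l + 1) + t * (real L)\<^sup>2 / (real l)\<^sup>2)
              * (LBINT s:{0..t}. (ell2_norm (v s))\<^sup>2))"
      unfolding observable_def R_def V_def .
  qed
qed

end
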